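(* Let $B$ be a nonzero unital ring of characteristic two, and fix $n\geq 4$. Suppose that (1) $\mathrm{GL}_{n-1}(B)=E_{n-1}(B)$ and $\mathrm{GL}_{n-2}(B)=E_{n-2}(B)$; (2) $j_{n-1}(N_{n-1}(B))=1$ in $\mathrm{St}_n(B)$; (3) the geometric realization $|X_n(B)|$ is simply connected. Then $\phi_n:\mathrm{St}_n(B)\to\mathrm{GL}_n(B)$ is an isomorphism.
   Context: Rings are associative and not necessarily commutative. Modules are right modules, and matrices act on columns from the left. Write $t_{ij}(a)=I+aE_{ij}$ ($i\ne j$, $a\in B$), and let $E_m(B)$ be the subgroup of $\mathrm{GL}_m(B)$ generated by these matrices. For $m\geq 3$, the Steinberg group $\mathrm{St}_m(B)$ has generators $X_{ij}(a)$, for $1\le i\ne j\le m$ and $a\in B$, and relations $X_{ij}(a)X_{ij}(b)=X_{ij}(a+b)$; $[X_{ij}(a),X_{kl}(b)]=1$ for $i\ne l$ and $j\ne k$; $[X_{ij}(a),X_{jk}(b)]=X_{ik}(ab)$ for distinct $i,j,k$; here $[x,y]=xyx^{-1}y^{-1}$. The homomorphism $\phi_m:\mathrm{St}_m(B)\to\mathrm{GL}_m(B)$ sends $X_{ij}(a)$ to $t_{ij}(a)$, and $N_m(B)=\ker\phi_m$. The standard stabilization homomorphism $j_m:\mathrm{St}_m(B)\to\mathrm{St}_{m+1}(B)$ is defined by $j_m(X_{ij}(a))=X_{ij}(a)$. The ordered frame semisimplicial set $X_n(B)$: its $p$-simplices are the tuples $(v_1,\ldots,v_k)$ of vectors in $B^n$,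 where $k=p+1\le n$, admitting a decomposition $B^n=v_1B\oplus\cdots\oplus v_kB\oplus C$ with $C\cong B^{n-k}$ as right modules, where each map $B\to v_iB$, $b\mapsto v_ib$, is required to be an isomorphism. The complement $C$ and its basis are not part of the data. The faces delete vectors, and there are no simplices in dimensions $p\ge n$. *)

theory Defs
  imports
    "HOL-Homology.Homology"
    "HOL-Algebra.Generated_Groups"
    "Jordan_Normal_Form.Matrix"
begin

hide_const (open) Finite_Cartesian_Product.vec Finite_Cartesian_Product.mat

section \<open>Groups given by generators and relations\<close>

text \<open>Words are lists of pairs (generator, sign), where the sign \<open>False\<close> stands for the formal
  inverse. A relation \<open>u = v\<close> is a pair \<open>(u, v)\<close> of words.\<close>

type_synonym 'g word = "('g \<times> bool) list"

definition words :: "'g set \<Rightarrow> 'g word set" where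
  "words S = {w. set w \<subseteq> S \<times> UNIV}"

definition word_inv :: "'g word \<Rightarrow> 'g word" where
  "word_inv w = rev (map (\<lambda>(g, e). (g, \<not> e)) w)"

definition word_comm :: "'g word \<Rightarrow> 'g word \<Rightarrow> 'g word" where
  "word_comm u v = u @ v @ word_inv u @ word_inv v"

inductive_set pres_rel :: "'g set \<Rightarrow> ('g word \<times> 'g word) set \<Rightarrow> ('g word \<times> 'g word) set"
  for S :: "'g set" and R :: "('g word \<times> 'g word) set" where
  rel: "(u, v) \<in> R \<Longrightarrow> u \<in> words S \<Longrightarrow> v \<in> words S \<Longrightarrow> (u, v) \<in> pres_rel S R"
| cancel: "g \<in> S \<Longrightarrow> ([(g, e), (g, \<not> e)], []) \<in> pres_rel S R"
| refl: "u \<in> words S \<Longrightarrow> (u, u) \<in> pres_rel S R"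
| sym: "(u, v) \<in> pres_rel S R \<Longrightarrow> (v, u) \<in> pres_rel S R"
| trans: "(u, v) \<in> pres_rel S R \<Longrightarrow> (v, w) \<in> pres_rel S R \<Longrightarrow> (u, w) \<in> pres_rel S R"
| append: "(u, v) \<in> pres_rel S R \<Longrightarrow> (u', v') \<in> pres_rel S R \<Longrightarrow> (u @ u', v @ v') \<in> pres_rel S R"

definition pres_class :: "'g set \<Rightarrow> ('g word \<times> 'g word) set \<Rightarrow> 'g word \<Rightarrow> 'g word set" where
  "pres_class S R w = pres_rel S R `` {w}"

definition presented_group :: "'g set \<Rightarrow> ('g word \<times> 'g word) set \<Rightarrow> 'g word set monoid" where
  "presented_group S R = \<lparr>
     carrier = words S // pres_rel S R,
     monoid.mult = (\<lambda>X Y. \<Union>u\<in>X. \<Union>v\<in>Y. pres_class S R (u @ v)),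
     one = pres_class S R []\<rparr>"

fun word_eval :: "('h, 'm) monoid_scheme \<Rightarrow> ('g \<Rightarrow> 'h) \<Rightarrow> 'g word \<Rightarrow> 'h" where
  "word_eval H f [] = \<one>\<^bsub>H\<^esub>"
| "word_eval H f ((g, e) # w) = (if e then f g else inv\<^bsub>H\<^esub> (f g)) \<otimes>\<^bsub>H\<^esub> word_eval H f w"

text \<open>The homomorphism out of a presented group determined by the images \<open>f g\<close> of the
  generators. It is meaningful when \<open>f\<close> respects the relations: see \<open>pres_lift_class\<close>,
  \<open>pres_lift_hom\<close> and \<open>pres_lift_gen\<close> below.\<close>

definition pres_lift :: "('h, 'm) monoid_scheme \<Rightarrow> ('g \<Rightarrow> 'h) \<Rightarrow> 'g word set \<Rightarrow> 'h" where
  "pres_lift H f X = the_elem (word_eval H f ` X)"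

lemma words_simps [simp]:
  "[] \<in> words S" "(x # w) \<in> words S \<longleftrightarrow> fst x \<in> S \<and> w \<in> words S"
  "u @ v \<in> words S \<longleftrightarrow> u \<in> words S \<and> v \<in> words S"
  by (simp_all add: words_def mem_Times_iff)

lemma word_inv_in_words [simp]: "word_inv w \<in> words S \<longleftrightarrow> w \<in> words S"
  by (induction w) (auto simp: word_inv_def)

lemma pres_rel_words: "(u, v) \<in> pres_rel S R \<Longrightarrow> u \<in> words S \<and> v \<in> words S"
  by (induction rule: pres_rel.induct) auto

lemma equiv_pres_rel: "equiv (words S) (pres_rel S R)"
proof (rule equivI)
  show "pres_rel S R \<subseteq> words S \<times> words S" using pres_rel_words by auto
  show "refl_on (words S) (pres_rel S R)" by (auto intro: refl_onI pres_rel.refl)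
  show "sym (pres_rel S R)" by (rule symI) (rule pres_rel.sym)
  show "trans (pres_rel S R)" by (rule transI) (rule pres_rel.trans)
qed

lemma pres_class_eq_iff:
  "u \<in> words S \<Longrightarrow> v \<in> words S \<Longrightarrow>
    pres_class S R u = pres_class S R v \<longleftrightarrow> (u, v) \<in> pres_rel S R"
  unfolding pres_class_def by (rule eq_equiv_class_iff[OF equiv_pres_rel])

lemma pres_class_self: "w \<in> words S \<Longrightarrow> w \<in> pres_class S R w"
  by (simp add: pres_class_def pres_rel.refl)

lemma pres_class_in_carrier: "w \<in> words S \<Longrightarrow> pres_class S R w \<in> carrier (presented_group S R)"
  by (simp add: presented_group_def pres_class_def quotientI)

lemma presented_group_cases:
  assumes "X \<in> carrier (presented_group S R)"
  obtains w where "w \<in> words S" "X = pres_class S R w"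
  using assms unfolding presented_group_def pres_class_def by (auto elim: quotientE)

lemma one_presented_group: "\<one>\<^bsub>presented_group S R\<^esub> = pres_class S R []"
  by (simp add: presented_group_def)

lemma mult_presented_group:
  assumes "u \<in> words S" "v \<in> words S"
  shows "pres_class S R u \<otimes>\<^bsub>presented_group S R\<^esub> pres_class S R v = pres_class S R (u @ v)"
proof -
  have eq: "pres_class S R (u' @ v') = pres_class S R (u @ v)"
    if "u' \<in> pres_class S R u" "v' \<in> pres_class S R v" for u' v'
  proof -
    have "(u, u') \<in> pres_rel S R" "(v, v') \<in> pres_rel S R"
      using that by (auto simp: pres_class_def)
    then have "(u' @ v', u @ v) \<in> pres_rel S R"
      by (intro pres_rel.append pres_rel.sym[of u u'] pres_rel.sym[of v v'])
    then show ?thesis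
      unfolding pres_class_def by (rule equiv_class_eq[OF equiv_pres_rel])
  qed
  have "(\<Union>u'\<in>pres_class S R u. \<Union>v'\<in>pres_class S R v. pres_class S R (u' @ v')) =
      (\<Union>u'\<in>pres_class S R u. \<Union>v'\<in>pres_class S R v. pres_class S R (u @ v))"
    using eq by simp
  also have "\<dots> = pres_class S R (u @ v)"
    using pres_class_self[OF assms(1), of R] pres_class_self[OF assms(2), of R]
    by (metis SUP_const empty_iff)
  finally show ?thesis by (simp add: presented_group_def)
qed

lemma word_inv_cancel: "w \<in> words S \<Longrightarrow> (word_inv w @ w, []) \<in> pres_rel S R"
proof (induction w)
  case Nil
  then show ?case by (simp add: word_inv_def pres_rel.refl)
next
  case (Cons x w)
  obtain g e where x: "x = (g, e)" by (cases x)
  have g: "g \<in> S" and w: "w \<in> words S" using Cons.prems x by auto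
  have "([(g, \<not> e), (g, e)], []) \<in> pres_rel S R"
    using pres_rel.cancel[OF g, of "\<not> e" R] by simp
  then have "(word_inv w @ [(g, \<not> e), (g, e)] @ w, word_inv w @ [] @ w) \<in> pres_rel S R"
    using w by (intro pres_rel.append pres_rel.refl) simp_all
  then have "(word_inv (x # w) @ x # w, word_inv w @ w) \<in> pres_rel S R"
    unfolding x by (simp add: word_inv_def)
  then show ?case by (rule pres_rel.trans) (rule Cons.IH[OF w])
qed

lemma group_presented_group: "group (presented_group S R)"
proof (rule groupI)
  fix X Y assume "X \<in> carrier (presented_group S R)" "Y \<in> carrier (presented_group S R)"
  then show "X \<otimes>\<^bsub>presented_group S R\<^esub> Y \<in> carrier (presented_group S R)"
    by (elim presented_group_cases) (simp add: mult_presented_group pres_class_in_carrier)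
next
  show "\<one>\<^bsub>presented_group S R\<^esub> \<in> carrier (presented_group S R)"
    by (simp add: one_presented_group pres_class_in_carrier)
next
  fix X Y Z
  assume "X \<in> carrier (presented_group S R)" "Y \<in> carrier (presented_group S R)"
    "Z \<in> carrier (presented_group S R)"
  then show "X \<otimes>\<^bsub>presented_group S R\<^esub> Y \<otimes>\<^bsub>presented_group S R\<^esub> Z =
      X \<otimes>\<^bsub>presented_group S R\<^esub> (Y \<otimes>\<^bsub>presented_group S R\<^esub> Z)"
    by (elim presented_group_cases) (simp add: mult_presented_group)
next
  fix X assume "X \<in> carrier (presented_group S R)"
  then show "\<one>\<^bsub>presented_group S R\<^esub> \<otimes>\<^bsub>presented_group S R\<^esub> X = X"
    by (elim presented_group_cases) (simp add: mult_presented_group one_presented_group)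
next
  fix X assume "X \<in> carrier (presented_group S R)"
  then obtain w where w: "w \<in> words S" "X = pres_class S R w" by (elim presented_group_cases)
  have "pres_class S R (word_inv w) \<otimes>\<^bsub>presented_group S R\<^esub> X = \<one>\<^bsub>presented_group S R\<^esub>"
    using w word_inv_cancel[OF w(1), of R]
    by (simp add: mult_presented_group one_presented_group pres_class_eq_iff)
  then show "\<exists>Y\<in>carrier (presented_group S R).
      Y \<otimes>\<^bsub>presented_group S R\<^esub> X = \<one>\<^bsub>presented_group S R\<^esub>"
    using w by (auto intro!: bexI[of _ "pres_class S R (word_inv w)"] pres_class_in_carrier)
qed

lemma word_eval_closed:
  "group H \<Longrightarrow> f \<in> S \<rightarrow> carrier H \<Longrightarrow> w \<in> words S \<Longrightarrow> word_eval H f w \<in> carrier H"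
  by (induction w) (auto intro!: monoid.m_closed group.is_monoid group.inv_closed)

lemma word_eval_append:
  "group H \<Longrightarrow> f \<in> S \<rightarrow> carrier H \<Longrightarrow> u \<in> words S \<Longrightarrow> v \<in> words S \<Longrightarrow>
    word_eval H f (u @ v) = word_eval H f u \<otimes>\<^bsub>H\<^esub> word_eval H f v"
proof (induction u)
  case Nil
  then show ?case
    by (simp add: word_eval_closed group.is_monoid monoid.l_one)
next
  case (Cons x u)
  interpret group H by fact
  obtain g e where x: "x = (g, e)" by (cases x)
  have "f g \<in> carrier H" using Cons.prems x by auto
  moreover have "word_eval H f u \<in> carrier H" "word_eval H f v \<in> carrier H"
    using Cons.prems word_eval_closed by fastforce+
  ultimately show ?case using Cons x by (simp add: m_assoc)
qed

lemma word_eval_cong: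
  assumes "group H" "f \<in> S \<rightarrow> carrier H"
    and resp: "\<forall>(u, v)\<in>R \<inter> words S \<times> words S. word_eval H f u = word_eval H f v"
    and "(u, v) \<in> pres_rel S R"
  shows "word_eval H f u = word_eval H f v"
  using assms(4)
proof (induction rule: pres_rel.induct)
  case (cancel g e)
  interpret group H by fact
  have "f g \<in> carrier H" using cancel assms(2) by auto
  then show ?case by (simp add: r_inv l_inv)
next
  case (append u v u' v')
  then show ?case
    using pres_rel_words[OF append.hyps(1)] pres_rel_words[OF append.hyps(2)]
    by (simp add: word_eval_append[OF assms(1,2)])
next
  case (rel u v)
  then show ?case using resp by blast
qed simp_all

lemma pres_lift_class:
  assumes "group H" "f \<in> S \<rightarrow> carrier H"
    and "\<forall>(u, v)\<in>R \<inter> words S \<times> words S. word_eval H f u = word_eval H f v"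
    and "w \<in> words S"
  shows "pres_lift H f (pres_class S R w) = word_eval H f w"
proof -
  have "word_eval H f w' = word_eval H f w" if "w' \<in> pres_class S R w" for w'
  proof -
    have "(w, w') \<in> pres_rel S R" using that unfolding pres_class_def by blast
    then show ?thesis by (rule word_eval_cong[OF assms(1-3), symmetric])
  qed
  then have "word_eval H f ` pres_class S R w = {word_eval H f w}"
    using pres_class_self[OF assms(4), of R] by blast
  then show ?thesis unfolding pres_lift_def by (simp only: the_elem_eq)
qed

lemma pres_lift_hom:
  assumes "group H" "f \<in> S \<rightarrow> carrier H"
    and "\<forall>(u, v)\<in>R \<inter> words S \<times> words S. word_eval H f u = word_eval H f v"
  shows "pres_lift H f \<in> hom (presented_group S R) H"
proof (rule homI)
  fix X assume "X \<in> carrier (presented_group S R)"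
  then obtain w where w: "w \<in> words S" "X = pres_class S R w" by (elim presented_group_cases)
  show "pres_lift H f X \<in> carrier H"
    unfolding w(2) pres_lift_class[OF assms w(1)] by (rule word_eval_closed[OF assms(1,2) w(1)])
next
  fix X Y assume "X \<in> carrier (presented_group S R)" "Y \<in> carrier (presented_group S R)"
  then obtain u v where uv: "u \<in> words S" "v \<in> words S"
    and XY: "X = pres_class S R u" "Y = pres_class S R v"
    by (elim presented_group_cases)
  have "pres_lift H f (X \<otimes>\<^bsub>presented_group S R\<^esub> Y) = word_eval H f (u @ v)"
    unfolding XY mult_presented_group[OF uv] by (rule pres_lift_class[OF assms]) (simp_all add: uv)
  also have "\<dots> = word_eval H f u \<otimes>\<^bsub>H\<^esub> word_eval H f v"
    by (rule word_eval_append[OF assms(1,2) uv])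
  also have "word_eval H f u = pres_lift H f X"
    unfolding XY by (rule pres_lift_class[OF assms uv(1), symmetric])
  also have "word_eval H f v = pres_lift H f Y"
    unfolding XY by (rule pres_lift_class[OF assms uv(2), symmetric])
  finally show "pres_lift H f (X \<otimes>\<^bsub>presented_group S R\<^esub> Y) =
      pres_lift H f X \<otimes>\<^bsub>H\<^esub> pres_lift H f Y" .
qed

lemma pres_lift_gen:
  assumes "group H" "f \<in> S \<rightarrow> carrier H"
    and "\<forall>(u, v)\<in>R \<inter> words S \<times> words S. word_eval H f u = word_eval H f v"
    and "g \<in> S"
  shows "pres_lift H f (pres_class S R [(g, True)]) = f g"
proof -
  interpret group H by fact
  have "f g \<in> carrier H" using assms(2,4) by auto
  moreover have "pres_lift H f (pres_class S R [(g, True)]) = word_eval H f [(g, True)]"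
    by (rule pres_lift_class[OF assms(1-3)]) (simp_all add: assms(4))
  ultimately show ?thesis by simp
qed

lemma word_eval_presented:
  "w \<in> words S \<Longrightarrow>
    word_eval (presented_group S R) (\<lambda>g. pres_class S R [(g, True)]) w = pres_class S R w"
proof (induction w)
  case Nil
  then show ?case by (simp add: one_presented_group)
next
  case (Cons x w)
  interpret group "presented_group S R" by (rule group_presented_group)
  obtain g e where x: "x = (g, e)" by (cases x)
  have g: "g \<in> S" and w: "w \<in> words S" using Cons.prems x by auto
  have "pres_class S R [(g, False)] \<otimes>\<^bsub>presented_group S R\<^esub> pres_class S R [(g, True)] =
      \<one>\<^bsub>presented_group S R\<^esub>"
    using g pres_rel.cancel[OF g, of False R]
    by (simp add: mult_presented_group one_presented_group pres_class_eq_iff)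
  then have "inv\<^bsub>presented_group S R\<^esub> pres_class S R [(g, True)] = pres_class S R [(g, False)]"
    using g by (intro inv_equality pres_class_in_carrier) simp_all
  then show ?case using Cons.IH[OF w] g w by (cases e) (simp_all add: x mult_presented_group)
qed

section \<open>Linear groups and Steinberg groups\<close>

text \<open>Matrix indices run over \<open>{0..<m}\<close>, following the matrix library.\<close>

definition GL :: "'b::ring_1 itself \<Rightarrow> nat \<Rightarrow> 'b mat monoid" where
  "GL TB m = units_of (ring_mat TB m ())"

definition mat_unit :: "nat \<Rightarrow> nat \<Rightarrow> nat \<Rightarrow> 'b::ring_1 \<Rightarrow> 'b mat" where
  "mat_unit m i j a = Matrix.mat m m (\<lambda>(r, c). if r = i \<and> c = j then a else 0)"

definition transv :: "nat \<Rightarrow> nat \<Rightarrow> nat \<Rightarrow> 'b::ring_1 \<Rightarrow> 'b mat" where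
  "transv m i j a = 1\<^sub>m m + mat_unit m i j a"

definition elem_group :: "'b::ring_1 itself \<Rightarrow> nat \<Rightarrow> 'b mat set" where
  "elem_group TB m = generate (GL TB m) {transv m i j a | i j a. i < m \<and> j < m \<and> i \<noteq> j}"

type_synonym 'b st_gen = "nat \<times> nat \<times> 'b"

definition st_gens :: "'b itself \<Rightarrow> nat \<Rightarrow> 'b st_gen set" where
  "st_gens TB m = {(i, j, a) | i j a. i < m \<and> j < m \<and> i \<noteq> j}"

definition x_word :: "nat \<Rightarrow> nat \<Rightarrow> 'b \<Rightarrow> 'b st_gen word" where
  "x_word i j a = [((i, j, a), True)]"

definition st_rels :: "'b::ring_1 itself \<Rightarrow> nat \<Rightarrow> ('b st_gen word \<times> 'b st_gen word) set" where
  "st_rels TB m =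
     {(x_word i j a @ x_word i j b, x_word i j (a + b)) | i j a b.
        i < m \<and> j < m \<and> i \<noteq> j} \<union>
     {(word_comm (x_word i j a) (x_word k l b), []) | i j k l a b.
        i < m \<and> j < m \<and> k < m \<and> l < m \<and> i \<noteq> j \<and> k \<noteq> l \<and> i \<noteq> l \<and> j \<noteq> k} \<union>
     {(word_comm (x_word i j a) (x_word j k b), x_word i k (a * b)) | i j k a b.
        i < m \<and> j < m \<and> k < m \<and> i \<noteq> j \<and> j \<noteq> k \<and> i \<noteq> k}"

definition St :: "'b::ring_1 itself \<Rightarrow> nat \<Rightarrow> 'b st_gen word set monoid" where
  "St TB m = presented_group (st_gens TB m) (st_rels TB m)"

definition x_gen :: "nat \<Rightarrow> nat \<Rightarrow> nat \<Rightarrow> 'b::ring_1 \<Rightarrow> 'b st_gen word set" where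
  "x_gen m i j a = pres_class (st_gens TYPE('b) m) (st_rels TYPE('b) m) (x_word i j a)"

definition phi :: "'b::ring_1 itself \<Rightarrow> nat \<Rightarrow> 'b st_gen word set \<Rightarrow> 'b mat" where
  "phi TB m = pres_lift (GL TB m) (\<lambda>(i, j, a). transv m i j a)"

definition st_ker :: "'b::ring_1 itself \<Rightarrow> nat \<Rightarrow> 'b st_gen word set set" where
  "st_ker TB m = kernel (St TB m) (GL TB m) (phi TB m)"

definition stab :: "'b::ring_1 itself \<Rightarrow> nat \<Rightarrow> 'b st_gen word set \<Rightarrow> 'b st_gen word set" where
  "stab TB m = pres_lift (St TB (Suc m)) (\<lambda>(i, j, a). x_gen (Suc m) i j a)"

lemma group_GL: "group (GL TYPE('b::ring_1) m)"
proof -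
  interpret semiring "ring_mat TYPE('b) m ()" by (rule semiring_mat)
  show ?thesis unfolding GL_def by (rule units_group)
qed

lemma group_St: "group (St TB m)"
  unfolding St_def by (rule group_presented_group)

lemma mat_unit_carrier [simp]: "mat_unit m i j a \<in> carrier_mat m m"
  by (simp add: mat_unit_def)

lemma transv_carrier [simp]: "transv m i j a \<in> carrier_mat m m"
  by (simp add: transv_def)

lemma mat_unit_mult:
  assumes "j < m"
  shows "mat_unit m i j a * mat_unit m k l b =
    (if j = k then mat_unit m i l (a * b) else 0\<^sub>m m m)"
proof (rule eq_matI)
  fix r c assume "r < dim_row (if j = k then mat_unit m i l (a * b) else 0\<^sub>m m m)"
    "c < dim_col (if j = k then mat_unit m i l (a * b) else 0\<^sub>m m m)"
  then have rc: "r < m" "c < m" by (auto simp: mat_unit_def split: if_splits)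
  then have "(mat_unit m i j a * mat_unit m k l b) $$ (r, c) =
      (\<Sum>s = 0..<m. (if r = i \<and> s = j then a else 0) * (if s = k \<and> c = l then b else 0))"
    by (simp add: mat_unit_def scalar_prod_def)
  also have "\<dots> = (\<Sum>s = 0..<m. if s = j then
      (if r = i then a else 0) * (if j = k \<and> c = l then b else 0) else 0)"
    by (intro sum.cong) auto
  also have "\<dots> = (if r = i then a else 0) * (if j = k \<and> c = l then b else 0)"
    using assms by simp
  finally show "(mat_unit m i j a * mat_unit m k l b) $$ (r, c) =
      (if j = k then mat_unit m i l (a * b) else 0\<^sub>m m m) $$ (r, c)"
    using rc by (simp add: mat_unit_def)
qed (auto simp: mat_unit_def)

lemma transv_mult:
  assumes "j < m"
  shows "transv m i j a * transv m k l b =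
    (1\<^sub>m m + mat_unit m k l b) +
    (mat_unit m i j a + (if j = k then mat_unit m i l (a * b) else 0\<^sub>m m m))"
proof -
  have "transv m i j a * transv m k l b =
      1\<^sub>m m * transv m k l b + mat_unit m i j a * transv m k l b"
    unfolding transv_def[of m i j a] by (rule add_mult_distrib_mat[of _ m m _ _ m]) simp_all
  also have "mat_unit m i j a * transv m k l b =
      mat_unit m i j a * 1\<^sub>m m + mat_unit m i j a * mat_unit m k l b"
    unfolding transv_def by (rule mult_add_distrib_mat[of _ m m _ m]) simp_all
  also have "1\<^sub>m m * transv m k l b = 1\<^sub>m m + mat_unit m k l b"
    unfolding left_mult_one_mat[OF transv_carrier] by (simp add: transv_def)
  also have "mat_unit m i j a * 1\<^sub>m m = mat_unit m i j a"
    by (rule right_mult_one_mat[OF mat_unit_carrier])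
  finally show ?thesis unfolding mat_unit_mult[OF assms] .
qed

lemma transv_add:
  assumes "j < m" "i \<noteq> j"
  shows "transv m i j a * transv m i j b = transv m i j (a + b)"
  unfolding transv_mult[OF assms(1)] using assms(2)
  by (intro eq_matI) (auto simp: transv_def mat_unit_def add.commute)

lemma transv_commute:
  assumes "j < m" "l < m" "i \<noteq> l" "j \<noteq> k"
  shows "transv m i j a * transv m k l b = transv m k l b * transv m i j a"
  unfolding transv_mult[OF assms(1)] transv_mult[OF assms(2)] using assms(3,4)
  by (intro eq_matI) (auto simp: mat_unit_def)

lemma transv_commutator:
  assumes "i < m" "j < m" "k < m" "i \<noteq> j" "j \<noteq> k" "i \<noteq> k"
  shows "transv m i j a * transv m j k b = transv m i k (a * b) * (transv m j k b * transv m i j a)"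
proof -
  have "transv m i k (a * b) * (transv m j k b * transv m i j a) =
      1\<^sub>m m * (transv m j k b * transv m i j a) +
      mat_unit m i k (a * b) * (transv m j k b * transv m i j a)"
    unfolding transv_def[of m i k]
    by (rule add_mult_distrib_mat[of _ m m _ _ m]) (simp_all add: mult_carrier_mat[of _ m m])
  also have "mat_unit m i k (a * b) * (transv m j k b * transv m i j a) =
      (mat_unit m i k (a * b) * transv m j k b) * transv m i j a"
    by (rule assoc_mult_mat[of _ m m _ m _ m, symmetric]) simp_all
  also have "mat_unit m i k (a * b) * transv m j k b = mat_unit m i k (a * b)"
    unfolding transv_def using assms
    by (subst mult_add_distrib_mat[of _ m m _ m]) (simp_all add: mat_unit_mult
        right_mult_one_mat[OF mat_unit_carrier] right_add_zero_mat[OF mat_unit_carrier])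
  also have "mat_unit m i k (a * b) * transv m i j a = mat_unit m i k (a * b)"
    unfolding transv_def using assms
    by (subst mult_add_distrib_mat[of _ m m _ m]) (simp_all add: mat_unit_mult
        right_mult_one_mat[OF mat_unit_carrier] right_add_zero_mat[OF mat_unit_carrier])
  also have "1\<^sub>m m * (transv m j k b * transv m i j a) = transv m j k b * transv m i j a"
    by (rule left_mult_one_mat[OF mult_carrier_mat[OF transv_carrier transv_carrier]])
  finally show ?thesis
    unfolding transv_mult[OF assms(2)] transv_mult[OF assms(3)] using assms(4-6)
    by (intro eq_matI) (auto simp: mat_unit_def)
qed

lemma transv_in_GL:
  assumes "j < m" "i \<noteq> j"
  shows "transv m i j (a :: 'b::ring_1) \<in> carrier (GL TYPE('b) m)"
proof -
  have zero: "transv m i j (0 :: 'b) = 1\<^sub>m m"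
    by (intro eq_matI) (auto simp: transv_def mat_unit_def)
  have "transv m i j (- a) * transv m i j a = 1\<^sub>m m" "transv m i j a * transv m i j (- a) = 1\<^sub>m m"
    using transv_add[OF assms, of "- a" a] transv_add[OF assms, of a "- a"] zero by simp_all
  then show ?thesis
    by (auto simp: GL_def units_of_def Units_def ring_mat_def intro!: bexI[of _ "transv m i j (- a)"])
qed

lemma mult_GL: "A \<otimes>\<^bsub>GL TB m\<^esub> B = A * B"
  by (simp add: GL_def units_of_def ring_mat_def)

lemma (in group) commutator_eq_iff:
  assumes "x \<in> carrier G" "y \<in> carrier G" "z \<in> carrier G"
  shows "x \<otimes> (y \<otimes> (inv x \<otimes> inv y)) = z \<longleftrightarrow> x \<otimes> y = z \<otimes> (y \<otimes> x)"
proof -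
  have "x \<otimes> (y \<otimes> (inv x \<otimes> inv y)) = (x \<otimes> y) \<otimes> inv (y \<otimes> x)"
    using assms by (simp add: inv_mult_group m_assoc)
  then show ?thesis using assms by (metis inv_solve_right m_closed)
qed

text \<open>The defining relations hold among the transvections, so that \<open>phi\<close> is a homomorphism.\<close>

lemma transv_respects_st_rels:
  "\<forall>(u, v)\<in>st_rels TYPE('b::ring_1) m \<inter> words (st_gens TYPE('b) m) \<times> words (st_gens TYPE('b) m).
     word_eval (GL TYPE('b) m) (\<lambda>(i, j, a). transv m i j a) u =
     word_eval (GL TYPE('b) m) (\<lambda>(i, j, a). transv m i j a) v"
proof -
  interpret group "GL TYPE('b) m" by (rule group_GL)
  have "word_eval (GL TYPE('b) m) (\<lambda>(i, j, a). transv m i j a) u =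
      word_eval (GL TYPE('b) m) (\<lambda>(i, j, a). transv m i j a) v"
    if "(u, v) \<in> st_rels TYPE('b) m" for u v
    using that unfolding st_rels_def
  proof (elim UnE CollectE exE conjE)
    fix i j and a b :: 'b
    assume "(u, v) = (x_word i j a @ x_word i j b, x_word i j (a + b))" "j < m" "i \<noteq> j"
    then show ?thesis
      using transv_in_GL[of j m i a] transv_in_GL[of j m i b] transv_in_GL[of j m i "a + b"]
        transv_add[of j m i a b]
      by (simp add: x_word_def) (simp add: mult_GL)
  next
    fix i j k l and a b :: 'b
    assume *: "(u, v) = (word_comm (x_word i j a) (x_word k l b), [])"
      "j < m" "l < m" "i \<noteq> j" "k \<noteq> l" "i \<noteq> l" "j \<noteq> k"
    have "transv m i j a \<otimes>\<^bsub>GL TYPE('b) m\<^esub> transv m k l b = \<one>\<^bsub>GL TYPE('b) m\<^esub> \<otimes>\<^bsub>GL TYPE('b) m\<^esub>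
        (transv m k l b \<otimes>\<^bsub>GL TYPE('b) m\<^esub> transv m i j a)"
      using * transv_in_GL[of j m i a] transv_in_GL[of l m k b] transv_commute[of j m l i k a b]
      by (metis l_one m_closed mult_GL)
    then show ?thesis
      using * transv_in_GL[of j m i a] transv_in_GL[of l m k b]
        commutator_eq_iff[of "transv m i j a" "transv m k l b" "\<one>\<^bsub>GL TYPE('b) m\<^esub>"]
      by (simp add: x_word_def word_comm_def word_inv_def)
  next
    fix i j k and a b :: 'b
    assume *: "(u, v) = (word_comm (x_word i j a) (x_word j k b), x_word i k (a * b))"
      "i < m" "j < m" "k < m" "i \<noteq> j" "j \<noteq> k" "i \<noteq> k"
    have "transv m i j a \<otimes>\<^bsub>GL TYPE('b) m\<^esub> transv m j k b =
        transv m i k (a * b) \<otimes>\<^bsub>GL TYPE('b) m\<^esub>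
          (transv m j k b \<otimes>\<^bsub>GL TYPE('b) m\<^esub> transv m i j a)"
      unfolding mult_GL using transv_commutator[OF *(2-7)] .
    then show ?thesis
      using * transv_in_GL[of j m i a] transv_in_GL[of k m j b] transv_in_GL[of k m i "a * b"]
        commutator_eq_iff[of "transv m i j a" "transv m j k b" "transv m i k (a * b)"]
      by (simp add: x_word_def word_comm_def word_inv_def)
  qed
  then show ?thesis by blast
qed

lemma transv_st_gens:
  "(\<lambda>(i, j, a). transv m i j a) \<in> st_gens TYPE('b::ring_1) m \<rightarrow> carrier (GL TYPE('b) m)"
  by (auto simp: st_gens_def intro: transv_in_GL)

lemma phi_hom: "phi TYPE('b::ring_1) m \<in> hom (St TYPE('b) m) (GL TYPE('b) m)"
  unfolding phi_def St_def
  by (rule pres_lift_hom[OF group_GL transv_st_gens transv_respects_st_rels])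

lemma phi_x_gen:
  assumes "i < m" "j < m" "i \<noteq> j"
  shows "phi TYPE('b::ring_1) m (x_gen m i j a) = transv m i j a"
  unfolding phi_def x_gen_def x_word_def
  by (subst pres_lift_gen[OF group_GL transv_st_gens transv_respects_st_rels])
    (use assms in \<open>auto simp: st_gens_def\<close>)

lemma st_gens_mono: "st_gens TB m \<subseteq> st_gens TB (Suc m)"
  by (auto simp: st_gens_def)

lemma st_rels_mono: "st_rels TB m \<subseteq> st_rels TB (Suc m)"
  unfolding st_rels_def by (intro Un_mono) fastforce+

lemma words_mono: "S \<subseteq> S' \<Longrightarrow> w \<in> words S \<Longrightarrow> w \<in> words S'"
  by (auto simp: words_def)

lemma x_gen_respects_st_rels:
  "\<forall>(u, v)\<in>st_rels TYPE('b::ring_1) m \<inter> words (st_gens TYPE('b) m) \<times> words (st_gens TYPE('b) m).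
     word_eval (St TYPE('b) (Suc m)) (\<lambda>(i, j, a). x_gen (Suc m) i j a) u =
     word_eval (St TYPE('b) (Suc m)) (\<lambda>(i, j, a). x_gen (Suc m) i j a) v"
proof -
  let ?S = "st_gens TYPE('b) (Suc m)" and ?R = "st_rels TYPE('b) (Suc m)"
  have f: "(\<lambda>(i, j, a). x_gen (Suc m) i j a) = (\<lambda>g. pres_class ?S ?R [(g, True)])"
    by (auto simp: x_gen_def x_word_def)
  have "word_eval (St TYPE('b) (Suc m)) (\<lambda>(i, j, a). x_gen (Suc m) i j a) u =
      word_eval (St TYPE('b) (Suc m)) (\<lambda>(i, j, a). x_gen (Suc m) i j a) v"
    if "(u, v) \<in> st_rels TYPE('b) m" "u \<in> words (st_gens TYPE('b) m)" "v \<in> words (st_gens TYPE('b) m)"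
    for u v
  proof -
    have w: "u \<in> words ?S" "v \<in> words ?S"
      using that(2,3) words_mono[OF st_gens_mono] by blast+
    have "(u, v) \<in> pres_rel ?S ?R"
      using that(1) st_rels_mono w by (blast intro: pres_rel.rel)
    then show ?thesis
      unfolding f St_def word_eval_presented[OF w(1)] word_eval_presented[OF w(2)]
      using pres_class_eq_iff[OF w] by blast
  qed
  then show ?thesis by blast
qed

lemma x_gen_st_gens:
  "(\<lambda>(i, j, a). x_gen (Suc m) i j a) \<in> st_gens TYPE('b::ring_1) m \<rightarrow> carrier (St TYPE('b) (Suc m))"
  unfolding St_def x_gen_def x_word_def
  by (auto simp: st_gens_def intro!: pres_class_in_carrier)

lemma stab_hom: "stab TYPE('b::ring_1) m \<in> hom (St TYPE('b) m) (St TYPE('b) (Suc m))"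
  unfolding stab_def St_def[of _ m]
  by (rule pres_lift_hom[OF group_St x_gen_st_gens x_gen_respects_st_rels])

lemma stab_x_gen:
  assumes "i < m" "j < m" "i \<noteq> j"
  shows "stab TYPE('b::ring_1) m (x_gen m i j a) = x_gen (Suc m) i j a"
  unfolding stab_def x_gen_def[of m] x_word_def
  by (subst pres_lift_gen[OF group_St x_gen_st_gens x_gen_respects_st_rels])
    (use assms in \<open>auto simp: st_gens_def\<close>)

section \<open>Simply connected spaces and geometric realization\<close>

definition simply_connected_space :: "'a topology \<Rightarrow> bool" where
  "simply_connected_space T \<longleftrightarrow> path_connected_space T \<and>
     (\<forall>g. pathin T g \<and> g 1 = g 0 \<longrightarrow>
        homotopic_with (\<lambda>h. h 0 = g 0 \<and> h 1 = g 0) (top_of_set {0..1}) T g (\<lambda>_. g 0))"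

definition quotient_topology :: "'a topology \<Rightarrow> ('a \<times> 'a) set \<Rightarrow> 'a set topology" where
  "quotient_topology T r =
     topology (\<lambda>U. U \<subseteq> topspace T // r \<and> openin T {x \<in> topspace T. r `` {x} \<in> U})"

lemma openin_quotient_topology:
  "openin (quotient_topology T r) U \<longleftrightarrow>
     U \<subseteq> topspace T // r \<and> openin T {x \<in> topspace T. r `` {x} \<in> U}"
proof -
  have "istopology (\<lambda>U. U \<subseteq> topspace T // r \<and> openin T {x \<in> topspace T. r `` {x} \<in> U})"
    unfolding istopology_def
  proof (intro conjI allI impI)
    fix U V
    assume *: "U \<subseteq> topspace T // r \<and> openin T {x \<in> topspace T. r `` {x} \<in> U}"
      "V \<subseteq> topspace T // r \<and> openin T {x \<in> topspace T. r `` {x} \<in> V}"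
    show "U \<inter> V \<subseteq> topspace T // r" using * by blast
    have "{x \<in> topspace T. r `` {x} \<in> U \<inter> V} =
        {x \<in> topspace T. r `` {x} \<in> U} \<inter> {x \<in> topspace T. r `` {x} \<in> V}" by blast
    then show "openin T {x \<in> topspace T. r `` {x} \<in> U \<inter> V}" using * by auto
  next
    fix K
    assume *: "\<forall>U\<in>K. U \<subseteq> topspace T // r \<and> openin T {x \<in> topspace T. r `` {x} \<in> U}"
    show "\<Union>K \<subseteq> topspace T // r" using * by blast
    have "{x \<in> topspace T. r `` {x} \<in> \<Union>K} = (\<Union>U\<in>K. {x \<in> topspace T. r `` {x} \<in> U})"
      by blast
    then show "openin T {x \<in> topspace T. r `` {x} \<in> \<Union>K}" using * by auto
  qed
  then show ?thesis by (simp add: quotient_topology_def topology_inverse')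
qed

lemma topspace_quotient_topology: "topspace (quotient_topology T r) = topspace T // r"
proof
  have "openin (quotient_topology T r) (topspace T // r)"
    unfolding openin_quotient_topology
  proof
    have "{x \<in> topspace T. r `` {x} \<in> topspace T // r} = topspace T" by (auto intro: quotientI)
    then show "openin T {x \<in> topspace T. r `` {x} \<in> topspace T // r}" by simp
  qed simp
  then show "topspace T // r \<subseteq> topspace (quotient_topology T r)"
    by (rule openin_subset)
  show "topspace (quotient_topology T r) \<subseteq> topspace T // r"
    using openin_topspace[of "quotient_topology T r"]
    by (simp only: openin_quotient_topology)
qed

lemma quotient_map_quotient_topology:
  "quotient_map T (quotient_topology T r) (\<lambda>x. r `` {x})"
proof -
  have "(\<lambda>x. r `` {x}) ` topspace T = topspace T // r" by (auto simp: quotient_def)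
  then show ?thesis
    by (simp add: quotient_map_def topspace_quotient_topology openin_quotient_topology)
qed

text \<open>A semisimplicial set: \<open>S p\<close> is the set of \<open>p\<close>-simplices and \<open>d i\<close> the \<open>i\<close>-th face map,
  in every dimension.\<close>

definition semisimplicial_set :: "(nat \<Rightarrow> 's set) \<Rightarrow> (nat \<Rightarrow> 's \<Rightarrow> 's) \<Rightarrow> bool" where
  "semisimplicial_set S d \<longleftrightarrow>
     (\<forall>p. \<forall>x\<in>S (Suc p). \<forall>i\<le>Suc p. d i x \<in> S p) \<and>
     (\<forall>p. \<forall>x\<in>S (Suc (Suc p)). \<forall>j\<le>Suc (Suc p). \<forall>i<j. d i (d j x) = d (j - 1) (d i x))"

text \<open>The disjoint union of the \<open>S p \<times> \<Delta>\<^sup>p\<close>, with points written \<open>((p, x), t)\<close>, and the gluing of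
  \<open>(x, \<delta>\<^sup>i t)\<close> to \<open>(d\<^sub>i x, t)\<close>. The coface map \<open>\<delta>\<^sup>i\<close> is \<open>simplical_face i\<close>.\<close>

definition simplices_topology :: "(nat \<Rightarrow> 's set) \<Rightarrow> ((nat \<times> 's) \<times> (nat \<Rightarrow> real)) topology" where
  "simplices_topology S =
     sum_topology (\<lambda>(p, x). subtopology (powertop_real UNIV) (standard_simplex p)) (Sigma UNIV S)"

definition face_gluing ::
  "(nat \<Rightarrow> 's set) \<Rightarrow> (nat \<Rightarrow> 's \<Rightarrow> 's) \<Rightarrow>
     (((nat \<times> 's) \<times> (nat \<Rightarrow> real)) \<times> ((nat \<times> 's) \<times> (nat \<Rightarrow> real))) set" where
  "face_gluing S d =
     {(((Suc p, x), simplical_face i t), ((p, d i x), t)) | p x i t.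
        x \<in> S (Suc p) \<and> i \<le> Suc p \<and> t \<in> standard_simplex p}"

definition gluing_rel ::
  "(nat \<Rightarrow> 's set) \<Rightarrow> (nat \<Rightarrow> 's \<Rightarrow> 's) \<Rightarrow>
     (((nat \<times> 's) \<times> (nat \<Rightarrow> real)) \<times> ((nat \<times> 's) \<times> (nat \<Rightarrow> real))) set" where
  "gluing_rel S d =
     (face_gluing S d \<union> (face_gluing S d)\<inverse>)\<^sup>* \<inter>
       topspace (simplices_topology S) \<times> topspace (simplices_topology S)"

definition geometric_realization ::
  "(nat \<Rightarrow> 's set) \<Rightarrow> (nat \<Rightarrow> 's \<Rightarrow> 's) \<Rightarrow> ((nat \<times> 's) \<times> (nat \<Rightarrow> real)) set topology" where
  "geometric_realization S d = quotient_topology (simplices_topology S) (gluing_rel S d)"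

lemma equiv_gluing_rel: "equiv (topspace (simplices_topology S)) (gluing_rel S d)"
proof (rule equivI)
  let ?g = "face_gluing S d \<union> (face_gluing S d)\<inverse>"
  show "gluing_rel S d \<subseteq> topspace (simplices_topology S) \<times> topspace (simplices_topology S)"
    by (auto simp: gluing_rel_def)
  show "refl_on (topspace (simplices_topology S)) (gluing_rel S d)"
    by (auto simp: refl_on_def gluing_rel_def)
  have "sym (?g\<^sup>*)" by (intro sym_rtrancl) (auto simp: sym_def)
  then show "sym (gluing_rel S d)" by (auto simp: gluing_rel_def sym_def)
  show "trans (gluing_rel S d)" by (auto simp: gluing_rel_def trans_def)
qed

section \<open>The ordered frame semisimplicial set\<close>

definition rsmult :: "'b::ring_1 vec \<Rightarrow> 'b \<Rightarrow> 'b vec" where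
  "rsmult v b = map_vec (\<lambda>x. x * b) v"

definition right_submodule :: "nat \<Rightarrow> 'b::ring_1 vec set \<Rightarrow> bool" where
  "right_submodule n M \<longleftrightarrow> M \<subseteq> carrier_vec n \<and> 0\<^sub>v n \<in> M \<and>
     (\<forall>u\<in>M. \<forall>v\<in>M. u + v \<in> M) \<and> (\<forall>u\<in>M. \<forall>b. rsmult u b \<in> M)"

definition right_module_iso :: "'b::ring_1 vec set \<Rightarrow> 'b vec set \<Rightarrow> ('b vec \<Rightarrow> 'b vec) \<Rightarrow> bool" where
  "right_module_iso M M' f \<longleftrightarrow> bij_betw f M M' \<and>
     (\<forall>u\<in>M. \<forall>v\<in>M. f (u + v) = f u + f v) \<and> (\<forall>u\<in>M. \<forall>b. f (rsmult u b) = rsmult (f u) b)"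

definition vec_sum :: "nat \<Rightarrow> 'b::ring_1 vec list \<Rightarrow> 'b vec" where
  "vec_sum n xs = foldr (+) xs (0\<^sub>v n)"

text \<open>\<open>B\<^sup>n\<close> is the internal direct sum of the listed right submodules.\<close>

definition internal_direct_sum :: "nat \<Rightarrow> 'b::ring_1 vec set list \<Rightarrow> bool" where
  "internal_direct_sum n Ms \<longleftrightarrow> (\<forall>M\<in>set Ms. right_submodule n M) \<and>
     (\<forall>w\<in>carrier_vec n. \<exists>!xs. list_all2 (\<in>) xs Ms \<and> w = vec_sum n xs)"

definition partial_frame :: "nat \<Rightarrow> 'b::ring_1 vec list \<Rightarrow> bool" where
  "partial_frame n vs \<longleftrightarrow> set vs \<subseteq> carrier_vec n \<and>
     (\<forall>v\<in>set vs. bij_betw (rsmult v) UNIV (range (rsmult v))) \<and>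
     (\<exists>C. internal_direct_sum n (map (\<lambda>v. range (rsmult v)) vs @ [C]) \<and>
        (\<exists>f. right_module_iso (carrier_vec (n - length vs)) C f))"

definition frame_simplices :: "'b::ring_1 itself \<Rightarrow> nat \<Rightarrow> nat \<Rightarrow> 'b vec list set" where
  "frame_simplices TB n p = {vs. length vs = Suc p \<and> Suc p \<le> n \<and> partial_frame n vs}"

definition frame_face :: "nat \<Rightarrow> 'b vec list \<Rightarrow> 'b vec list" where
  "frame_face i vs = take i vs @ drop (Suc i) vs"

lemma rsmult_carrier [simp]: "rsmult v b \<in> carrier_vec n \<longleftrightarrow> v \<in> carrier_vec n"
  by (simp add: rsmult_def)

lemma rsmult_add_vec:
  "u \<in> carrier_vec n \<Longrightarrow> v \<in> carrier_vec n \<Longrightarrow> rsmult (u + v) b = rsmult u b + rsmult v b"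
  by (intro eq_vecI) (auto simp: rsmult_def distrib_right)

lemma rsmult_add: "v \<in> carrier_vec n \<Longrightarrow> rsmult v (a + b) = rsmult v a + rsmult v b"
  by (intro eq_vecI) (auto simp: rsmult_def distrib_left)

lemma rsmult_rsmult: "rsmult (rsmult v a) b = rsmult v (a * b)"
  by (intro eq_vecI) (auto simp: rsmult_def mult.assoc)

lemma rsmult_zero: "v \<in> carrier_vec n \<Longrightarrow> rsmult v 0 = 0\<^sub>v n"
  by (intro eq_vecI) (auto simp: rsmult_def)

lemma vec_sum_carrier: "set xs \<subseteq> carrier_vec n \<Longrightarrow> vec_sum n xs \<in> carrier_vec n"
  by (induction xs) (auto simp: vec_sum_def)

lemma vec_sum_Nil [simp]: "vec_sum n [] = 0\<^sub>v n"
  and vec_sum_Cons [simp]: "vec_sum n (x # xs) = x + vec_sum n xs"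
  by (simp_all add: vec_sum_def)

lemma vec_sum_shift:
  assumes "x \<in> carrier_vec n" "c \<in> carrier_vec n"
  shows "set q \<subseteq> carrier_vec n \<Longrightarrow> vec_sum n (q @ [x + c]) = x + vec_sum n (q @ [c])"
proof (induction q)
  case Nil
  then show ?case using assms by (intro eq_vecI) auto
next
  case (Cons y q)
  have "y \<in> carrier_vec n" "vec_sum n (q @ [c]) \<in> carrier_vec n"
    using Cons.prems assms by (auto intro!: vec_sum_carrier)
  then have "y + (x + vec_sum n (q @ [c])) = x + (y + vec_sum n (q @ [c]))"
    using assms by (intro eq_vecI) (auto simp: add.left_commute)
  then show ?case using Cons by simp
qed

lemma vec_sum_merge:
  assumes "set p \<subseteq> carrier_vec n" "set q \<subseteq> carrier_vec n" "x \<in> carrier_vec n" "c \<in> carrier_vec n"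
  shows "vec_sum n (p @ [x] @ q @ [c]) = vec_sum n (p @ q @ [x + c])"
  using vec_sum_shift[OF assms(3,4,2)] by (induction p) simp_all

lemma list_all2_subset: "list_all2 (\<in>) xs Ms \<Longrightarrow> \<forall>M\<in>set Ms. M \<subseteq> A \<Longrightarrow> set xs \<subseteq> A"
  by (induction rule: list_all2_induct) auto

definition set_sum :: "'b::ring_1 vec set \<Rightarrow> 'b vec set \<Rightarrow> 'b vec set" where
  "set_sum V C = {x + c | x c. x \<in> V \<and> c \<in> C}"

lemma right_submodule_set_sum:
  assumes "right_submodule n V" "right_submodule n C"
  shows "right_submodule n (set_sum V C)"
  unfolding right_submodule_def
proof (intro conjI ballI allI)
  show "set_sum V C \<subseteq> carrier_vec n"
    using assms by (auto simp: set_sum_def right_submodule_def intro!: add_carrier_vec)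
  have "0\<^sub>v n + 0\<^sub>v n \<in> set_sum V C"
    using assms unfolding set_sum_def right_submodule_def by blast
  then show "0\<^sub>v n \<in> set_sum V C" by simp
next
  fix u w assume "u \<in> set_sum V C" "w \<in> set_sum V C"
  then obtain x c x' c' where *: "u = x + c" "w = x' + c'" "x \<in> V" "x' \<in> V" "c \<in> C" "c' \<in> C"
    by (auto simp: set_sum_def)
  then have "x \<in> carrier_vec n" "x' \<in> carrier_vec n" "c \<in> carrier_vec n" "c' \<in> carrier_vec n"
    using assms by (auto simp: right_submodule_def)
  then have "u + w = (x + x') + (c + c')"
    unfolding * by (intro eq_vecI) auto
  then show "u + w \<in> set_sum V C"
    using assms * unfolding set_sum_def right_submodule_def by blast
next
  fix u b assume "u \<in> set_sum V C"
  then obtain x c where *: "u = x + c" "x \<in> V" "c \<in> C" by (auto simp: set_sum_def)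
  then have "x \<in> carrier_vec n" "c \<in> carrier_vec n"
    using assms by (auto simp: right_submodule_def)
  then have "rsmult u b = rsmult x b + rsmult c b"
    unfolding * by (rule rsmult_add_vec)
  then show "rsmult u b \<in> set_sum V C"
    using assms * unfolding set_sum_def right_submodule_def by blast
qed

lemma internal_direct_sum_merge:
  assumes "internal_direct_sum n (Ps @ [V] @ Qs @ [C])"
  shows "internal_direct_sum n (Ps @ Qs @ [set_sum V C])"
  unfolding internal_direct_sum_def
proof (intro conjI ballI)
  have sub: "\<forall>M\<in>set Ps \<union> {V} \<union> set Qs \<union> {C}. right_submodule n M"
    using assms by (auto simp: internal_direct_sum_def)
  then have car: "\<forall>M\<in>set Ps. M \<subseteq> carrier_vec n" "\<forall>M\<in>set Qs. M \<subseteq> carrier_vec n"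
    "V \<subseteq> carrier_vec n" "C \<subseteq> carrier_vec n"
    by (auto simp: right_submodule_def)
  show "right_submodule n M" if "M \<in> set (Ps @ Qs @ [set_sum V C])" for M
    using that sub right_submodule_set_sum[of n V C] by auto
  fix w :: "'a vec" assume "w \<in> carrier_vec n"
  then have ex1: "\<exists>!xs. list_all2 (\<in>) xs (Ps @ [V] @ Qs @ [C]) \<and> w = vec_sum n xs"
    using assms unfolding internal_direct_sum_def by blast
  then obtain xs where "list_all2 (\<in>) xs (Ps @ [V] @ Qs @ [C])" and w: "w = vec_sum n xs"
    by blast
  then obtain p x q c where xs: "xs = p @ [x] @ q @ [c]"
    and l: "list_all2 (\<in>) p Ps" "x \<in> V" "list_all2 (\<in>) q Qs" "c \<in> C"
    by (auto simp: list_all2_append2 list_all2_Cons2)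
  have merge: "vec_sum n (p' @ [x'] @ q' @ [c']) = vec_sum n (p' @ q' @ [x' + c'])"
    if "list_all2 (\<in>) p' Ps" "x' \<in> V" "list_all2 (\<in>) q' Qs" "c' \<in> C" for p' x' q' c'
    by (rule vec_sum_merge[OF list_all2_subset[OF that(1) car(1)]
          list_all2_subset[OF that(3) car(2)]]) (use that car in auto)
  show "\<exists>!ys. list_all2 (\<in>) ys (Ps @ Qs @ [set_sum V C]) \<and> w = vec_sum n ys"
  proof (rule ex1I[of _ "p @ q @ [x + c]"])
    have "x + c \<in> set_sum V C" using l unfolding set_sum_def by blast
    then show "list_all2 (\<in>) (p @ q @ [x + c]) (Ps @ Qs @ [set_sum V C]) \<and>
        w = vec_sum n (p @ q @ [x + c])"
      using l merge[OF l] w xs by (auto intro!: list_all2_appendI)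
  next
    fix ys assume ys: "list_all2 (\<in>) ys (Ps @ Qs @ [set_sum V C]) \<and> w = vec_sum n ys"
    then obtain p' q' z where z: "ys = p' @ q' @ [z]" "list_all2 (\<in>) p' Ps"
      "list_all2 (\<in>) q' Qs" "z \<in> set_sum V C"
      by (auto simp: list_all2_append2 list_all2_Cons2)
    then obtain x' c' where xc: "z = x' + c'" "x' \<in> V" "c' \<in> C" by (auto simp: set_sum_def)
    have "list_all2 (\<in>) (p' @ [x'] @ q' @ [c']) (Ps @ [V] @ Qs @ [C])"
      using z xc by (intro list_all2_appendI) auto
    moreover have "w = vec_sum n (p' @ [x'] @ q' @ [c'])"
      using merge[OF z(2) xc(2) z(3) xc(3)] ys z xc by simp
    moreover have "list_all2 (\<in>) (p @ [x] @ q @ [c]) (Ps @ [V] @ Qs @ [C])"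
      using l by (intro list_all2_appendI) auto
    ultimately have "p' @ [x'] @ q' @ [c'] = p @ [x] @ q @ [c]"
      using ex1 w xs by blast
    moreover have "length p' = length p" "length q' = length q"
      using l z by (metis list_all2_lengthD)+
    ultimately show "ys = p @ q @ [x + c]" using z xc by simp
  qed
qed

lemma internal_direct_sum_inj:
  assumes "internal_direct_sum n (Ps @ [V] @ Qs @ [C])"
    and "x \<in> V" "x' \<in> V" "c \<in> C" "c' \<in> C" "x + c = x' + c'"
  shows "x = x' \<and> c = c'"
proof -
  have sub: "\<forall>M\<in>set Ps \<union> {V} \<union> set Qs \<union> {C}. right_submodule n M"
    using assms(1) by (auto simp: internal_direct_sum_def)
  define z where "z = (\<lambda>Ms :: 'a vec set list. map (\<lambda>_. 0\<^sub>v n :: 'a vec) Ms)"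
  have z: "list_all2 (\<in>) (z Ms) Ms" if "\<forall>M\<in>set Ms. right_submodule n M" for Ms
    using that by (auto simp: z_def list_all2_conv_all_nth right_submodule_def)
  have zc: "set (z Ms) \<subseteq> carrier_vec n" for Ms by (auto simp: z_def)
  have car: "x \<in> carrier_vec n" "x' \<in> carrier_vec n" "c \<in> carrier_vec n" "c' \<in> carrier_vec n"
    using sub assms by (auto simp: right_submodule_def)
  let ?t = "\<lambda>x c. z Ps @ [x] @ z Qs @ [c]"
  have "vec_sum n (?t x c) = vec_sum n (?t x' c')"
    using car zc assms(6) by (simp only: vec_sum_merge)
  moreover have "vec_sum n (?t x c) \<in> carrier_vec n"
    using car zc by (intro vec_sum_carrier) auto
  moreover have "list_all2 (\<in>) (?t x c) (Ps @ [V] @ Qs @ [C])"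
    "list_all2 (\<in>) (?t x' c') (Ps @ [V] @ Qs @ [C])"
    using assms sub by (auto intro!: list_all2_appendI z)
  ultimately have "?t x c = ?t x' c'"
    using assms(1) unfolding internal_direct_sum_def by metis
  then show ?thesis by simp
qed

lemma right_module_iso_merge:
  assumes ds: "internal_direct_sum n (Ps @ [range (rsmult v)] @ Qs @ [C])"
    and v: "v \<in> carrier_vec n" and inj: "inj (rsmult v)"
    and f: "right_module_iso (carrier_vec m) C f"
  shows "right_module_iso (carrier_vec (Suc m)) (set_sum (range (rsmult v)) C)
    (\<lambda>u. rsmult v (u $ 0) + f (Matrix.vec m (\<lambda>j. u $ Suc j)))"
proof -
  let ?t = "\<lambda>u :: 'a vec. Matrix.vec m (\<lambda>j. u $ Suc j)"
  let ?F = "\<lambda>u. rsmult v (u $ 0) + f (?t u)"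
  have C: "C \<subseteq> carrier_vec n"
    using ds by (auto simp: internal_direct_sum_def right_submodule_def)
  have fbij: "bij_betw f (carrier_vec m) C"
    and fadd: "\<And>u w. u \<in> carrier_vec m \<Longrightarrow> w \<in> carrier_vec m \<Longrightarrow> f (u + w) = f u + f w"
    and fsm: "\<And>u b. u \<in> carrier_vec m \<Longrightarrow> f (rsmult u b) = rsmult (f u) b"
    using f by (auto simp: right_module_iso_def)
  have fC: "f (?t u) \<in> C" for u
    using bij_betw_apply[OF fbij, of "?t u"] by simp
  then have fc: "f (?t u) \<in> carrier_vec n" for u using C by blast
  have "inj_on ?F (carrier_vec (Suc m))"
  proof (rule inj_onI)
    fix u w :: "'a vec"
    assume u: "u \<in> carrier_vec (Suc m)" and w: "w \<in> carrier_vec (Suc m)" and eq: "?F u = ?F w"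
    have "rsmult v (u $ 0) = rsmult v (w $ 0) \<and> f (?t u) = f (?t w)"
      by (rule internal_direct_sum_inj[OF ds _ _ fC fC eq]) auto
    then have 0: "u $ 0 = w $ 0" and t: "?t u = ?t w"
      using inj bij_betw_imp_inj_on[OF fbij] by (auto dest: injD inj_onD)
    have "u $ Suc j = w $ Suc j" if "j < m" for j
      using arg_cong[OF t, of "\<lambda>x. x $ j"] that by simp
    then have "u $ j = w $ j" if "j < Suc m" for j
      using 0 that by (cases j) auto
    then show "u = w" using u w by (intro eq_vecI) auto
  qed
  moreover have "?F ` carrier_vec (Suc m) = set_sum (range (rsmult v)) C"
  proof
    show "?F ` carrier_vec (Suc m) \<subseteq> set_sum (range (rsmult v)) C"
      using fC by (auto simp: set_sum_def)
    show "set_sum (range (rsmult v)) C \<subseteq> ?F ` carrier_vec (Suc m)"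
    proof
      fix y assume "y \<in> set_sum (range (rsmult v)) C"
      then obtain b c where y: "y = rsmult v b + c" "c \<in> C" by (auto simp: set_sum_def)
      then obtain u where u: "u \<in> carrier_vec m" "c = f u"
        using bij_betw_imp_surj_on[OF fbij] by blast
      let ?u = "Matrix.vec (Suc m) (\<lambda>j. case j of 0 \<Rightarrow> b | Suc k \<Rightarrow> u $ k)"
      have "?t ?u = u" using u by (intro eq_vecI) auto
      then have "?F ?u = y" using y u by simp
      then show "y \<in> ?F ` carrier_vec (Suc m)" by (intro image_eqI[of _ _ ?u]) auto
    qed
  qed
  moreover have "?F (u + w) = ?F u + ?F w"
    if "u \<in> carrier_vec (Suc m)" "w \<in> carrier_vec (Suc m)" for u w
  proof -
    have "?t (u + w) = ?t u + ?t w" using that by (intro eq_vecI) auto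
    then have "?F (u + w) = (rsmult v (u $ 0) + rsmult v (w $ 0)) + (f (?t u) + f (?t w))"
      using that v by (simp add: rsmult_add[OF v] fadd)
    also have "\<dots> = ?F u + ?F w"
      using v fc[of u] fc[of w] by (intro eq_vecI) (auto simp: rsmult_def)
    finally show ?thesis .
  qed
  moreover have "?F (rsmult u b) = rsmult (?F u) b" if "u \<in> carrier_vec (Suc m)" for u b
  proof -
    have "?t (rsmult u b) = rsmult (?t u) b"
      using that by (intro eq_vecI) (auto simp: rsmult_def)
    then have "?F (rsmult u b) = rsmult v (u $ 0 * b) + rsmult (f (?t u)) b"
      using that by (simp add: fsm) (simp add: rsmult_def)
    also have "\<dots> = rsmult (?F u) b"
      using v fc[of u] by (simp add: rsmult_add_vec[of _ n] rsmult_rsmult)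
    finally show ?thesis .
  qed
  ultimately show ?thesis unfolding right_module_iso_def bij_betw_def by blast
qed

lemma partial_frame_remove:
  assumes "partial_frame n (as @ v # bs)" "length (as @ v # bs) \<le> n"
  shows "partial_frame n (as @ bs)"
proof -
  obtain C f where ds: "internal_direct_sum n
      (map (\<lambda>v. range (rsmult v)) as @ [range (rsmult v)] @ map (\<lambda>v. range (rsmult v)) bs @ [C])"
    and f: "right_module_iso (carrier_vec (n - length (as @ v # bs))) C f"
    using assms(1) unfolding partial_frame_def by auto
  have v: "v \<in> carrier_vec n" "inj (rsmult v)"
    using assms(1) by (auto simp: partial_frame_def bij_betw_def)
  have "n - length (as @ bs) = Suc (n - length (as @ v # bs))" using assms(2) by simp
  then have "\<exists>g. right_module_iso (carrier_vec (n - length (as @ bs)))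
      (set_sum (range (rsmult v)) C) g"
    using right_module_iso_merge[OF ds v f] by metis
  then show ?thesis
    using internal_direct_sum_merge[OF ds] assms(1) unfolding partial_frame_def by auto
qed

lemma length_frame_face: "i < length vs \<Longrightarrow> length (frame_face i vs) = length vs - 1"
  by (simp add: frame_face_def)

lemma nth_frame_face:
  "i < length vs \<Longrightarrow> k < length vs - 1 \<Longrightarrow>
    frame_face i vs ! k = (if k < i then vs ! k else vs ! Suc k)"
  by (auto simp: frame_face_def nth_append min_def)

lemma semisimplicial_set_frames: "semisimplicial_set (frame_simplices TB n) frame_face"
  unfolding semisimplicial_set_def
proof (intro conjI allI ballI impI)
  fix p i and vs :: "'a vec list"
  assume vs: "vs \<in> frame_simplices TB n (Suc p)" and i: "i \<le> Suc p"
  then have l: "length vs = Suc (Suc p)" "length vs \<le> n" "i < length vs" "partial_frame n vs"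
    by (auto simp: frame_simplices_def)
  have eq: "take i vs @ vs ! i # drop (Suc i) vs = vs"
    by (rule id_take_nth_drop[OF l(3), symmetric])
  have "partial_frame n (frame_face i vs)"
    unfolding frame_face_def using l(2,4)
    by (intro partial_frame_remove[of n "take i vs" "vs ! i" "drop (Suc i) vs"]) (simp_all only: eq)
  then show "frame_face i vs \<in> frame_simplices TB n p"
    using l by (simp add: frame_simplices_def length_frame_face)
next
  fix p i j and vs :: "'a vec list"
  assume "vs \<in> frame_simplices TB n (Suc (Suc p))" "j \<le> Suc (Suc p)" "i < j"
  then have l: "j < length vs" "i < j" by (simp_all add: frame_simplices_def)
  show "frame_face i (frame_face j vs) = frame_face (j - 1) (frame_face i vs)"
  proof (rule nth_equalityI)
    show "length (frame_face i (frame_face j vs)) = length (frame_face (j - 1) (frame_face i vs))"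
      using l by (simp add: length_frame_face)
    fix k assume "k < length (frame_face i (frame_face j vs))"
    then have k: "k < length vs - 1 - 1" using l by (simp add: length_frame_face)
    then show "frame_face i (frame_face j vs) ! k = frame_face (j - 1) (frame_face i vs) ! k"
      using l by (simp add: length_frame_face nth_frame_face) linarith
  qed
qed

end

theory Submission
  imports Defs
begin

unbundle no vec_syntax

text \<open>A simply connected space carries no nontrivial local system, and the frame complex has one built
  from the Steinberg group. The stabiliser of the last basis vector lifts isomorphically to the subgroup
  \<open>P\<close> of the Steinberg group generated by the \<open>X k l a\<close> with \<open>l < n - 1\<close>: it is a row group extended by
  the image of the smaller Steinberg group, which by hypothesis factors through \<open>GL\<close>. The fibre over a
  vertex \<open>v\<close> consists of the cosets \<open>g P\<close> with \<open>\<phi> g\<close> taking the last basis vector to \<open>v\<close>, and along an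
  edge \<open>g P\<close> is carried to \<open>g w P\<close>, where \<open>w\<close> is the Weyl element exchanging the last two indices. In
  characteristic two \<open>w\<close> is an involution without signs, the transport does not depend on the
  orientation of the edge, and the braid relation gives its compatibility with triangles. A global
  section through \<open>P\<close> identifies every \<open>g P\<close> with the image vertex of \<open>g\<close>, so that
  \<open>\<phi>\<close> is injective; nonemptiness of the fibres gives surjectivity.\<close>

section \<open>Flat sections of a local system\<close>

text \<open>Simple connectivity speaks of continuous loops in the realization, while fibres and
  transport live on vertices and edges. The open stars of the vertices bridge the gap without edge
  paths or simplicial approximation: a point of several stars has a representative in one simplex
  containing all their vertices, so rules that satisfy the cocycle identity inside every simplex are
  the transition functions of a locally constant sheaf, and a homotopy acts on its sections
  directly. Simplices are ordered tuples, so every edge occurs in both directions; this forces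
  transport to be its own inverse. Over a vertex, the equality of \<open>GL\<close> and the
  elementary group in rank \<open>n - 1\<close> lets a coset of \<open>P\<close> be represented by
  an element with any matrix having the given last column. In rank \<open>n - 2\<close> the same
  equality compares two representatives adapted to one edge. Triviality of the stabilized kernel
  makes \<phi> injective on \<open>P\<close>, so that elements of \<open>P\<close> can be compared
  through their matrices; transport is single valued for this reason.\<close>

locale local_system =
  fixes T :: "'x topology" and U :: "'v \<Rightarrow> 'x set" and Fib :: "'v \<Rightarrow> 'l set"
    and tr :: "'v \<Rightarrow> 'v \<Rightarrow> 'l \<Rightarrow> 'l"
  assumes openin_U: "openin T (U v)"
    and cover: "x \<in> topspace T \<Longrightarrow> \<exists>v. x \<in> U v"
    and tr_closed: "x \<in> U v \<Longrightarrow> x \<in> U w \<Longrightarrow> a \<in> Fib v \<Longrightarrow> tr v w a \<in> Fib w"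
    and tr_refl: "a \<in> Fib v \<Longrightarrow> tr v v a = a"
    and tr_trans: "x \<in> U u \<Longrightarrow> x \<in> U v \<Longrightarrow> x \<in> U w \<Longrightarrow> a \<in> Fib u \<Longrightarrow>
      tr v w (tr u v a) = tr u w a"
begin

text \<open>\<open>s v k\<close> is the value at \<open>k\<close> read in the chart
  \<open>U v\<close>, constrained only if \<open>f k\<close> lies there; the last clause is local
  constancy. Sections are taken along a map \<open>f\<close>, not over subsets of the space, because
  paths and homotopies need not be injective.\<close>

definition flat :: "('k::metric_space \<Rightarrow> 'x) \<Rightarrow> 'k set \<Rightarrow> ('v \<Rightarrow> 'k \<Rightarrow> 'l) \<Rightarrow> bool" where
  "flat f A s \<longleftrightarrow> (\<forall>k\<in>A. \<forall>v. f k \<in> U v \<longrightarrow> s v k \<in> Fib v \<and>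
     (\<forall>w. f k \<in> U w \<longrightarrow> s w k = tr v w (s v k)) \<and>
     eventually (\<lambda>k'. s v k' = s v k) (at k within A))"

lemma flat_fib: "flat f A s \<Longrightarrow> k \<in> A \<Longrightarrow> f k \<in> U v \<Longrightarrow> s v k \<in> Fib v"
  and flat_tr: "flat f A s \<Longrightarrow> k \<in> A \<Longrightarrow> f k \<in> U v \<Longrightarrow> f k \<in> U w \<Longrightarrow> s w k = tr v w (s v k)"
  and flat_ev: "flat f A s \<Longrightarrow> k \<in> A \<Longrightarrow> f k \<in> U v \<Longrightarrow>
    eventually (\<lambda>k'. s v k' = s v k) (at k within A)"
  unfolding flat_def by blast+

lemma flat_reparam:
  fixes h :: "'j::metric_space \<Rightarrow> 'k::metric_space"
  assumes "flat f A s" "continuous_on B h" "h ` B \<subseteq> A"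
    and "\<And>k. k \<in> B \<Longrightarrow> f (h k) = f' k"
  shows "flat f' B (\<lambda>v k. s v (h k))"
  unfolding flat_def
proof (intro ballI allI impI conjI)
  fix k v assume "k \<in> B" "f' k \<in> U v"
  then have k: "k \<in> B" "f (h k) \<in> U v" using assms(4) by simp_all
  then have hk: "h k \<in> A" using assms(3) by auto
  show "s v (h k) \<in> Fib v" using flat_fib[OF assms(1) hk k(2)] .
  show "s w (h k) = tr v w (s v (h k))" if "f' k \<in> U w" for w
    using flat_tr[OF assms(1) hk k(2)] that assms(4)[OF k(1)] by simp
  obtain S where S: "open S" "h k \<in> S" "\<And>x. x \<in> S \<Longrightarrow> x \<noteq> h k \<Longrightarrow> x \<in> A \<Longrightarrow> s v x = s v (h k)"
    using flat_ev[OF assms(1) hk k(2)] unfolding eventually_at_topological by blast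
  obtain R where R: "open R" "k \<in> R" "\<And>y. y \<in> B \<Longrightarrow> y \<in> R \<Longrightarrow> h y \<in> S"
    using continuous_on_topological[THEN iffD1, rule_format, OF assms(2) k(1) S(1,2)] by blast
  show "eventually (\<lambda>k'. s v (h k') = s v (h k)) (at k within B)"
    unfolding eventually_at_topological
  proof (intro exI[of _ R] conjI ballI impI R(1,2))
    fix x assume "x \<in> R" "x \<in> B"
    then have "h x \<in> S" "h x \<in> A" using R(3) assms(3) by auto
    then show "s v (h x) = s v (h k)" using S(3) by (cases "h x = h k") simp_all
  qed
qed

lemma flat_mono: "flat f A s \<Longrightarrow> B \<subseteq> A \<Longrightarrow> flat f B s"
  using flat_reparam[of f A s B "\<lambda>k. k" f] by (auto simp: image_subset_iff)

lemma eventually_in_U: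
  assumes "continuous_map (top_of_set A) T f" "k \<in> A" "f k \<in> U v"
  shows "eventually (\<lambda>k'. k' \<in> A \<and> f k' \<in> U v) (at k within A)"
proof -
  have "openin (top_of_set A) {y \<in> topspace (top_of_set A). f y \<in> U v}"
    using assms(1) openin_U by (rule openin_continuous_map_preimage)
  then obtain S where "open S" "{y \<in> A. f y \<in> U v} = A \<inter> S"
    by (auto simp: openin_open)
  then show ?thesis
    unfolding eventually_at_topological using assms(2,3) by (intro exI[of _ S]) auto
qed

text \<open>Both sections change chart by \<open>tr\<close>, so agreement at a point in one chart is
  agreement there in all. Agreement is therefore a locally constant truth value, hence constant on a
  connected domain.\<close>

lemma flat_unique:
  assumes fl: "flat f A s" "flat f A s'" and f: "continuous_map (top_of_set A) T f"
    and A: "connected A" and k: "k \<in> A" "f k \<in> U v" "s v k = s' v k"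
    and l: "l \<in> A" "f l \<in> U w"
  shows "s w l = s' w l"
proof -
  define E where "E k \<longleftrightarrow> (\<forall>v. f k \<in> U v \<longrightarrow> s v k = s' v k)" for k
  have E: "E k" if "k \<in> A" "f k \<in> U v" "s v k = s' v k" for k v
    unfolding E_def using flat_tr[OF fl(1) that(1,2)] flat_tr[OF fl(2) that(1,2)] that(3) by metis
  have "E k = E l"
  proof (rule connected_local_const[OF A k(1) l(1)], rule ballI)
    fix a assume a: "a \<in> A"
    then have "f a \<in> topspace T" using f by (auto simp: continuous_map_def)
    then obtain u where u: "f a \<in> U u" using cover by blast
    from flat_ev[OF fl(1) a u] flat_ev[OF fl(2) a u] eventually_in_U[OF f a u]
    show "eventually (\<lambda>b. E a = E b) (at a within A)"
    proof eventually_elim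
      case (elim b)
      have "E c \<longleftrightarrow> s u c = s' u c" if "c \<in> A" "f c \<in> U u" for c
        using E[OF that] that(2) unfolding E_def by blast
      then show ?case using elim a u by simp
    qed
  qed
  then show ?thesis using E[OF k] l unfolding E_def by blast
qed

section \<open>Existence of flat sections by subdivision\<close>

definition sectionable :: "('k::metric_space \<Rightarrow> 'x) \<Rightarrow> 'k set \<Rightarrow> bool" where
  "sectionable f A \<longleftrightarrow>
     (\<forall>k\<in>A. \<forall>v a. f k \<in> U v \<longrightarrow> a \<in> Fib v \<longrightarrow> (\<exists>s. flat f A s \<and> s v k = a))"

lemma sectionable_local:
  assumes "f ` A \<subseteq> U u"
  shows "sectionable f A"
  unfolding sectionable_def
proof (intro ballI allI impI)
  fix k v a assume k: "k \<in> A" "f k \<in> U v" "a \<in> Fib v"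
  \<comment> \<open>Constant in the chart \<open>U u\<close>, and read in the other charts through
    \<open>tr u\<close>.\<close>
  let ?s = "\<lambda>w (_ :: 'a). tr u w (tr v u a)"
  have a: "tr v u a \<in> Fib u" using tr_closed[of "f k" v u a] k assms by blast
  have "flat f A ?s"
    unfolding flat_def
  proof (intro ballI allI impI conjI)
    fix l w assume "l \<in> A" "f l \<in> U w"
    then show "?s w l \<in> Fib w" using tr_closed[of "f l" u w] a assms by blast
    show "?s w' l = tr w w' (?s w l)" if "f l \<in> U w'" for w'
      using tr_trans[of "f l" u w w' "tr v u a"] a assms that \<open>l \<in> A\<close> \<open>f l \<in> U w\<close> by (metis image_subset_iff)
  qed simp
  moreover have "?s v k = a"
    using tr_trans[of "f k" v u v a] k assms tr_refl by (metis image_subset_iff)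
  ultimately show "\<exists>s. flat f A s \<and> s v k = a" by blast
qed

text \<open>A section on one piece is continued by the section on the other that has the same value
  at one common point; connectedness of the overlap makes them agree on all of it. Since the pieces
  are closed, local constancy can be checked on each of them separately.\<close>

lemma sectionable_Un:
  assumes f: "continuous_map (top_of_set (A \<union> B)) T f"
    and AB: "closed A" "closed B" "connected (A \<inter> B)" "A \<inter> B \<noteq> {}"
    and sec: "sectionable f A" "sectionable f B"
  shows "sectionable f (A \<union> B)"
proof -
  \<comment> \<open>Stated for arbitrary \<open>C\<close> and \<open>D\<close> because the initial
    point may lie in either piece; the construction starts from the piece that contains it.\<close>
  have ext: "\<exists>s. flat f (C \<union> D) s \<and> s v k = a"
    if CD: "closed C" "closed D" "connected (C \<inter> D)" "C \<inter> D \<noteq> {}"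
      and sec: "sectionable f C" "sectionable f D"
      and f: "continuous_map (top_of_set (C \<union> D)) T f"
      and k: "k \<in> C" "f k \<in> U v" "a \<in> Fib v" for C D k v a
  proof -
    obtain s where s: "flat f C s" "s v k = a" using sec(1) k unfolding sectionable_def by blast
    obtain b where b: "b \<in> C" "b \<in> D" using CD by blast
    then have "f b \<in> topspace T" using f by (auto simp: continuous_map_def)
    then obtain u where u: "f b \<in> U u" using cover by blast
    then obtain s' where s': "flat f D s'" "s' u b = s u b"
      using sec(2) b flat_fib[OF s(1) b(1) u] unfolding sectionable_def by blast
    have f': "continuous_map (top_of_set (C \<inter> D)) T f"
      using f by (rule continuous_map_from_subtopology_mono) auto
    have eq: "s w l = s' w l" if "l \<in> C \<inter> D" "f l \<in> U w" for l w
      using flat_unique[OF flat_mono[OF s(1)] flat_mono[OF s'(1)] f' CD(3) _ u s'(2)[symmetric] that] b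
      by blast
    define r where "r w l = (if l \<in> C then s w l else s' w l)" for w l
    have rD: "r w l = s' w l" if "l \<in> D" "f l \<in> U w" for w l
      using eq that by (auto simp: r_def)
    have "flat f (C \<union> D) r"
      unfolding flat_def
    proof (intro ballI allI impI conjI)
      fix l w assume l: "l \<in> C \<union> D" "f l \<in> U w"
      show "r w l \<in> Fib w"
        using l flat_fib[OF s(1) _ l(2)] flat_fib[OF s'(1) _ l(2)] by (auto simp: r_def)
      show "r w' l = tr w w' (r w l)" if "f l \<in> U w'" for w'
        using l flat_tr[OF s(1) _ l(2) that] flat_tr[OF s'(1) _ l(2) that] by (auto simp: r_def)
      have "eventually (\<lambda>k'. r w k' = r w l) (at l within C)"
      proof (cases "l \<in> C")
        case True
        have "eventually (\<lambda>k'. k' \<in> C) (at l within C)" by (simp add: eventually_at_filter)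
        with flat_ev[OF s(1) True l(2)] show ?thesis
          by eventually_elim (use True in \<open>auto simp: r_def\<close>)
      next
        case False
        then have "at l within C = bot" using CD(1) by (meson closed_limpt islimpt_def trivial_limit_within)
        then show ?thesis by simp
      qed
      moreover have "eventually (\<lambda>k'. r w k' = r w l) (at l within D)"
      proof (cases "l \<in> D")
        case True
        have *: "continuous_map (top_of_set D) T f"
          using f by (rule continuous_map_from_subtopology_mono) auto
        from flat_ev[OF s'(1) True l(2)] eventually_in_U[OF * True l(2)] show ?thesis
          by eventually_elim (use rD True l in auto)
      next
        case False
        then have "at l within D = bot" using CD(2) by (meson closed_limpt islimpt_def trivial_limit_within)
        then show ?thesis by simp
      qed
      ultimately show "eventually (\<lambda>k'. r w k' = r w l) (at l within C \<union> D)"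
        by (simp add: at_within_union eventually_sup)
    qed
    moreover have "r v k = a" using k s by (simp add: r_def)
    ultimately show ?thesis by blast
  qed
  show ?thesis
    unfolding sectionable_def
  proof (intro ballI allI impI)
    fix k v a assume k: "k \<in> A \<union> B" "f k \<in> U v" "a \<in> Fib v"
    show "\<exists>s. flat f (A \<union> B) s \<and> s v k = a"
    proof (cases "k \<in> A")
      case True
      then show ?thesis using ext[OF AB sec f True k(2,3)] by blast
    next
      case False
      then have "k \<in> B" using k by blast
      then show ?thesis
        using ext[of B A k v a] AB sec f k by (simp add: Int_commute Un_commute)
    qed
  qed
qed

text \<open>A Lebesgue number argument as two nested bisections: around each \<open>x\<close> a thin
  strip over the whole of \<open>{c0..d0}\<close> is sectionable, and this is itself proved by
  bisecting in the second variable. Adjacent rectangles meet in a segment, which is connected. With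
  \<open>f\<close> given on the whole plane, no boundary points need separate treatment.\<close>

lemma sectionable_square:
  fixes f :: "real \<times> real \<Rightarrow> 'x"
  assumes f: "continuous_map euclidean T f" and "a0 \<le> b0" "c0 \<le> d0"
  shows "sectionable f ({a0..b0} \<times> {c0..d0})"
proof -
  define P where "P a b c d \<longleftrightarrow> sectionable f ({a..b} \<times> {c..d})" for a b c d :: real
  have f': "continuous_map (top_of_set A) T f" for A
    using f by (rule continuous_map_from_subtopology)
  have glue: "sectionable f (A \<union> B)"
    if "sectionable f A" "sectionable f B" "closed A" "closed B" "A \<inter> B = {a..b} \<times> {c..d}" "a \<le> b" "c \<le> d"
    for A B a b c d
  proof (rule sectionable_Un[OF f' that(3,4) _ _ that(1,2)])
    show "connected (A \<inter> B)"
      unfolding that(5) by (intro connected_Times) auto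
    show "A \<inter> B \<noteq> {}" using that(5,6,7) by simp
  qed
  have "P a0 b0 c0 d0"
  proof (rule Bolzano[of a0 b0 "\<lambda>a b. P a b c0 d0"])
    fix a b c :: real assume *: "P a b c0 d0" "P b c c0 d0" "a \<le> b" "b \<le> c"
    have "{a..b} \<times> {c0..d0} \<inter> {b..c} \<times> {c0..d0} = {b..b} \<times> {c0..d0}" using * by auto
    moreover have "{a..c} \<times> {c0..d0} = {a..b} \<times> {c0..d0} \<union> {b..c} \<times> {c0..d0}"
      using * by auto
    ultimately show "P a c c0 d0"
      using glue[of "{a..b} \<times> {c0..d0}" "{b..c} \<times> {c0..d0}" b b c0 d0] * assms(3)
      unfolding P_def by (simp add: closed_Times)
  next
    fix x :: real
    let ?Q = "\<lambda>c d. \<exists>e>0. \<forall>a b. a \<le> x \<and> x \<le> b \<and> b - a < e \<longrightarrow> P a b c d"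
    show "?Q c0 d0"
    proof (rule Bolzano[of c0 d0 ?Q])
      fix p q r :: real assume *: "?Q p q" "?Q q r" "p \<le> q" "q \<le> r"
      obtain e where e: "e > 0" "\<And>a b. a \<le> x \<Longrightarrow> x \<le> b \<Longrightarrow> b - a < e \<Longrightarrow> P a b p q"
        using *(1) by blast
      obtain e' where e': "e' > 0" "\<And>a b. a \<le> x \<Longrightarrow> x \<le> b \<Longrightarrow> b - a < e' \<Longrightarrow> P a b q r"
        using *(2) by blast
      have "P a b p r" if ab: "a \<le> x" "x \<le> b" "b - a < min e e'" for a b
      proof -
        have "{a..b} \<times> {p..q} \<inter> {a..b} \<times> {q..r} = {a..b} \<times> {q..q}" using * by auto
        moreover have "{a..b} \<times> {p..r} = {a..b} \<times> {p..q} \<union> {a..b} \<times> {q..r}" using * by auto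
        moreover have "P a b p q" "P a b q r" using ab e e' by auto
        ultimately show ?thesis
          using glue[of "{a..b} \<times> {p..q}" "{a..b} \<times> {q..r}" a b q q] ab
          unfolding P_def by (simp add: closed_Times)
      qed
      then show "?Q p r" using e(1) e'(1) by (intro exI[of _ "min e e'"]) auto
    next
      fix y :: real
      have "f (x, y) \<in> topspace T" using f by (auto simp: continuous_map_def)
      then obtain u where u: "f (x, y) \<in> U u" using cover by blast
      then have "eventually (\<lambda>k. f k \<in> U u) (at (x, y))"
        using eventually_in_U[OF f'[of UNIV], of "(x, y)" u] by simp
      then obtain e where e: "e > 0" "\<And>k. k \<noteq> (x, y) \<Longrightarrow> dist k (x, y) < e \<Longrightarrow> f k \<in> U u"
        unfolding eventually_at by auto
      \<comment> \<open>Both sides are shorter than \<open>e/2\<close>, so the sum of the coordinate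
        distances to \<open>(x, y)\<close>, which bounds the Euclidean distance, stays below
        \<open>e\<close>.\<close>
      have PP: "P a b c d"
        if that: "a \<le> x" "x \<le> b" "b - a < e/2" "c \<le> y" "y \<le> d" "d - c < e/2" for a b c d
        unfolding P_def
      proof (rule sectionable_local, rule image_subsetI)
        fix k assume k: "k \<in> {a..b} \<times> {c..d}"
        obtain k1 k2 where kk: "k = (k1, k2)" by (cases k)
        have "dist k (x, y) \<le> dist k1 x + dist k2 y"
          unfolding kk dist_Pair_Pair by (rule sqrt_sum_squares_le_sum) auto
        also have "\<dots> < e" using k that unfolding kk dist_real_def by auto
        finally show "f k \<in> U u" using e(2)[of k] u by (cases "k = (x, y)") auto
      qed
      have "?Q p q" if "p \<le> y" "y \<le> q" "q - p < e/2" for p q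
        using e(1) PP that by (intro exI[of _ "e/2"]) auto
      then show "\<exists>d>0. \<forall>p q. p \<le> y \<and> y \<le> q \<and> q - p < d \<longrightarrow> ?Q p q"
        using e(1) by (intro exI[of _ "e/2"]) auto
    qed (use assms in simp_all)
  qed (use assms in simp_all)
  then show ?thesis by (simp add: P_def)
qed

lemma flat_const:
  assumes "flat f A s" "connected A" "\<And>k. k \<in> A \<Longrightarrow> f k \<in> U v" "k \<in> A" "l \<in> A"
  shows "s v k = s v l"
proof (rule connected_local_const[OF assms(2,4,5)], rule ballI)
  fix a assume a: "a \<in> A"
  from flat_ev[OF assms(1) a assms(3)[OF a]]
  show "eventually (\<lambda>b. s v a = s v b) (at a within A)" by eventually_elim simp
qed

lemma sectionable_path:
  assumes "pathin T p"
  shows "sectionable p {0..1}"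
  unfolding sectionable_def
proof (intro ballI allI impI)
  fix k v a assume k: "k \<in> {0..1::real}" "p k \<in> U v" "a \<in> Fib v"
  \<comment> \<open>The path becomes a map of the plane that ignores the first coordinate and clamps
    the second to the unit interval.\<close>
  define c where "c y = max 0 (min 1 y)" for y :: real
  have c: "c y = y" if "y \<in> {0..1}" for y using that by (auto simp: c_def)
  have "continuous_on UNIV (\<lambda>z :: real \<times> real. c (snd z))"
    unfolding c_def by (intro continuous_intros)
  then have "continuous_map euclidean (top_of_set {0..1}) (\<lambda>z :: real \<times> real. c (snd z))"
    by (simp add: continuous_map_in_subtopology c_def)
  then have "continuous_map euclidean T (p \<circ> (\<lambda>z :: real \<times> real. c (snd z)))"
    using assms unfolding pathin_def by (rule continuous_map_compose)
  then have sec: "sectionable (p \<circ> (\<lambda>z :: real \<times> real. c (snd z))) ({0..1} \<times> {0..1})"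
    by (intro sectionable_square) auto
  have "(0 :: real, k) \<in> {0..1} \<times> {0..1}" "(p \<circ> (\<lambda>z. c (snd z))) (0, k) \<in> U v"
    using k c by auto
  then obtain s where s: "flat (p \<circ> (\<lambda>z :: real \<times> real. c (snd z))) ({0..1} \<times> {0..1}) s"
    "s v (0, k) = a"
    using sec[unfolded sectionable_def, rule_format, OF _ _ k(3)] by blast
  have "flat p {0..1} (\<lambda>v y. s v (0, y))"
    by (rule flat_reparam[OF s(1)]) (auto intro!: continuous_intros simp: c)
  then show "\<exists>s. flat p {0..1} s \<and> s v k = a" using s(2) by blast
qed

section \<open>Parallel transport and its independence of the path\<close>

definition moves :: "'x \<Rightarrow> 'v \<Rightarrow> 'l \<Rightarrow> 'x \<Rightarrow> 'v \<Rightarrow> 'l \<Rightarrow> bool" where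
  "moves x v a y w b \<longleftrightarrow> x \<in> U v \<and> y \<in> U w \<and> (\<exists>p s. pathin T p \<and> p 0 = x \<and> p 1 = y \<and>
     flat p {0..1::real} s \<and> s v 0 = a \<and> s w 1 = b)"

lemma moves_exists:
  assumes "pathin T p" "p 0 \<in> U v" "p 1 \<in> U w" "a \<in> Fib v"
  shows "\<exists>b. moves (p 0) v a (p 1) w b"
proof -
  obtain s where "flat p {0..1} s" "s v 0 = a"
    using sectionable_path[OF assms(1)] assms unfolding sectionable_def by fastforce
  then show ?thesis using assms unfolding moves_def by blast
qed

lemma moves_fib: "moves x v a y w b \<Longrightarrow> a \<in> Fib v \<and> b \<in> Fib w"
  unfolding moves_def using flat_fib by fastforce

lemma moves_in_U:
  assumes "pathin T p" "\<And>t. t \<in> {0..1} \<Longrightarrow> p t \<in> U v" "p 1 \<in> U w" "a \<in> Fib v"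
  shows "moves (p 0) v a (p 1) w (tr v w a)"
proof -
  obtain s where s: "flat p {0..1} s" "s v 0 = a"
    using sectionable_path[OF assms(1)] assms unfolding sectionable_def by fastforce
  have "s v 0 = s v 1" by (rule flat_const[OF s(1) _ assms(2)]) auto
  then have "s w 1 = tr v w a" using flat_tr[OF s(1), of 1 v w] s(2) assms(2,3) by simp
  then show ?thesis using assms(1-3) s unfolding moves_def by auto
qed

lemma moves_sym:
  assumes "moves x v a y w b"
  shows "moves y w b x v a"
proof -
  obtain p s where p: "pathin T p" "p 0 = x" "p 1 = y" and s: "flat p {0..1::real} s" "s v 0 = a" "s w 1 = b"
    and xy: "x \<in> U v" "y \<in> U w"
    using assms unfolding moves_def by blast
  have "continuous_map (top_of_set {0..1}) (top_of_set {0..1}) (\<lambda>t::real. 1 - t)"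
    by (auto simp: continuous_map_in_subtopology intro!: continuous_intros)
  then have "pathin T (p \<circ> (\<lambda>t. 1 - t))"
    using p(1) unfolding pathin_def by (rule continuous_map_compose)
  moreover have "flat (p \<circ> (\<lambda>t. 1 - t)) {0..1} (\<lambda>v t. s v (1 - t))"
    by (rule flat_reparam[OF s(1)]) (auto intro!: continuous_intros)
  ultimately show ?thesis using p s xy unfolding moves_def
    by (intro conjI exI[of _ "p \<circ> (\<lambda>t. 1 - t)"] exI[of _ "\<lambda>v t. s v (1 - t)"]) auto
qed

lemma moves_trans:
  assumes "moves x v a y w b" "moves y w b z u c"
  shows "moves x v a z u c"
proof -
  obtain p s where p: "pathin T p" "p 0 = x" "p 1 = y" and s: "flat p {0..1::real} s" "s v 0 = a" "s w 1 = b"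
    and xy: "x \<in> U v" "y \<in> U w"
    using assms unfolding moves_def by blast
  obtain q s' where q: "pathin T q" "q 0 = y" "q 1 = z" and s': "flat q {0..1::real} s'" "s' w 0 = b" "s' u 1 = c"
    and z: "z \<in> U u"
    using assms unfolding moves_def by blast
  define r where "r t = (if t \<le> 1/2 then (p \<circ> (\<lambda>t. 2 * t)) t else (q \<circ> (\<lambda>t. 2 * t - 1)) t)" for t :: real
  have "pathin T r"
    unfolding pathin_def r_def
  proof (rule continuous_map_cases_le)
    have "continuous_map (subtopology (top_of_set {0..1}) {t \<in> topspace (top_of_set {0..1}). t \<le> 1/2})
        (top_of_set {0..1}) (\<lambda>t::real. 2 * t)"
      by (auto simp: continuous_map_in_subtopology subtopology_subtopology intro!: continuous_intros)
    then show "continuous_map (subtopology (top_of_set {0..1}) {t \<in> topspace (top_of_set {0..1}). t \<le> 1/2})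
        T (p \<circ> (\<lambda>t. 2 * t))"
      using p(1) unfolding pathin_def by (rule continuous_map_compose)
    have "continuous_map (subtopology (top_of_set {0..1}) {t \<in> topspace (top_of_set {0..1}). 1/2 \<le> t})
        (top_of_set {0..1}) (\<lambda>t::real. 2 * t - 1)"
      by (auto simp: continuous_map_in_subtopology subtopology_subtopology intro!: continuous_intros)
    then show "continuous_map (subtopology (top_of_set {0..1}) {t \<in> topspace (top_of_set {0..1}). 1/2 \<le> t})
        T (q \<circ> (\<lambda>t. 2 * t - 1))"
      using q(1) unfolding pathin_def by (rule continuous_map_compose)
  next
    fix t :: real assume t: "t = 1/2"
    show "(p \<circ> (\<lambda>t. 2 * t)) t = (q \<circ> (\<lambda>t. 2 * t - 1)) t" unfolding t by (simp add: p q)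
  qed auto
  moreover have r01: "r 0 = x" "r 1 = z" using p q by (simp_all add: r_def)
  moreover have "a \<in> Fib v" using moves_fib assms(1) by blast
  \<comment> \<open>A fresh section along the concatenated path; uniqueness on each half identifies
    it with the two given sections, so nothing has to be glued.\<close>
  ultimately obtain S where S: "flat r {0..1} S" "S v 0 = a"
    using sectionable_path[of r] xy(1) unfolding sectionable_def by fastforce
  have S1: "flat p {0..1} (\<lambda>v t. S v (t / 2))"
    by (rule flat_reparam[OF S(1)]) (auto intro!: continuous_intros simp: r_def)
  have S2: "flat q {0..1} (\<lambda>v t. S v ((t + 1) / 2))"
    by (rule flat_reparam[OF S(1)]) (auto intro!: continuous_intros simp: r_def p q add_divide_distrib)
  have "S w (1/2) = s w 1"
    using flat_unique[OF S1 s(1) p(1)[unfolded pathin_def], of 0 v 1 w] S(2) s xy p by simp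
  then have "S u 1 = s' u 1"
    using flat_unique[OF S2 s'(1) q(1)[unfolded pathin_def], of 0 w 1 u] s s' xy z q by simp
  then show ?thesis
    using \<open>pathin T r\<close> r01 S xy z s'(3) unfolding moves_def by blast
qed

text \<open>A null homotopy of the loop maps a square to the space: one side is the loop and the
  other three go to \<open>x\<close>. A flat section over the square is constant along those three
  sides, so its values at the two ends of the loop coincide.\<close>

lemma moves_loop:
  assumes sc: "simply_connected_space T" and "moves x v a x v b"
  shows "a = b"
proof -
  obtain p s where p: "pathin T p" "p 0 = x" "p 1 = x" and s: "flat p {0..1::real} s" "s v 0 = a" "s v 1 = b"
    and x: "x \<in> U v"
    using assms(2) unfolding moves_def by blast
  have "homotopic_with (\<lambda>h. h 0 = p 0 \<and> h 1 = p 0) (top_of_set {0..1}) T p (\<lambda>_. p 0)"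
    using sc[unfolded simply_connected_space_def, THEN conjunct2, rule_format, of p] p by simp
  then obtain H where H: "continuous_map (prod_topology (top_of_set {0..1::real}) (top_of_set {0..1::real})) T H"
    "\<And>y. H (0, y) = p y" "\<And>y. H (1, y) = x" "\<And>t. t \<in> {0..1} \<Longrightarrow> H (t, 0) = x \<and> H (t, 1) = x"
    unfolding homotopic_with_def using p(2) by auto
  define c where "c y = max 0 (min 1 y)" for y :: real
  have c: "c y = y" if "y \<in> {0..1}" for y using that by (auto simp: c_def)
  define C where "C z = (c (fst z), c (snd z))" for z
  have "continuous_on UNIV C"
    unfolding c_def C_def by (intro continuous_intros)
  then have "continuous_map euclidean (top_of_set ({0..1} \<times> {0..1})) C"
    by (auto simp: continuous_map_in_subtopology c_def C_def)
  then have f: "continuous_map euclidean T (H \<circ> C)"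
    using H(1) unfolding prod_topology_subtopology_eu by (rule continuous_map_compose)
  have "sectionable (H \<circ> C) ({0..1} \<times> {0..1})"
    using f by (intro sectionable_square) auto
  moreover have "(H \<circ> C) (0, 0) \<in> U v" using H x p by (simp add: C_def c)
  moreover have "a \<in> Fib v" using moves_fib assms(2) by blast
  ultimately obtain S where S: "flat (H \<circ> C) ({0..1} \<times> {0..1}) S" "S v (0, 0) = a"
    unfolding sectionable_def by fastforce
  have "flat p {0..1} (\<lambda>v y. S v (0, y))"
    by (rule flat_reparam[OF S(1)]) (auto intro!: continuous_intros simp: C_def c H)
  then have "S v (0, 1) = s v 1"
    using flat_unique[OF _ s(1) p(1)[unfolded pathin_def], of _ 0 v 1 v] S(2) s x p by simp
  moreover have "S v (0, 0) = S v (1, 0)" "S v (1, 0) = S v (1, 1)" "S v (1, 1) = S v (0, 1)"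
  proof -
    have *: "S v k = S v l" if "A \<subseteq> {0..1} \<times> {0..1}" "connected A" "k \<in> A" "l \<in> A"
      "\<And>z. z \<in> A \<Longrightarrow> (H \<circ> C) z = x" for A k l
      using flat_const[OF flat_mono[OF S(1) that(1)] that(2) _ that(3,4), of v] that(5) x by metis
    have con: "connected ({a..b} \<times> {c..d})" for a b c d :: real
      by (intro connected_Times) auto
    show "S v (0, 0) = S v (1, 0)"
      by (rule *[of "{0..1} \<times> {0..0}"]) (use con H in \<open>auto simp: C_def c\<close>)
    show "S v (1, 0) = S v (1, 1)"
      by (rule *[of "{1..1} \<times> {0..1}"]) (use con H in \<open>auto simp: C_def c\<close>)
    show "S v (1, 1) = S v (0, 1)"
      by (rule *[of "{0..1} \<times> {1..1}"]) (use con H in \<open>auto simp: C_def c\<close>)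
  qed
  ultimately show ?thesis using S(2) s(3) by simp
qed

text \<open>The section is transport from \<open>v0\<close>: path connectedness provides a value at
  each vertex and \<open>moves_loop\<close> makes it unique. An adjacency consists of two paths with
  a common end, each inside its own chart, so following one and then the other backwards changes the
  value exactly by \<open>tr\<close>.\<close>

theorem section_exists:
  assumes sc: "simply_connected_space T"
    and base: "\<And>v. v \<in> V \<Longrightarrow> base v \<in> U v"
    and adj: "\<And>v w. adj v w \<Longrightarrow> v \<in> V \<and> w \<in> V \<and> (\<exists>p q. pathin T p \<and> pathin T q \<and>
      p 0 = base v \<and> q 0 = base w \<and> p 1 = q 1 \<and> p ` {0..1} \<subseteq> U v \<and> q ` {0..1} \<subseteq> U w)"
    and a0: "v0 \<in> V" "a0 \<in> Fib v0"
  shows "\<exists>\<sigma>. \<sigma> v0 = a0 \<and> (\<forall>v\<in>V. \<sigma> v \<in> Fib v) \<and> (\<forall>v w. adj v w \<longrightarrow> \<sigma> w = tr v w (\<sigma> v))"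
proof -
  have top: "base v \<in> topspace T" if "v \<in> V" for v
    using base[OF that] openin_subset[OF openin_U] by blast
  have ex: "\<exists>b. moves (base v0) v0 a0 (base v) v b" if v: "v \<in> V" for v
  proof -
    obtain p where "pathin T p" "p 0 = base v0" "p 1 = base v"
      using sc top[OF a0(1)] top[OF v]
      unfolding simply_connected_space_def path_connected_space_def by blast
    then show ?thesis using moves_exists[of p v0 v a0] base a0 v by auto
  qed
  have un: "b = c" if "moves (base v0) v0 a0 (base v) v b" "moves (base v0) v0 a0 (base v) v c" for v b c
    using moves_loop[OF sc moves_trans[OF moves_sym[OF that(1)] that(2)]] .
  define \<sigma> where "\<sigma> v = (THE b. moves (base v0) v0 a0 (base v) v b)" for v
  have \<sigma>: "\<sigma> v = b" if "moves (base v0) v0 a0 (base v) v b" for v b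
    unfolding \<sigma>_def using that un[OF _ that] by (rule the_equality)
  have \<sigma>': "moves (base v0) v0 a0 (base v) v (\<sigma> v)" if "v \<in> V" for v
    using ex[OF that] \<sigma> by blast
  have "\<sigma> v0 = a0"
  proof (rule \<sigma>)
    have "moves (base v0) v0 a0 (base v0) v0 (tr v0 v0 a0)"
      using moves_in_U[of "\<lambda>_. base v0" v0 v0 a0] base a0 top by (simp add: pathin_const)
    then show "moves (base v0) v0 a0 (base v0) v0 a0" using tr_refl a0 by simp
  qed
  moreover have "\<sigma> v \<in> Fib v" if "v \<in> V" for v
    using \<sigma>'[OF that] moves_fib by blast
  moreover have "\<sigma> w = tr v w (\<sigma> v)" if vw: "adj v w" for v w
  proof (rule \<sigma>)
    obtain p q where pq: "pathin T p" "pathin T q" "p 0 = base v" "q 0 = base w" "p 1 = q 1"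
      "p ` {0..1} \<subseteq> U v" "q ` {0..1} \<subseteq> U w" and V: "v \<in> V" "w \<in> V"
      using adj[OF vw] by blast
    have fib: "\<sigma> v \<in> Fib v" using \<sigma>'[OF V(1)] moves_fib by blast
    have y: "q 1 \<in> U v" "q 1 \<in> U w" using pq by (metis atLeastAtMost_iff image_subset_iff order_refl zero_le_one)+
    have 1: "moves (base v) v (\<sigma> v) (q 1) w (tr v w (\<sigma> v))"
      using moves_in_U[OF pq(1), of v w "\<sigma> v"] pq y fib by (auto simp: image_subset_iff)
    have 2: "tr v w (\<sigma> v) \<in> Fib w" using tr_closed[OF y fib] .
    have "moves (base w) w (tr v w (\<sigma> v)) (q 1) w (tr v w (\<sigma> v))"
      using moves_in_U[OF pq(2), of w w "tr v w (\<sigma> v)"] pq y 2 tr_refl[OF 2]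
      by (auto simp: image_subset_iff)
    then show "moves (base v0) v0 a0 (base w) w (tr v w (\<sigma> v))"
      using moves_trans[OF moves_trans[OF \<sigma>'[OF V(1)] 1] moves_sym] by blast
  qed
  ultimately show ?thesis by blast
qed

end

section \<open>Open stars in the realization\<close>

text \<open>The open star of a vertex is described on representatives \<open>((p, x), t)\<close>, without reference to
  the carrier of a point: the condition is invariant under gluing.\<close>

definition star_reps :: "'b vec \<Rightarrow> ((nat \<times> 'b vec list) \<times> (nat \<Rightarrow> real)) set" where
  "star_reps v = {((p, x), t) | p x t. \<exists>i\<le>p. x ! i = v \<and> t i > 0}"

text \<open>The topological part uses only the lengths of the tuples and closure under faces; linear
  algebra enters later.\<close>

locale vector_simplices =
  fixes S :: "nat \<Rightarrow> 'b vec list set"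
  assumes length_S: "x \<in> S p \<Longrightarrow> length x = Suc p"
    and face_S: "x \<in> S (Suc p) \<Longrightarrow> i \<le> Suc p \<Longrightarrow> frame_face i x \<in> S p"
begin

abbreviation "R \<equiv> gluing_rel S frame_face"
abbreviation "X \<equiv> geometric_realization S frame_face"
abbreviation "D \<equiv> topspace (simplices_topology S)"

definition star :: "'b vec \<Rightarrow> ((nat \<times> 'b vec list) \<times> (nat \<Rightarrow> real)) set set" where
  "star v = {C \<in> topspace X. C \<inter> star_reps v \<noteq> {}}"

lemma topspace_D: "D = {((p, x), t) | p x t. x \<in> S p \<and> t \<in> standard_simplex p}"
  by (auto simp: simplices_topology_def topspace_sum_topology)

lemma topspace_X: "topspace X = D // R"
  by (simp add: geometric_realization_def topspace_quotient_topology)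

text \<open>The coface inserts a zero coordinate at position \<open>i\<close>, the position of the
  deleted vertex. Positive coordinates therefore sit at surviving vertices, whose positions are kept
  below \<open>i\<close> and shifted by one above it.\<close>

lemma star_reps_face:
  assumes "(a, b) \<in> face_gluing S frame_face"
  shows "a \<in> star_reps v \<longleftrightarrow> b \<in> star_reps v"
proof -
  obtain p x i t where *: "a = ((Suc p, x), simplical_face i t)" "b = ((p, frame_face i x), t)"
    "x \<in> S (Suc p)" "i \<le> Suc p"
    using assms by (auto simp: face_gluing_def)
  have len: "length x = Suc (Suc p)" using length_S[OF *(3)] .
  have nth: "frame_face i x ! k = (if k < i then x ! k else x ! Suc k)" if "k \<le> p" for k
    using that len *(4) by (simp add: nth_frame_face)
  show ?thesis
  proof
    assume "a \<in> star_reps v"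
    then obtain j where j: "j \<le> Suc p" "x ! j = v" "simplical_face i t j > 0"
      by (auto simp: star_reps_def *)
    then have "j < i \<or> j > i" by (auto simp: simplical_face_def split: if_splits)
    then show "b \<in> star_reps v"
    proof
      assume "j < i"
      moreover from this have "j \<le> p" using *(4) by simp
      ultimately show ?thesis using j nth[of j]
        by (auto simp: star_reps_def * simplical_face_def intro!: exI[of _ j])
    next
      assume "j > i"
      then show ?thesis using j nth[of "j - 1"]
        by (auto simp: star_reps_def * simplical_face_def intro!: exI[of _ "j - 1"])
    qed
  next
    assume "b \<in> star_reps v"
    then obtain j where j: "j \<le> p" "frame_face i x ! j = v" "t j > 0"
      by (auto simp: star_reps_def *)
    then show "a \<in> star_reps v"
      using nth[of j] 
      by (auto simp: star_reps_def * simplical_face_def split: if_splits intro!: exI[of _ "if j < i then j else Suc j"])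
  qed
qed

lemma star_reps_R:
  assumes "(a, b) \<in> R"
  shows "a \<in> star_reps v \<longleftrightarrow> b \<in> star_reps v"
proof -
  have "(a, b) \<in> (face_gluing S frame_face \<union> (face_gluing S frame_face)\<inverse>)\<^sup>*"
    using assms by (simp add: gluing_rel_def)
  then show ?thesis
    by (induction rule: rtrancl_induct) (use star_reps_face in blast)+
qed

lemma class_in_star:
  assumes "z \<in> D"
  shows "R `` {z} \<in> star v \<longleftrightarrow> z \<in> star_reps v"
proof -
  have "z \<in> R `` {z}" using assms by (auto simp: gluing_rel_def)
  then show ?thesis
    using star_reps_R[of z] quotientI[OF assms, of R] unfolding star_def topspace_X by blast
qed

text \<open>On a single simplex \<open>x\<close> the preimage is the union of the relatively open
  sets \<open>t k > 0\<close> over the positions \<open>k\<close> at which \<open>v\<close>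
  occurs.\<close>

lemma openin_star: "openin X (star v)"
proof -
  have "openin (simplices_topology S) {z \<in> D. R `` {z} \<in> star v}"
    unfolding simplices_topology_def[of S] openin_sum_topology
  proof (intro conjI ballI)
    show "{z \<in> topspace (sum_topology (\<lambda>(p, x). subtopology (powertop_real UNIV) (standard_simplex p))
        (Sigma UNIV S)). R `` {z} \<in> star v}
      \<subseteq> Sigma (Sigma UNIV S) (topspace \<circ> (\<lambda>(p, x). subtopology (powertop_real UNIV) (standard_simplex p)))"
      by (auto simp: topspace_sum_topology)
    fix i assume "i \<in> Sigma UNIV S"
    then obtain p x where i: "i = (p, x)" "x \<in> S p" by auto
    have "{t. (i, t) \<in> {z \<in> D. R `` {z} \<in> star v}} =
        {t \<in> standard_simplex p. (i, t) \<in> star_reps v}"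
      using class_in_star i by (auto simp: topspace_D)
    also have "\<dots> = (\<Union>k\<in>{k. k \<le> p \<and> x ! k = v}. {t. t k \<in> {0<..}}) \<inter> standard_simplex p"
      using i by (auto simp: star_reps_def)
    also have "openin (subtopology (powertop_real UNIV) (standard_simplex p)) \<dots>"
    proof -
      have "continuous_map (powertop_real UNIV) euclideanreal (\<lambda>t. t k)" for k :: nat
        by (rule continuous_map_product_projection) simp
      from openin_continuous_map_preimage[OF this, of "{0<..}"]
      have "openin (powertop_real UNIV) {t. t k \<in> {0<..}}" for k :: nat by simp
      then show ?thesis by (intro openin_subtopology_Int openin_Union) blast
    qed
    finally show "openin ((\<lambda>(p, x). subtopology (powertop_real UNIV) (standard_simplex p)) i)
        {t. (i, t) \<in> {z \<in> topspace (sum_topology (\<lambda>(p, x). subtopology (powertop_real UNIV)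
          (standard_simplex p)) (Sigma UNIV S)). R `` {z} \<in> star v}}"
      using i by (simp add: simplices_topology_def)
  qed
  moreover have "star v \<subseteq> D // R" by (auto simp: star_def topspace_X)
  ultimately show ?thesis
    by (simp add: geometric_realization_def openin_quotient_topology)
qed

lemma star_cover:
  assumes "C \<in> topspace X"
  shows "\<exists>v. C \<in> star v"
proof -
  obtain p x t where z: "((p, x), t) \<in> D" "C = R `` {((p, x), t)}"
    using assms unfolding topspace_X by (elim quotientE) auto
  then have t: "t \<in> standard_simplex p" by (simp add: topspace_D)
  have "\<exists>i\<le>p. t i > 0"
  proof (rule ccontr)
    assume "\<not> (\<exists>i\<le>p. t i > 0)"
    then have "sum t {..p} \<le> 0" by (intro sum_nonpos) auto
    then show False using t by (simp add: standard_simplex_def)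
  qed
  then obtain i where "i \<le> p" "t i > 0" by blast
  then have "((p, x), t) \<in> star_reps (x ! i)" by (auto simp: star_reps_def)
  then show ?thesis using class_in_star[OF z(1)] z(2) by blast
qed

text \<open>Gluing invariance lets one representative of \<open>C\<close> witness membership in all
  three stars. Hence conditions imposed on simplices suffice for the cocycle identity on
  overlaps.\<close>

lemma common_simplex:
  assumes "C \<in> star u" "C \<in> star v" "C \<in> star w"
  shows "\<exists>p x i j k. x \<in> S p \<and> i \<le> p \<and> j \<le> p \<and> k \<le> p \<and> x ! i = u \<and> x ! j = v \<and> x ! k = w"
proof -
  obtain p x t where z: "((p, x), t) \<in> D" "C = R `` {((p, x), t)}"
    using assms unfolding star_def topspace_X by (auto elim!: quotientE)
  then have "((p, x), t) \<in> star_reps u" "((p, x), t) \<in> star_reps v" "((p, x), t) \<in> star_reps w"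
    using assms class_in_star[OF z(1)] by auto
  moreover have "x \<in> S p" using z by (simp add: topspace_D)
  ultimately show ?thesis unfolding star_reps_def by blast
qed

section \<open>Vertices and edges inside the realization\<close>

definition edge_pt :: "real \<Rightarrow> nat \<Rightarrow> real" where
  "edge_pt s i = (if i = 0 then 1 - s else if i = 1 then s else 0)"

lemma edge_pt_simplex: "s \<in> {0..1} \<Longrightarrow> edge_pt s \<in> standard_simplex 1"
  by (auto simp: standard_simplex_def edge_pt_def)

lemma pathin_edge:
  assumes x: "x \<in> S 1" and c: "continuous_on {0..1} c" "c ` {0..1} \<subseteq> {0..1}"
  shows "pathin X (\<lambda>r. R `` {((1, x), edge_pt (c r))})"
proof -
  have "continuous_map (top_of_set {0..1}) euclideanreal (\<lambda>r. edge_pt (c r) i)" for i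
    using c(1) by (cases "i = 0"; cases "i = 1") (auto simp: edge_pt_def intro!: continuous_intros)
  then have "continuous_map (top_of_set {0..1}) (subtopology (powertop_real UNIV) (standard_simplex 1))
      (\<lambda>r. edge_pt (c r))"
    using c(2) edge_pt_simplex
    by (auto simp: continuous_map_in_subtopology continuous_map_componentwise_UNIV image_subset_iff)
  moreover have "continuous_map (subtopology (powertop_real UNIV) (standard_simplex 1))
      (simplices_topology S) (\<lambda>t. ((1, x), t))"
    using continuous_map_component_injection[of "(1, x)" "Sigma UNIV S"
        "\<lambda>(p, x). subtopology (powertop_real UNIV) (standard_simplex p)"] x
    by (simp add: simplices_topology_def)
  moreover have "continuous_map (simplices_topology S) X (\<lambda>z. R `` {z})"
    unfolding geometric_realization_def
    by (rule quotient_imp_continuous_map[OF quotient_map_quotient_topology])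
  ultimately have "continuous_map (top_of_set {0..1}) X
      ((\<lambda>z. R `` {z}) \<circ> ((\<lambda>t. ((1, x), t)) \<circ> (\<lambda>r. edge_pt (c r))))"
    by (intro continuous_map_compose)
  then show ?thesis by (simp add: pathin_def o_def)
qed

text \<open>The only nonzero coordinate of \<open>edge_pt 0\<close> is a 1 at index 0, so it also
  serves as the single point of the standard 0-simplex.\<close>

definition vertex_pt :: "'b vec \<Rightarrow> ((nat \<times> 'b vec list) \<times> (nat \<Rightarrow> real)) set" where
  "vertex_pt v = R `` {((0, [v]), edge_pt 0)}"

lemma vertex_in_D: "[v] \<in> S 0 \<Longrightarrow> ((0, [v]), edge_pt 0) \<in> D"
  by (auto simp: topspace_D standard_simplex_def edge_pt_def)

lemma edge_in_D: "x \<in> S 1 \<Longrightarrow> s \<in> {0..1} \<Longrightarrow> ((1, x), edge_pt s) \<in> D"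
  using edge_pt_simplex by (auto simp: topspace_D)

lemma edge_ends:
  assumes vw: "[v, w] \<in> S 1"
  shows "[v] \<in> S 0" "[w] \<in> S 0"
    "R `` {((1, [v, w]), edge_pt 0)} = vertex_pt v" "R `` {((1, [v, w]), edge_pt 1)} = vertex_pt w"
proof -
  show v: "[v] \<in> S 0" using face_S[of "[v, w]" 0 1] vw by (simp add: frame_face_def)
  show w: "[w] \<in> S 0" using face_S[of "[v, w]" 0 0] vw by (simp add: frame_face_def)
  have f1: "simplical_face 1 (edge_pt 0) = edge_pt 0"
    by (auto simp: simplical_face_def edge_pt_def)
  have f0: "simplical_face 0 (edge_pt 0) = edge_pt 1"
    by (auto simp: simplical_face_def edge_pt_def)
  have t: "edge_pt 0 \<in> standard_simplex 0" by (auto simp: standard_simplex_def edge_pt_def)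
  have "(((1, [v, w]), edge_pt 0), ((0, [v]), edge_pt 0)) \<in> face_gluing S frame_face"
    unfolding face_gluing_def using vw f1 t
    by (intro CollectI exI[of _ 0] exI[of _ "[v, w]"] exI[of _ 1] exI[of _ "edge_pt 0"])
      (simp add: frame_face_def)
  then have "(((1, [v, w]), edge_pt 0), ((0, [v]), edge_pt 0)) \<in> R"
    using vertex_in_D[OF v] edge_in_D[OF vw, of 0] by (auto simp: gluing_rel_def)
  then show "R `` {((1, [v, w]), edge_pt 0)} = vertex_pt v"
    unfolding vertex_pt_def by (rule equiv_class_eq[OF equiv_gluing_rel])
  have "(((1, [v, w]), edge_pt 1), ((0, [w]), edge_pt 0)) \<in> face_gluing S frame_face"
    unfolding face_gluing_def using vw f0 t
    by (intro CollectI exI[of _ 0] exI[of _ "[v, w]"] exI[of _ 0] exI[of _ "edge_pt 0"])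
      (simp add: frame_face_def)
  then have "(((1, [v, w]), edge_pt 1), ((0, [w]), edge_pt 0)) \<in> R"
    using vertex_in_D[OF w] edge_in_D[OF vw, of 1] by (auto simp: gluing_rel_def)
  then show "R `` {((1, [v, w]), edge_pt 1)} = vertex_pt w"
    unfolding vertex_pt_def by (rule equiv_class_eq[OF equiv_gluing_rel])
qed

theorem simply_connected_section:
  assumes sc: "simply_connected_space X"
    and tr_closed: "\<And>p x i j a. x \<in> S p \<Longrightarrow> i \<le> p \<Longrightarrow> j \<le> p \<Longrightarrow> a \<in> Fib (x ! i) \<Longrightarrow>
      tr (x ! i) (x ! j) a \<in> Fib (x ! j)"
    and tr_refl: "\<And>v a. a \<in> Fib v \<Longrightarrow> tr v v a = a"
    and tr_trans: "\<And>p x i j k a. x \<in> S p \<Longrightarrow> i \<le> p \<Longrightarrow> j \<le> p \<Longrightarrow> k \<le> p \<Longrightarrow> a \<in> Fib (x ! i) \<Longrightarrow>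
      tr (x ! j) (x ! k) (tr (x ! i) (x ! j) a) = tr (x ! i) (x ! k) a"
    and v0: "[v0] \<in> S 0" "a0 \<in> Fib v0"
  shows "\<exists>\<sigma>. \<sigma> v0 = a0 \<and> (\<forall>v. [v] \<in> S 0 \<longrightarrow> \<sigma> v \<in> Fib v) \<and>
    (\<forall>v w. [v, w] \<in> S 1 \<longrightarrow> \<sigma> w = tr v w (\<sigma> v))"
proof -
  interpret local_system X star Fib tr
  proof
    show "openin X (star v)" for v by (rule openin_star)
    show "\<exists>v. C \<in> star v" if "C \<in> topspace X" for C using star_cover[OF that] .
    show "tr v w a \<in> Fib w" if "C \<in> star v" "C \<in> star w" "a \<in> Fib v" for C v w a
      using common_simplex[OF that(1,2,2)] tr_closed that(3) by blast
    show "tr v v a = a" if "a \<in> Fib v" for v a using tr_refl that .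
    show "tr v w (tr u v a) = tr u w a"
      if "C \<in> star u" "C \<in> star v" "C \<in> star w" "a \<in> Fib u" for C u v w a
      using common_simplex[OF that(1-3)] tr_trans that(4) by blast
  qed
  \<comment> \<open>The two halves of the edge, both run towards the midpoint: the coordinate of
    \<open>v\<close> stays positive on the first and that of \<open>w\<close> on the second.\<close>
  have "\<exists>p q. pathin X p \<and> pathin X q \<and> p 0 = vertex_pt v \<and> q 0 = vertex_pt w \<and> p 1 = q 1 \<and>
      p ` {0..1} \<subseteq> star v \<and> q ` {0..1} \<subseteq> star w" if vw: "[v, w] \<in> S 1" for v w
  proof (rule exI[of _ "\<lambda>r. R `` {((1, [v, w]), edge_pt (r / 2))}"],
      rule exI[of _ "\<lambda>r. R `` {((1, [v, w]), edge_pt (1 - r / 2))}"], intro conjI)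
    show "pathin X (\<lambda>r. R `` {((1, [v, w]), edge_pt (r / 2))})"
      by (rule pathin_edge[OF vw]) (auto intro!: continuous_intros)
    show "pathin X (\<lambda>r. R `` {((1, [v, w]), edge_pt (1 - r / 2))})"
      by (rule pathin_edge[OF vw]) (auto intro!: continuous_intros)
    show "(\<lambda>r. R `` {((1, [v, w]), edge_pt (r / 2))}) ` {0..1} \<subseteq> star v"
    proof (rule image_subsetI)
      fix r :: real assume r: "r \<in> {0..1}"
      have "((1, [v, w]), edge_pt (r / 2)) \<in> star_reps v"
        using r by (auto simp: star_reps_def edge_pt_def intro!: exI[of _ "0::nat"])
      then show "R `` {((1, [v, w]), edge_pt (r / 2))} \<in> star v"
        using class_in_star[OF edge_in_D[OF vw]] r by simp
    qed
    show "(\<lambda>r. R `` {((1, [v, w]), edge_pt (1 - r / 2))}) ` {0..1} \<subseteq> star w"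
    proof (rule image_subsetI)
      fix r :: real assume r: "r \<in> {0..1}"
      have "((1, [v, w]), edge_pt (1 - r / 2)) \<in> star_reps w"
        using r by (auto simp: star_reps_def edge_pt_def intro!: exI[of _ "1::nat"])
      then show "R `` {((1, [v, w]), edge_pt (1 - r / 2))} \<in> star w"
        using class_in_star[OF edge_in_D[OF vw]] r by simp
    qed
  qed (use edge_ends[OF vw] in simp_all)
  then have "[v] \<in> S 0 \<and> [w] \<in> S 0 \<and> (\<exists>p q. pathin X p \<and> pathin X q \<and> p 0 = vertex_pt v \<and>
      q 0 = vertex_pt w \<and> p 1 = q 1 \<and> p ` {0..1} \<subseteq> star v \<and> q ` {0..1} \<subseteq> star w)"
    if vw: "[v, w] \<in> S 1" for v w
    using edge_ends(1,2)[OF vw] vw by simp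
  moreover have "vertex_pt v \<in> star v" if "[v] \<in> S 0" for v
    unfolding vertex_pt_def class_in_star[OF vertex_in_D[OF that]]
    by (auto simp: star_reps_def edge_pt_def)
  ultimately show ?thesis
    using section_exists[OF sc, of "{v. [v] \<in> S 0}" vertex_pt "\<lambda>v w. [v, w] \<in> S 1" v0 a0] v0 by auto
qed

end

section \<open>Steinberg relations in characteristic two\<close>

text \<open>The induction rule of \<open>generate\<close> splits products arbitrarily. Strengthening
  the claim to "left multiplication by \<open>x\<close> preserves \<open>Q\<close>" reduces it to
  single generators, and closure of \<open>S\<close> under inverses absorbs the inverse
  case.\<close>

lemma (in group) generate_induct_left [consumes 3, case_names one mult]:
  assumes S: "S \<subseteq> carrier G" and inv: "\<And>s. s \<in> S \<Longrightarrow> inv s \<in> S" and x: "x \<in> generate G S"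
    and one: "Q \<one>" and mult: "\<And>s y. s \<in> S \<Longrightarrow> y \<in> generate G S \<Longrightarrow> Q y \<Longrightarrow> Q (s \<otimes> y)"
  shows "Q x"
proof -
  have "\<forall>y\<in>generate G S. Q y \<longrightarrow> Q (x \<otimes> y)"
    using x
  proof (induction rule: generate.induct)
    case one
    then show ?case using generate_in_carrier[OF S] by simp
  next
    case (incl h)
    then show ?case using mult by blast
  next
    case (inv h)
    then show ?case using mult assms(2) by blast
  next
    case (eng h1 h2)
    have "h1 \<in> carrier G" "h2 \<in> carrier G" using eng.hyps generate_in_carrier[OF S] by auto
    then show ?case
      using eng generate_in_carrier[OF S] by (auto simp: m_assoc generate.eng)
  qed
  from bspec[OF this generate.one] one show ?thesis
    using generate_in_carrier[OF S x] by simp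
qed

text \<open>The Steinberg relations are abstracted from the presentation, with commutators written
  as equations of products so that no inverses occur. The abstraction is used in rank
  \<open>n\<close> and again in rank \<open>n - 1\<close>.\<close>

locale steinberg = group G for G (structure) +
  fixes n :: nat and X :: "nat \<Rightarrow> nat \<Rightarrow> 'r::ring_1 \<Rightarrow> 'a"
  assumes X_closed [simp, intro]: "i < n \<Longrightarrow> j < n \<Longrightarrow> i \<noteq> j \<Longrightarrow> X i j a \<in> carrier G"
    and X_add: "i < n \<Longrightarrow> j < n \<Longrightarrow> i \<noteq> j \<Longrightarrow> X i j a \<otimes> X i j b = X i j (a + b)"
    and X_commute: "i < n \<Longrightarrow> j < n \<Longrightarrow> k < n \<Longrightarrow> l < n \<Longrightarrow> i \<noteq> j \<Longrightarrow> k \<noteq> l \<Longrightarrow> i \<noteq> l \<Longrightarrow> j \<noteq> k \<Longrightarrow>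
      X i j a \<otimes> X k l b = X k l b \<otimes> X i j a"
    and X_comm: "i < n \<Longrightarrow> j < n \<Longrightarrow> k < n \<Longrightarrow> i \<noteq> j \<Longrightarrow> j \<noteq> k \<Longrightarrow> i \<noteq> k \<Longrightarrow>
      X i j a \<otimes> X j k b = X i k (a * b) \<otimes> (X j k b \<otimes> X i j a)"
    and generated: "carrier G = generate G {X i j a | i j a. i < n \<and> j < n \<and> i \<noteq> j}"
    and char2: "(a::'r::ring_1) + a = 0"
begin

lemma X_zero: "i < n \<Longrightarrow> j < n \<Longrightarrow> i \<noteq> j \<Longrightarrow> X i j 0 = \<one>"
  using X_add[of i j 0 0] X_closed[of i j 0] by (metis add_0 l_cancel_one)

lemma X_self: "i < n \<Longrightarrow> j < n \<Longrightarrow> i \<noteq> j \<Longrightarrow> X i j a \<otimes> X i j a = \<one>"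
  by (simp add: X_add char2 X_zero)

lemma X_self_left: "i < n \<Longrightarrow> j < n \<Longrightarrow> i \<noteq> j \<Longrightarrow> z \<in> carrier G \<Longrightarrow> X i j a \<otimes> (X i j a \<otimes> z) = z"
  by (simp add: m_assoc[symmetric] X_self)

lemma X_inv: "i < n \<Longrightarrow> j < n \<Longrightarrow> i \<noteq> j \<Longrightarrow> inv (X i j a) = X i j a"
  using inv_equality[OF X_self] by simp

text \<open>In characteristic two a commutator of generators may be moved to either side.\<close>

lemma X_comm': "i < n \<Longrightarrow> j < n \<Longrightarrow> k < n \<Longrightarrow> i \<noteq> j \<Longrightarrow> j \<noteq> k \<Longrightarrow> i \<noteq> k \<Longrightarrow>
    X j k b \<otimes> X i j a = X i k (a * b) \<otimes> (X i j a \<otimes> X j k b)"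
  by (simp add: X_comm X_self_left)

lemma swap_left:
  assumes "x \<otimes> y = z" "x \<in> carrier G" "y \<in> carrier G" "u \<in> carrier G"
  shows "x \<otimes> (y \<otimes> u) = z \<otimes> u"
  using assms by (simp add: m_assoc[symmetric])

section \<open>Subgroups generated by the initial columns\<close>

definition gens :: "nat \<Rightarrow> 'a set" where
  "gens m = {X k l a | k l a. k < n \<and> l < m \<and> k \<noteq> l}"

text \<open>On matrices, right multiplication by such a generator alters only column
  \<open>l\<close>, so the images of \<open>cols m\<close> fix the basis vectors from index
  \<open>m\<close> on. The values \<open>n - 1\<close> and \<open>n - 2\<close> of \<open>m\<close>
  correspond to vertices and to edges.\<close>

definition cols :: "nat \<Rightarrow> 'a set" where
  "cols m = generate G (gens m)"

lemma gens_carrier: "m \<le> n \<Longrightarrow> gens m \<subseteq> carrier G"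
  by (auto simp: gens_def)

lemma gens_inv: "m \<le> n \<Longrightarrow> s \<in> gens m \<Longrightarrow> inv s \<in> gens m"
  by (auto simp: gens_def X_inv) blast

lemma cols_subgroup: "m \<le> n \<Longrightarrow> subgroup (cols m) G"
  unfolding cols_def by (rule generate_is_subgroup[OF gens_carrier])

lemma cols_carrier: "m \<le> n \<Longrightarrow> x \<in> cols m \<Longrightarrow> x \<in> carrier G"
  by (rule subgroup.mem_carrier[OF cols_subgroup])

lemma cols_X: "k < n \<Longrightarrow> l < m \<Longrightarrow> k \<noteq> l \<Longrightarrow> X k l a \<in> cols m"
  unfolding cols_def by (rule generate.incl) (auto simp: gens_def)

lemma cols_mult: "x \<in> cols m \<Longrightarrow> y \<in> cols m \<Longrightarrow> x \<otimes> y \<in> cols m"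
  unfolding cols_def by (rule generate.eng)

lemma cols_one: "\<one> \<in> cols m"
  unfolding cols_def by (rule generate.one)

lemma cols_n: "cols n = carrier G"
  by (simp add: generated cols_def gens_def)

lemma cols_mono: "m \<le> m' \<Longrightarrow> cols m \<subseteq> cols m'"
  unfolding cols_def by (intro mono_generate) (fastforce simp: gens_def)

lemma cols_induct [consumes 2, case_names one mult]:
  assumes "x \<in> cols m" "m \<le> n" "Q \<one>"
    and "\<And>k l a y. k < n \<Longrightarrow> l < m \<Longrightarrow> k \<noteq> l \<Longrightarrow> y \<in> cols m \<Longrightarrow> Q y \<Longrightarrow> Q (X k l a \<otimes> y)"
  shows "Q x"
proof (rule generate_induct_left[OF gens_carrier[OF assms(2)] gens_inv[OF assms(2)] assms(1)[unfolded cols_def]])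
  fix s y assume "s \<in> gens m" "y \<in> generate G (gens m)" "Q y"
  then show "Q (s \<otimes> y)" using assms(4) unfolding gens_def cols_def by blast
qed (auto intro: assms(3))

section \<open>Weyl elements: lifts of transpositions of two indices\<close>

definition weyl :: "nat \<Rightarrow> nat \<Rightarrow> 'a" where
  "weyl i j = X i j 1 \<otimes> (X j i 1 \<otimes> X i j 1)"

lemma weyl_closed [simp, intro]: "i < n \<Longrightarrow> j < n \<Longrightarrow> i \<noteq> j \<Longrightarrow> weyl i j \<in> carrier G"
  by (simp add: weyl_def)

lemma weyl_self: "i < n \<Longrightarrow> j < n \<Longrightarrow> i \<noteq> j \<Longrightarrow> weyl i j \<otimes> weyl i j = \<one>"
  by (simp add: weyl_def m_assoc X_self_left X_self)

lemma weyl_self_left: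
  "i < n \<Longrightarrow> j < n \<Longrightarrow> i \<noteq> j \<Longrightarrow> z \<in> carrier G \<Longrightarrow> weyl i j \<otimes> (weyl i j \<otimes> z) = z"
  by (simp add: m_assoc[symmetric] weyl_self)

context
  fixes i j k :: nat
  assumes ijk: "i < n" "j < n" "k < n" "i \<noteq> j" "i \<noteq> k" "j \<noteq> k"
begin

text \<open>Moving \<open>X i k a\<close> to the left past the middle factor creates
  \<open>X j k a\<close>; moving that past the first factor creates a second \<open>X i k a\<close>,
  which cancels the original because generators are involutions.\<close>

lemma weyl_row: "weyl i j \<otimes> X i k a = X j k a \<otimes> weyl i j"
proof -
  note [simp] = ijk ijk(4-6)[symmetric] 
  let ?x = "X i j 1" and ?y = "X j i 1" and ?b = "X i k a" and ?c = "X j k a"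
  have xb: "?x \<otimes> ?b = ?b \<otimes> ?x" by (rule X_commute) simp_all
  have bc: "?b \<otimes> ?c = ?c \<otimes> ?b" by (rule X_commute) simp_all
  have xc: "?x \<otimes> ?c = ?b \<otimes> (?c \<otimes> ?x)" using X_comm[of i j k 1 a] by simp
  have yb: "?y \<otimes> ?b = ?c \<otimes> (?b \<otimes> ?y)" using X_comm[of j i k 1 a] by simp
  have "weyl i j \<otimes> ?b = ?x \<otimes> (?y \<otimes> (?b \<otimes> ?x))"
    by (simp add: weyl_def m_assoc xb)
  also have "\<dots> = ?x \<otimes> (?c \<otimes> (?b \<otimes> (?y \<otimes> ?x)))"
    by (simp add: swap_left[OF yb] m_assoc)
  also have "\<dots> = ?b \<otimes> (?c \<otimes> (?b \<otimes> (?x \<otimes> (?y \<otimes> ?x))))"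
    by (simp add: swap_left[OF xc] swap_left[OF xb] m_assoc)
  also have "\<dots> = ?c \<otimes> weyl i j"
    by (simp add: swap_left[OF bc] X_self_left m_assoc weyl_def)
  finally show ?thesis .
qed

lemma weyl_row': "weyl i j \<otimes> X j k a = X i k a \<otimes> weyl i j"
proof -
  note [simp] = ijk ijk(4-6)[symmetric]
  have "weyl i j \<otimes> X j k a = weyl i j \<otimes> ((X j k a \<otimes> weyl i j) \<otimes> weyl i j)"
    by (simp add: m_assoc weyl_self)
  also have "\<dots> = X i k a \<otimes> weyl i j"
    unfolding weyl_row[symmetric] by (simp add: m_assoc weyl_self_left)
  finally show ?thesis .
qed

lemma weyl_col': "weyl i j \<otimes> X k j a = X k i a \<otimes> weyl i j"
proof -
  note [simp] = ijk ijk(4-6)[symmetric]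
  let ?x = "X i j 1" and ?y = "X j i 1" and ?b = "X k j a" and ?c = "X k i a"
  have xb: "?x \<otimes> ?b = ?b \<otimes> ?x" by (rule X_commute) simp_all
  have bc: "?b \<otimes> ?c = ?c \<otimes> ?b" by (rule X_commute) simp_all
  have xc: "?x \<otimes> ?c = ?b \<otimes> (?c \<otimes> ?x)" using X_comm'[of k i j 1 a] by simp
  have yb: "?y \<otimes> ?b = ?c \<otimes> (?b \<otimes> ?y)" using X_comm'[of k j i 1 a] by simp
  have "weyl i j \<otimes> ?b = ?x \<otimes> (?y \<otimes> (?b \<otimes> ?x))"
    by (simp add: weyl_def m_assoc xb)
  also have "\<dots> = ?x \<otimes> (?c \<otimes> (?b \<otimes> (?y \<otimes> ?x)))"
    by (simp add: swap_left[OF yb] m_assoc)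
  also have "\<dots> = ?b \<otimes> (?c \<otimes> (?b \<otimes> (?x \<otimes> (?y \<otimes> ?x))))"
    by (simp add: swap_left[OF xc] swap_left[OF xb] m_assoc)
  also have "\<dots> = ?c \<otimes> weyl i j"
    by (simp add: swap_left[OF bc] X_self_left m_assoc weyl_def)
  finally show ?thesis .
qed

lemma weyl_col: "weyl i j \<otimes> X k i a = X k j a \<otimes> weyl i j"
proof -
  note [simp] = ijk ijk(4-6)[symmetric]
  have "weyl i j \<otimes> X k i a = weyl i j \<otimes> ((X k i a \<otimes> weyl i j) \<otimes> weyl i j)"
    by (simp add: m_assoc weyl_self)
  also have "\<dots> = X k j a \<otimes> weyl i j"
    unfolding weyl_col'[symmetric] by (simp add: m_assoc weyl_self_left)
  finally show ?thesis .
qed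

text \<open>Conjugation by \<open>weyl i j\<close> renames \<open>i\<close> to \<open>j\<close> in
  each of the three factors of \<open>weyl k i\<close>.\<close>

lemma weyl_weyl: "weyl i j \<otimes> weyl k i = weyl k j \<otimes> weyl i j"
proof -
  note [simp] = ijk ijk(4-6)[symmetric]
  have "weyl i j \<otimes> weyl k i = X k j 1 \<otimes> (X j k 1 \<otimes> (X k j 1 \<otimes> weyl i j))"
    by (simp add: weyl_def[of k i] swap_left[OF weyl_col] swap_left[OF weyl_row] weyl_col m_assoc)
  then show ?thesis by (simp add: weyl_def[of k j] m_assoc)
qed

end

text \<open>Each side conjugates one Weyl element by the other. Conjugation renames an index, so
  both sides collapse to \<open>weyl k j\<close>.\<close>

lemma weyl_braid:
  assumes "i < n" "j < n" "k < n" "i \<noteq> j" "i \<noteq> k" "j \<noteq> k"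
  shows "weyl i j \<otimes> (weyl k i \<otimes> weyl i j) = weyl k i \<otimes> (weyl i j \<otimes> weyl k i)"
proof -
  note [simp] = assms assms(4-6)[symmetric]
  have r: "weyl k i \<otimes> X i j a = X k j a \<otimes> weyl k i" for a by (rule weyl_row') simp_all
  have c: "weyl k i \<otimes> X j i a = X j k a \<otimes> weyl k i" for a by (rule weyl_col') simp_all
  have "weyl k i \<otimes> weyl i j = X k j 1 \<otimes> (X j k 1 \<otimes> (X k j 1 \<otimes> weyl k i))"
    by (simp add: weyl_def[of i j] swap_left[OF r] swap_left[OF c] r m_assoc)
  then have *: "weyl k i \<otimes> weyl i j = weyl k j \<otimes> weyl k i" by (simp add: weyl_def[of k j] m_assoc)
  have "weyl i j \<otimes> (weyl k i \<otimes> weyl i j) = weyl k j"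
    by (simp add: swap_left[OF weyl_weyl] m_assoc weyl_self)
  moreover have "weyl k i \<otimes> (weyl i j \<otimes> weyl k i) = weyl k j"
    by (simp add: swap_left[OF *] m_assoc weyl_self)
  ultimately show ?thesis by simp
qed

text \<open>With \<open>i\<close> and \<open>j\<close> at least \<open>m\<close>, column indices
  below \<open>m\<close> are untouched and the transposition acts on row indices alone, so the Weyl
  element normalises \<open>cols m\<close>.\<close>

lemma weyl_cols:
  assumes "q \<in> cols m" "m \<le> i" "m \<le> j" "i < n" "j < n" "i \<noteq> j"
  shows "\<exists>q'\<in>cols m. weyl i j \<otimes> q = q' \<otimes> weyl i j"
  using assms(1) order.trans[OF assms(2) less_imp_le[OF assms(4)]]
proof (induction rule: cols_induct)
  case one
  then show ?case using assms cols_one by (intro bexI[of _ \<one>]) auto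
next
  case (mult k l a y)
  have l: "l < n" "l \<noteq> i" "l \<noteq> j" using mult.hyps assms(2-5) by auto
  have m: "m \<le> n" using assms(2,4) by simp
  note [simp] = assms(4-6) assms(6)[symmetric]
  obtain q' where q': "q' \<in> cols m" "weyl i j \<otimes> y = q' \<otimes> weyl i j" using mult by blast
  have "\<exists>k'<n. k' \<noteq> l \<and> weyl i j \<otimes> X k l a = X k' l a \<otimes> weyl i j"
  proof (cases "k = i \<or> k = j")
    case True
    have "weyl i j \<otimes> X i l a = X j l a \<otimes> weyl i j" "weyl i j \<otimes> X j l a = X i l a \<otimes> weyl i j"
      using weyl_row[of i j l a] weyl_row'[of i j l a] l by auto
    then show ?thesis using True l assms(4,5) by metis
  next
    case False
    have 1: "X i j 1 \<otimes> X k l a = X k l a \<otimes> X i j 1" and 2: "X j i 1 \<otimes> X k l a = X k l a \<otimes> X j i 1"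
      using False l mult.hyps by (auto intro!: X_commute)
    have "weyl i j \<otimes> X k l a = X k l a \<otimes> weyl i j"
      using l mult.hyps by (simp add: weyl_def m_assoc 1 swap_left[OF 1] swap_left[OF 2])
    then show ?thesis using mult.hyps l by blast
  qed
  then obtain k' where k': "k' < n" "k' \<noteq> l" "weyl i j \<otimes> X k l a = X k' l a \<otimes> weyl i j" by blast
  have "weyl i j \<otimes> (X k l a \<otimes> y) = (X k' l a \<otimes> q') \<otimes> weyl i j"
    using l k' mult.hyps q' cols_carrier[OF m] by (simp add: swap_left[OF k'(3)] m_assoc)
  then show ?case using cols_mult[OF cols_X[OF k'(1) _ k'(2)] q'(1)] mult.hyps by blast
qed

text \<open>The remaining generators, those in the last column, are conjugate to earlier ones by the
  Weyl element, except for one, which is a commutator of the others.\<close>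

lemma cols_weyl_generate:
  assumes "n \<ge> 3" and M: "M \<subseteq> carrier G" "\<And>x y. x \<in> M \<Longrightarrow> y \<in> M \<Longrightarrow> x \<otimes> y \<in> M"
    "cols (n - 1) \<subseteq> M" "weyl (n - 2) (n - 1) \<in> M"
  shows "M = carrier G"
proof -
  let ?w = "weyl (n - 2) (n - 1)"
  have lt: "n - 2 < n" "n - 1 < n" "n - 2 \<noteq> n - 1" "n - 1 \<noteq> n - 2" "0 < n" using assms(1) by auto
  have 1: "X k l a \<in> M" if "k < n" "l < n - 1" "k \<noteq> l" for k l a
    using cols_X[OF that] M(3) by blast
  have 2: "X k (n - 1) a \<in> M" if k: "k < n - 2" for k a
  proof -
    have "?w \<otimes> X k (n - 2) a = X k (n - 1) a \<otimes> ?w"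
      by (rule weyl_col) (use k lt in auto)
    then have "?w \<otimes> (X k (n - 2) a \<otimes> ?w) = X k (n - 1) a"
      using k lt by (simp add: m_assoc[symmetric]) (simp add: m_assoc weyl_self)
    moreover have "X k (n - 2) a \<in> M" using k 1 lt by auto
    ultimately show ?thesis using M(2,4) by metis
  qed
  have 3: "X (n - 2) (n - 1) a \<in> M" for a
  proof -
    \<comment> \<open>The bound on \<open>n\<close> keeps 0 distinct from both \<open>n - 2\<close>
      and \<open>n - 1\<close>. Since \<open>M\<close> is known to be closed only under products,
      the commutator is written as the square of \<open>?b\<close> times \<open>?c\<close>, using
      that both factors are involutions.\<close>
    let ?b = "X (n - 2) 0 a" and ?c = "X 0 (n - 1) 1"
    have c: "?b \<in> carrier G" "?c \<in> carrier G" using assms(1) by auto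
    have "?b \<otimes> ?c = X (n - 2) (n - 1) a \<otimes> (?c \<otimes> ?b)"
      using X_comm[of "n - 2" 0 "n - 1" a 1] assms(1) by simp
    then have "(?b \<otimes> ?c) \<otimes> (?b \<otimes> ?c) = (X (n - 2) (n - 1) a \<otimes> (?c \<otimes> ?b)) \<otimes> (?b \<otimes> ?c)"
      by (rule arg_cong)
    also have "\<dots> = X (n - 2) (n - 1) a"
      using c lt assms(1) by (simp add: m_assoc X_self_left X_self)
    finally have "(?b \<otimes> ?c) \<otimes> (?b \<otimes> ?c) = X (n - 2) (n - 1) a" .
    moreover have "?b \<in> M" "?c \<in> M" using 1 2 assms(1) by auto
    ultimately show ?thesis using M(2) by metis
  qed
  have "x \<in> M" if "x \<in> cols n" for x
    using that order.refl
  proof (induction rule: cols_induct)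
    case one
    then show ?case using cols_one M(3) by blast
  next
    case (mult k l a y)
    then have "l < n - 1 \<or> l = n - 1 \<and> k < n - 2 \<or> l = n - 1 \<and> k = n - 2" by auto
    then have "X k l a \<in> M" using 1 2 3 mult.hyps by blast
    then show ?case using M(2) mult by blast
  qed
  then show ?thesis using M(1) cols_n by blast
qed

section \<open>The last row and the structure of the vertex stabiliser\<close>

fun row_elem :: "nat \<Rightarrow> (nat \<Rightarrow> 'r) \<Rightarrow> 'a" where
  "row_elem 0 r = \<one>"
| "row_elem (Suc m) r = X (n - 1) m (r m) \<otimes> row_elem m r"

lemma row_elem_closed: "m < n \<Longrightarrow> row_elem m r \<in> carrier G"
  by (induction m) auto

lemma row_elem_cong: "(\<And>k. k < m \<Longrightarrow> r k = r' k) \<Longrightarrow> row_elem m r = row_elem m r'"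
  by (induction m) auto

lemma row_elem_mult:
  "m < n \<Longrightarrow> k < m \<Longrightarrow> X (n - 1) k a \<otimes> row_elem m r = row_elem m (r(k := a + r k))"
proof (induction m)
  case (Suc m)
  show ?case
  proof (cases "k = m")
    case True
    have "row_elem m (r(m := a + r m)) = row_elem m r" by (rule row_elem_cong) simp
    then show ?thesis
      unfolding True row_elem.simps
      using Suc.prems row_elem_closed[of m r] by (simp add: m_assoc[symmetric] X_add)
  next
    case False
    have "X (n - 1) k a \<otimes> X (n - 1) m (r m) = X (n - 1) m (r m) \<otimes> X (n - 1) k a"
      by (rule X_commute) (use Suc.prems in auto)
    then show ?thesis
      using Suc False row_elem_closed[of m r] by (simp add: swap_left m_assoc)
  qed
qed simp

lemma row_elem_zero: "m < n \<Longrightarrow> row_elem m (\<lambda>_. 0) = \<one>"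
  by (induction m) (auto simp: X_zero)

text \<open>Conjugation by \<open>X k l a\<close> changes at most entry \<open>l\<close> of the row.
  The right side has all \<open>n - 1\<close> entries even for smaller \<open>m\<close>, because
  \<open>l\<close> may lie beyond \<open>m\<close>.\<close>

lemma X_row_elem:
  assumes "k < n - 1" "l < n - 1" "k \<noteq> l"
  shows "m < n \<Longrightarrow> \<exists>r'. X k l a \<otimes> row_elem m r = row_elem (n - 1) r' \<otimes> X k l a"
proof (induction m)
  case 0
  then show ?case using assms row_elem_zero[of "n - 1"] by (intro exI[of _ "\<lambda>_. 0"]) simp
next
  case (Suc m)
  note One_nat_def [simp del]
  obtain r' where r': "X k l a \<otimes> row_elem m r = row_elem (n - 1) r' \<otimes> X k l a" using Suc by auto
  have c: "row_elem m r \<in> carrier G" "row_elem (n - 1) r'' \<in> carrier G" for r''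
    using Suc.prems row_elem_closed by auto
  have X: "X k l a \<in> carrier G" "X (n - 1) m b \<in> carrier G" "X (n - 1) l b \<in> carrier G" for b
    using assms Suc.prems by auto
  have row: "X (n - 1) m b \<otimes> row_elem (n - 1) r'' = row_elem (n - 1) (r''(m := b + r'' m))"
    "X (n - 1) l b \<otimes> row_elem (n - 1) r'' = row_elem (n - 1) (r''(l := b + r'' l))" for b r''
    using row_elem_mult assms Suc.prems by auto
  show ?case
  proof (cases "m = k")
    case True
    have 1: "X k l a \<otimes> X (n - 1) m (r m) =
        X (n - 1) l (r m * a) \<otimes> (X (n - 1) m (r m) \<otimes> X k l a)"
      unfolding True by (rule X_comm') (use assms in auto)
    have "X k l a \<otimes> row_elem (Suc m) r = X (n - 1) l (r m * a) \<otimes>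
        (X (n - 1) m (r m) \<otimes> row_elem (n - 1) r') \<otimes> X k l a"
      using c X r' by (simp add: swap_left[OF 1] m_assoc)
    then show ?thesis unfolding row by blast
  next
    case False
    have 1: "X k l a \<otimes> X (n - 1) m (r m) = X (n - 1) m (r m) \<otimes> X k l a"
      by (rule X_commute) (use assms Suc.prems False in auto)
    have "X k l a \<otimes> row_elem (Suc m) r = (X (n - 1) m (r m) \<otimes> row_elem (n - 1) r') \<otimes> X k l a"
      using c X r' by (simp add: swap_left[OF 1] m_assoc)
    then show ?thesis unfolding row by blast
  qed
qed

text \<open>A new generator on the left is absorbed by the row part if its row index is
  \<open>n - 1\<close>, and otherwise moved past it at the cost of a new row. What accumulates on
  the right has both indices below \<open>n - 1\<close>, hence comes from the smaller Steinberg
  group.\<close>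

lemma cols_decompose:
  assumes "g \<in> cols (n - 1)" "n \<ge> 1"
  shows "\<exists>r. \<exists>h\<in>generate G {X k l a | k l a. k < n - 1 \<and> l < n - 1 \<and> k \<noteq> l}. g = row_elem (n - 1) r \<otimes> h"
  using assms(1) diff_le_self
proof (induction rule: cols_induct)
  case one
  have "\<one> = row_elem (n - 1) (\<lambda>_. 0) \<otimes> \<one>" using assms(2) by (simp add: row_elem_zero)
  then show ?case using generate.one by blast
next
  case (mult k l a y)
  let ?J = "{X k l a | k l a. k < n - 1 \<and> l < n - 1 \<and> k \<noteq> l}"
  have J: "?J \<subseteq> carrier G" by auto
  obtain r h where y: "h \<in> generate G ?J" "y = row_elem (n - 1) r \<otimes> h" using mult by blast
  have h: "h \<in> carrier G" using generate_in_carrier[OF J y(1)] .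
  have c: "row_elem (n - 1) r \<in> carrier G" for r by (rule row_elem_closed) (use assms in auto)
  have Xc: "X k l a \<in> carrier G" using mult.hyps by auto
  show ?case
  proof (cases "k = n - 1")
    case True
    then have "X k l a \<otimes> y = row_elem (n - 1) (r(l := a + r l)) \<otimes> h"
      unfolding y(2) using row_elem_mult[of "n - 1" l a r] mult.hyps c h Xc assms
      by (simp add: m_assoc[symmetric])
    then show ?thesis using y(1) by blast
  next
    case False
    then have k: "k < n - 1" using mult.hyps by simp
    obtain r' where r': "X k l a \<otimes> row_elem (n - 1) r = row_elem (n - 1) r' \<otimes> X k l a"
      using X_row_elem[OF k, of l "n - 1" a r] mult.hyps assms by auto
    have "X k l a \<otimes> y = row_elem (n - 1) r' \<otimes> (X k l a \<otimes> h)"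
      unfolding y(2) using r' c h Xc by (simp add: m_assoc[symmetric])
    moreover have "X k l a \<otimes> h \<in> generate G ?J"
      by (rule generate.eng[OF generate.incl y(1)]) (use k mult.hyps in blast)
    ultimately show ?thesis by blast
  qed
qed

end

section \<open>Matrices fixing the last basis vectors\<close>

lemma one_GL: "\<one>\<^bsub>GL TYPE('b::ring_1) n\<^esub> = (1\<^sub>m n :: 'b mat)"
  by (simp add: GL_def units_of_def ring_mat_def)

lemma carrier_GL: "A \<in> carrier (GL TYPE('b::ring_1) n) \<longleftrightarrow>
    A \<in> carrier_mat n n \<and> (\<exists>B\<in>carrier_mat n n. B * A = 1\<^sub>m n \<and> A * B = 1\<^sub>m n)"
  by (auto simp: GL_def units_of_def Units_def ring_mat_def)

lemma GL_carrier_mat: "A \<in> carrier (GL TYPE('b::ring_1) n) \<Longrightarrow> A \<in> carrier_mat n n"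
  by (simp add: carrier_GL)

lemma inv_GL:
  fixes A :: "'b::ring_1 mat"
  assumes "A \<in> carrier (GL TYPE('b) n)"
  shows "inv\<^bsub>GL TYPE('b) n\<^esub> A * A = 1\<^sub>m n" "A * inv\<^bsub>GL TYPE('b) n\<^esub> A = 1\<^sub>m n"
  using group.l_inv[OF group_GL assms] group.r_inv[OF group_GL assms] by (simp_all add: mult_GL one_GL)

lemma mat_unit_mult_index:
  assumes "A \<in> carrier_mat n n" "k < n" "r < n" "c < n"
  shows "(mat_unit n i k a * A) $$ (r, c) = (if r = i then a * A $$ (k, c) else (0 :: 'b::ring_1))"
proof -
  have "(mat_unit n i k a * A) $$ (r, c) =
      (\<Sum>s = 0..<n. (if r = i \<and> s = k then a else 0) * A $$ (s, c))"
    using assms by (simp add: mat_unit_def scalar_prod_def)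
  also have "\<dots> = (\<Sum>s = 0..<n. if s = k then (if r = i then a * A $$ (k, c) else 0) else 0)"
    by (intro sum.cong) auto
  finally show ?thesis using assms by simp
qed

lemma mult_mat_unit_index:
  assumes "A \<in> carrier_mat n n" "i < n" "r < n" "c < n"
  shows "(A * mat_unit n i k a) $$ (r, c) = (if c = k then A $$ (r, i) * a else (0 :: 'b::ring_1))"
proof -
  have "(A * mat_unit n i k a) $$ (r, c) =
      (\<Sum>s = 0..<n. A $$ (r, s) * (if s = i \<and> c = k then a else 0))"
    using assms by (simp add: mat_unit_def scalar_prod_def)
  also have "\<dots> = (\<Sum>s = 0..<n. if s = i then (if c = k then A $$ (r, i) * a else 0) else 0)"
    by (intro sum.cong) auto
  finally show ?thesis using assms by simp
qed

lemma transv_mult_index: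
  assumes "A \<in> carrier_mat n n" "k < n" "r < n" "c < n"
  shows "(transv n i k a * A) $$ (r, c) = A $$ (r, c) + (if r = i then a * A $$ (k, c) else (0 :: 'b::ring_1))"
proof -
  have "transv n i k a * A = A + mat_unit n i k a * A"
    using assms(1) unfolding transv_def by (simp add: add_mult_distrib_mat[of _ n n _ _ n])
  then show ?thesis using mat_unit_mult_index[OF assms, of i a] assms
    by (simp add: mat_unit_def)
qed

lemma mult_transv_index:
  assumes "A \<in> carrier_mat n n" "i < n" "r < n" "c < n"
  shows "(A * transv n i k a) $$ (r, c) = A $$ (r, c) + (if c = k then A $$ (r, i) * a else (0 :: 'b::ring_1))"
proof -
  have "A * transv n i k a = A + A * mat_unit n i k a"
    using assms(1) unfolding transv_def by (simp add: mult_add_distrib_mat[of _ n n _ n])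
  then show ?thesis using mult_mat_unit_index[OF assms, of k a] assms
    by (simp add: mat_unit_def)
qed

lemma col_mult_transv:
  assumes "A \<in> carrier_mat n n" "i < n" "c < n" "c \<noteq> k"
  shows "col (A * transv n i k a) c = col A (c :: nat)"
proof (rule eq_vecI)
  fix r assume "r < dim_vec (col A c)"
  then have "r < n" using assms by simp
  then show "col (A * transv n i k a) c $ r = col A c $ r"
    using mult_transv_index[OF assms(1,2) _ assms(3), of r k a] assms
    by (simp add: transv_def mat_unit_def del: index_mult_mat(1))
qed (use assms in simp)

section \<open>Block triangular matrices as products of transvections\<close>

definition lower :: "nat \<Rightarrow> nat \<Rightarrow> (nat \<Rightarrow> nat \<Rightarrow> 'b) \<Rightarrow> 'b::ring_1 mat" where
  "lower n m f = four_block_mat (1\<^sub>m m) (0\<^sub>m m (n - m)) (Matrix.mat (n - m) m (\<lambda>(i, k). f (i + m) k)) (1\<^sub>m (n - m))"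

definition extend_mat :: "nat \<Rightarrow> nat \<Rightarrow> 'b mat \<Rightarrow> 'b::ring_1 mat" where
  "extend_mat n m A = four_block_mat A (0\<^sub>m m (n - m)) (0\<^sub>m (n - m) m) (1\<^sub>m (n - m))"

lemma lower_carrier: "m \<le> n \<Longrightarrow> lower n m f \<in> carrier_mat n n"
  unfolding lower_def by (intro carrier_matI) auto

lemma lower_index: "m \<le> n \<Longrightarrow> r < n \<Longrightarrow> c < n \<Longrightarrow>
    lower n m f $$ (r, c) = (if r = c then 1 else if r \<ge> m \<and> c < m then f r c else 0)"
  by (auto simp: lower_def)

lemma transv_lower:
  assumes "m \<le> i" "i < n" "k < m"
  shows "transv n i k a * lower n m f = lower n m (\<lambda>r c. (if r = i \<and> c = k then a else 0) + f r c)"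
proof (rule eq_matI)
  fix r c assume "r < dim_row (lower n m (\<lambda>r c. (if r = i \<and> c = k then a else 0) + f r c))"
    "c < dim_col (lower n m (\<lambda>r c. (if r = i \<and> c = k then a else 0) + f r c))"
  then have rc: "r < n" "c < n" using assms by (auto simp: lower_def)
  have "(transv n i k a * lower n m f) $$ (r, c) =
      lower n m f $$ (r, c) + (if r = i then a * lower n m f $$ (k, c) else 0)"
    by (rule transv_mult_index) (use assms rc lower_carrier[of m n f] in auto)
  then show "(transv n i k a * lower n m f) $$ (r, c) =
      lower n m (\<lambda>r c. (if r = i \<and> c = k then a else 0) + f r c) $$ (r, c)"
    using assms rc by (auto simp: lower_index)
qed (use assms in \<open>auto simp: lower_def transv_def mat_unit_def\<close>)

lemma extend_mult:
  assumes "A \<in> carrier_mat m m" "B \<in> carrier_mat m m" "m \<le> n"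
  shows "extend_mat n m A * extend_mat n m B = extend_mat n m (A * B)"
  unfolding extend_mat_def using assms
  by (subst mult_four_block_mat[of _ m m _ "n - m" _ "n - m" _ _ m _ "n - m"]) auto

lemma extend_one: "m \<le> n \<Longrightarrow> extend_mat n m (1\<^sub>m m) = 1\<^sub>m n"
  unfolding extend_mat_def by (intro eq_matI) auto

lemma extend_transv: "i < m \<Longrightarrow> j < m \<Longrightarrow> m \<le> n \<Longrightarrow> extend_mat n m (transv m i j a) = transv n i j a"
  unfolding extend_mat_def by (intro eq_matI) (auto simp: transv_def mat_unit_def)

lemma lower_extend:
  assumes "A \<in> carrier_mat m m" "m \<le> n"
  shows "lower n m f * extend_mat n m A = four_block_mat A (0\<^sub>m m (n - m))
    (Matrix.mat (n - m) m (\<lambda>(i, k). f (i + m) k) * A) (1\<^sub>m (n - m))"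
  unfolding extend_mat_def lower_def using assms
  by (subst mult_four_block_mat[of _ m m _ "n - m" _ "n - m" _ _ m _ "n - m"]) auto

text \<open>The matrix counterpart of \<open>cols m\<close>; for \<open>m = n\<close> it is the
  elementary group.\<close>

definition transv_group :: "'b::ring_1 itself \<Rightarrow> nat \<Rightarrow> nat \<Rightarrow> 'b mat set" where
  "transv_group TB n m = generate (GL TB n) {transv n k l a | k l a. k < n \<and> l < m \<and> k \<noteq> l}"

lemma transv_group_transv:
  "k < n \<Longrightarrow> l < m \<Longrightarrow> k \<noteq> l \<Longrightarrow> transv n k l (a::'b::ring_1) \<in> transv_group TYPE('b) n m"
  unfolding transv_group_def by (rule generate.incl) blast

lemma transv_group_mult:
  "A \<in> transv_group TYPE('b::ring_1) n m \<Longrightarrow> B \<in> transv_group TYPE('b) n m \<Longrightarrow>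
    A * B \<in> transv_group TYPE('b) n m"
  unfolding transv_group_def mult_GL[of "TYPE('b)" n A B, symmetric] by (rule generate.eng)

lemma inv_transv:
  assumes "i < n" "j < n" "i \<noteq> j"
  shows "inv\<^bsub>GL TYPE('b::ring_1) n\<^esub> (transv n i j a) = transv n i j (- a)"
proof (rule group.inv_equality[OF group_GL])
  have "transv n i j (0::'b) = 1\<^sub>m n"
    by (intro eq_matI) (auto simp: transv_def mat_unit_def)
  then show "transv n i j (- a) \<otimes>\<^bsub>GL TYPE('b) n\<^esub> transv n i j a = \<one>\<^bsub>GL TYPE('b) n\<^esub>"
    using transv_add[of j n i "- a" a] assms by (simp add: mult_GL one_GL)
qed (use assms transv_in_GL in auto)

lemma transv_group_induct [consumes 2, case_names one mult]:
  fixes A :: "'b::ring_1 mat"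
  assumes "A \<in> transv_group TYPE('b) n m" "m \<le> n" "Q (1\<^sub>m n)"
    and "\<And>k l (a::'b) B. k < n \<Longrightarrow> l < m \<Longrightarrow> k \<noteq> l \<Longrightarrow> B \<in> transv_group TYPE('b) n m \<Longrightarrow> Q B \<Longrightarrow>
      Q (transv n k l a * B)"
  shows "Q A"
proof (rule group.generate_induct_left[OF group_GL _ _ assms(1)[unfolded transv_group_def]])
  show "{transv n k l (a::'b) | k l a. k < n \<and> l < m \<and> k \<noteq> l} \<subseteq> carrier (GL TYPE('b) n)"
    using assms(2) by (auto intro: transv_in_GL)
  show "inv\<^bsub>GL TYPE('b) n\<^esub> s \<in> {transv n k l (a::'b) | k l a. k < n \<and> l < m \<and> k \<noteq> l}"
    if "s \<in> {transv n k l (a::'b) | k l a. k < n \<and> l < m \<and> k \<noteq> l}" for s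
  proof -
    from that obtain k l a where s: "s = transv n k l a" "k < n" "l < m" "k \<noteq> l" by blast
    then have "inv\<^bsub>GL TYPE('b) n\<^esub> s = transv n k l (- a)" using inv_transv[of k n l a] assms(2) by simp
    then show ?thesis using s by blast
  qed
  show "Q \<one>\<^bsub>GL TYPE('b) n\<^esub>" using assms(3) by (simp add: one_GL)
  fix s B assume "s \<in> {transv n k l (a::'b) | k l a. k < n \<and> l < m \<and> k \<noteq> l}"
    "B \<in> generate (GL TYPE('b) n) {transv n k l a | k l a. k < n \<and> l < m \<and> k \<noteq> l}" "Q B"
  then show "Q (s \<otimes>\<^bsub>GL TYPE('b) n\<^esub> B)"
    using assms(4) unfolding transv_group_def mult_GL by blast
qed

lemma one_transv_group: "1\<^sub>m n \<in> transv_group TYPE('b::ring_1) n m"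
  unfolding transv_group_def using generate.one[of "GL TYPE('b) n"] by (simp add: one_GL)

lemma elem_group_transv: "elem_group TYPE('b::ring_1) m = transv_group TYPE('b) m m"
proof -
  have "{transv m i j (a::'b) | i j a. i < m \<and> j < m \<and> i \<noteq> j} = {transv m k l a | k l a. k < m \<and> l < m \<and> k \<noteq> l}"
    by blast
  then show ?thesis by (simp add: elem_group_def transv_group_def)
qed

lemma transv_group_GL: "m \<le> n \<Longrightarrow> A \<in> transv_group TYPE('b::ring_1) n m \<Longrightarrow> A \<in> carrier (GL TYPE('b) n)"
  unfolding transv_group_def
  by (rule group.generate_in_carrier[OF group_GL]) (auto intro: transv_in_GL)

lemma extend_transv_group:
  assumes "A \<in> transv_group TYPE('b::ring_1) m m" "m \<le> n"
  shows "extend_mat n m A \<in> transv_group TYPE('b) n m"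
  using assms(1) order.refl
proof (induction rule: transv_group_induct)
  case one
  then show ?case using assms(2) by (simp add: extend_one one_transv_group)
next
  case (mult k l a B)
  have "B \<in> carrier_mat m m" using mult.hyps(4) transv_group_GL GL_carrier_mat by blast
  then have "extend_mat n m (transv m k l a * B) = transv n k l a * extend_mat n m B"
    using extend_mult[of "transv m k l a" m B n] extend_transv[of k m l n a] assms(2) mult.hyps by simp
  then show ?case
    using mult transv_group_mult transv_group_transv[of k n l m a] assms(2) by auto
qed

text \<open>The lower left block is filled one position at a time, each by one transvection on the
  left; \<open>I\<close> is the set of positions already filled.\<close>

lemma lower_transv_group:
  assumes "m \<le> n"
  shows "lower n m f \<in> transv_group TYPE('b::ring_1) n m"
proof -
  have "lower n m (\<lambda>r c. if (r, c) \<in> I then f r c else 0) \<in> transv_group TYPE('b) n m"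
    if "finite I" "I \<subseteq> {m..<n} \<times> {..<m}" for I
    using that
  proof (induction I)
    case empty
    have "lower n m (\<lambda>r c. 0) = (1\<^sub>m n :: 'b mat)"
      using assms by (intro eq_matI) (auto simp: lower_index lower_def)
    then show ?case by (simp add: one_transv_group)
  next
    case (insert x I)
    obtain i k where x: "x = (i, k)" "m \<le> i" "i < n" "k < m" using insert.prems by auto
    have "lower n m (\<lambda>r c. if (r, c) \<in> insert x I then f r c else 0) =
        transv n i k (f i k) * lower n m (\<lambda>r c. if (r, c) \<in> I then f r c else 0)"
      unfolding transv_lower[OF x(2-4)]
      by (intro arg_cong[of _ _ "lower n m"] ext) (use insert.hyps in \<open>auto simp: x\<close>)
    then show ?case
      using insert transv_group_mult transv_group_transv[of i n k m "f i k"] x by auto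
  qed
  from this[of "{m..<n} \<times> {..<m}"]
  have "lower n m (\<lambda>r c. if (r, c) \<in> {m..<n} \<times> {..<m} then f r c else 0) \<in> transv_group TYPE('b) n m"
    by simp
  moreover have "lower n m (\<lambda>r c. if (r, c) \<in> {m..<n} \<times> {..<m} then f r c else 0) = lower n m f"
    using assms by (intro eq_matI) (auto simp: lower_index lower_def)
  ultimately show ?thesis by simp
qed

lemma fixed_cols_block:
  assumes "M \<in> carrier_mat n n" "m \<le> n" "\<And>c. m \<le> c \<Longrightarrow> c < n \<Longrightarrow> col M c = col (1\<^sub>m n) c"
  shows "M = four_block_mat (Matrix.mat m m (\<lambda>x. M $$ x)) (0\<^sub>m m (n - m))
    (Matrix.mat (n - m) m (\<lambda>(i, k). M $$ (i + m, k))) (1\<^sub>m (n - m))"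
proof -
  have "M $$ (r, c) = (if r = c then 1 else 0)" if "m \<le> c" "c < n" "r < n" for r c
    using arg_cong[OF assms(3)[OF that(1,2)], of "\<lambda>v. v $ r"] that assms(1) by simp
  then show ?thesis using assms(1,2) by (intro eq_matI) auto
qed

lemma four_block_eqD:
  assumes "four_block_mat A B C D = four_block_mat A' B' C' D'"
    and "A \<in> carrier_mat m m" "A' \<in> carrier_mat m m" "C \<in> carrier_mat k m" "C' \<in> carrier_mat k m"
      "D \<in> carrier_mat k k" "D' \<in> carrier_mat k k"
  shows "A = A'" "C = C'"
proof -
  have e: "four_block_mat A B C D $$ (r, c) = four_block_mat A' B' C' D' $$ (r, c)" for r c
    using assms(1) by simp
  show "A = A'"
  proof (rule eq_matI)
    fix r c assume "r < dim_row A'" "c < dim_col A'"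
    then show "A $$ (r, c) = A' $$ (r, c)" using e[of r c] assms(2-) by simp
  qed (use assms(2-) in auto)
  show "C = C'"
  proof (rule eq_matI)
    fix r c assume "r < dim_row C'" "c < dim_col C'"
    then show "C $$ (r, c) = C' $$ (r, c)" using e[of "r + m" c] assms(2-) by simp
  qed (use assms(2-) in auto)
qed

text \<open>In block form \<open>M\<close> has first block column \<open>A\<close>, \<open>D\<close>
  and second block column 0, 1. The inverse of \<open>M\<close> fixes the same basis vectors, so its
  upper left block inverts \<open>A\<close>, and the elementary hypothesis in rank \<open>m\<close>
  applies to \<open>A\<close>. Then \<open>M\<close> is a unipotent matrix with lower block
  \<open>D\<close> times the inverse of \<open>A\<close>, followed by the extension of
  \<open>A\<close>.\<close>

lemma fixed_cols_transv_group:
  assumes M: "M \<in> carrier (GL TYPE('b::ring_1) n)" and m: "m \<le> n"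
    and fixed: "\<And>c. m \<le> c \<Longrightarrow> c < n \<Longrightarrow> col M c = col (1\<^sub>m n) c"
    and GE: "carrier (GL TYPE('b) m) = elem_group TYPE('b) m"
  shows "M \<in> transv_group TYPE('b) n m"
proof -
  obtain N where MN: "M \<in> carrier_mat n n" "N \<in> carrier_mat n n" "N * M = 1\<^sub>m n" "M * N = 1\<^sub>m n"
    using M by (auto simp: carrier_GL)
  have "col N c = col (1\<^sub>m n) c" if "m \<le> c" "c < n" for c
  proof -
    have "col N c = N *\<^sub>v col (1\<^sub>m n) c" using col_mult2[OF MN(2) one_carrier_mat that(2)] MN(2) by simp
    also have "\<dots> = col (N * M) c" using col_mult2[OF MN(2,1) that(2)] fixed[OF that] by simp
    finally show ?thesis using MN by simp
  qed
  note bM = fixed_cols_block[OF MN(1) m fixed] and bN = fixed_cols_block[OF MN(2) m this]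
  define A D where "A = Matrix.mat m m (\<lambda>x. M $$ x)" and "D = Matrix.mat (n - m) m (\<lambda>(i, k). M $$ (i + m, k))"
  define A' D' where "A' = Matrix.mat m m (\<lambda>x. N $$ x)" and "D' = Matrix.mat (n - m) m (\<lambda>(i, k). N $$ (i + m, k))"
  have c: "A \<in> carrier_mat m m" "A' \<in> carrier_mat m m" "D \<in> carrier_mat (n - m) m" "D' \<in> carrier_mat (n - m) m"
    by (simp_all add: A_def A'_def D_def D'_def)
  have M': "M = four_block_mat A (0\<^sub>m m (n - m)) D (1\<^sub>m (n - m))" using bM by (simp add: A_def D_def)
  have N': "N = four_block_mat A' (0\<^sub>m m (n - m)) D' (1\<^sub>m (n - m))" using bN by (simp add: A'_def D'_def)
  have one: "1\<^sub>m n = four_block_mat (1\<^sub>m m) (0\<^sub>m m (n - m)) (0\<^sub>m (n - m) m) (1\<^sub>m (n - m) :: 'b mat)"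
    using m by (intro eq_matI) auto
  have "M * N = four_block_mat (A * A') (0\<^sub>m m (n - m)) (D * A' + D') (1\<^sub>m (n - m))"
    unfolding M' N' using c by (subst mult_four_block_mat[of _ m m _ "n - m" _ "n - m" _ _ m _ "n - m"]) auto
  note eq = HOL.trans[OF HOL.trans[OF this[symmetric] MN(4)] one]
  have AA': "A * A' = 1\<^sub>m m"
    by (rule four_block_eqD(1)[OF eq, of m "n - m"]) (use c in auto)
  have "N * M = four_block_mat (A' * A) (0\<^sub>m m (n - m)) (D' * A + D) (1\<^sub>m (n - m))"
    unfolding M' N' using c by (subst mult_four_block_mat[of _ m m _ "n - m" _ "n - m" _ _ m _ "n - m"]) auto
  note eq = HOL.trans[OF HOL.trans[OF this[symmetric] MN(3)] one]
  have A'A: "A' * A = 1\<^sub>m m"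
    by (rule four_block_eqD(1)[OF eq, of m "n - m"]) (use c in auto)
  have "A \<in> carrier (GL TYPE('b) m)" using c AA' A'A by (auto simp: carrier_GL)
  then have A: "extend_mat n m A \<in> transv_group TYPE('b) n m"
    using GE extend_transv_group[OF _ m] by (simp add: elem_group_transv)
  \<comment> \<open>\<open>lower\<close> numbers the rows of its block as rows of the full matrix,
    hence the shift by \<open>m\<close>.\<close>
  define f where "f r c = (D * A') $$ (r - m, c)" for r c
  have "Matrix.mat (n - m) m (\<lambda>(i, k). f (i + m) k) = D * A'"
    using c by (intro eq_matI) (auto simp: f_def)
  moreover have "D * A' * A = D" using c A'A by (simp add: assoc_mult_mat[of _ "n - m" m _ m _ m])
  ultimately have "lower n m f * extend_mat n m A = M"
    using lower_extend[OF c(1) m, of f] by (simp add: M')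
  then show ?thesis using transv_group_mult[OF lower_transv_group[OF m] A] by metis
qed

section \<open>Frames and invertible matrices\<close>

text \<open>Right linearity places coordinates to the right of the images of the basis vectors, as
  the matrix product does. The induction runs over the truncations \<open>?t m\<close> of
  \<open>x\<close> to its first \<open>m\<close> coordinates.\<close>

lemma right_linear_matrix:
  fixes g :: "'b::ring_1 vec \<Rightarrow> 'b vec"
  assumes into: "\<And>u. u \<in> carrier_vec n \<Longrightarrow> g u \<in> carrier_vec n"
    and add: "\<And>u v. u \<in> carrier_vec n \<Longrightarrow> v \<in> carrier_vec n \<Longrightarrow> g (u + v) = g u + g v"
    and smult: "\<And>u b. u \<in> carrier_vec n \<Longrightarrow> g (rsmult u b) = rsmult (g u) b"
    and x: "x \<in> carrier_vec n"
  shows "g x = Matrix.mat n n (\<lambda>(i, j). g (unit_vec n j) $ i) *\<^sub>v x"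
proof -
  let ?t = "\<lambda>m. Matrix.vec n (\<lambda>i. if i < m then x $ i else 0)"
  have "g (?t m) = Matrix.vec n (\<lambda>i. \<Sum>j<m. g (unit_vec n j) $ i * x $ j)" if "m \<le> n" for m
    using that
  proof (induction m)
    case 0
    have "?t 0 = rsmult (0\<^sub>v n) 0" by (intro eq_vecI) (auto simp: rsmult_def)
    then have "g (?t 0) = rsmult (g (0\<^sub>v n)) 0" using smult[of "0\<^sub>v n" 0] by simp
    also have "\<dots> = 0\<^sub>v n" by (rule rsmult_zero[OF into]) simp
    finally show ?case by (intro eq_vecI) auto
  next
    case (Suc m)
    have "?t (Suc m) = ?t m + rsmult (unit_vec n m) (x $ m)"
      using Suc.prems by (intro eq_vecI) (auto simp: rsmult_def less_Suc_eq)
    moreover have "?t m \<in> carrier_vec n" by simp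
    ultimately have "g (?t (Suc m)) = g (?t m) + rsmult (g (unit_vec n m)) (x $ m)"
      by (simp add: add smult)
    moreover have "g (unit_vec n m) \<in> carrier_vec n" by (rule into) simp
    ultimately show ?case
      using Suc by (intro eq_vecI) (auto simp: rsmult_def)
  qed
  from this[OF order.refl] have "g (?t n) = Matrix.vec n (\<lambda>i. \<Sum>j<n. g (unit_vec n j) $ i * x $ j)" .
  moreover have "?t n = x" using x by (intro eq_vecI) auto
  ultimately show ?thesis
    using x by (intro eq_vecI) (auto simp: scalar_prod_def lessThan_atLeast0 intro!: sum.cong)
qed

lemma right_module_iso_GL:
  fixes g :: "'b::ring_1 vec \<Rightarrow> 'b vec"
  assumes "right_module_iso (carrier_vec n) (carrier_vec n) g"
  shows "\<exists>M\<in>carrier (GL TYPE('b) n). \<forall>j<n. col M j = g (unit_vec n j)"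
proof -
  have bij: "bij_betw g (carrier_vec n) (carrier_vec n)"
    and add: "\<And>u v. u \<in> carrier_vec n \<Longrightarrow> v \<in> carrier_vec n \<Longrightarrow> g (u + v) = g u + g v"
    and smult: "\<And>u b. u \<in> carrier_vec n \<Longrightarrow> g (rsmult u b) = rsmult (g u) b"
    using assms by (auto simp: right_module_iso_def)
  have into: "g u \<in> carrier_vec n" if "u \<in> carrier_vec n" for u
    using bij_betw_apply[OF bij that] .
  define h where "h = inv_into (carrier_vec n) g"
  have hin: "h u \<in> carrier_vec n" if "u \<in> carrier_vec n" for u
    using that bij bij_betw_imp_surj_on[OF bij] by (simp add: h_def inv_into_into)
  have gh: "g (h u) = u" if "u \<in> carrier_vec n" for u
    using that bij_betw_inv_into_right[OF bij] by (simp add: h_def)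
  have hg: "h (g u) = u" if "u \<in> carrier_vec n" for u
    using that bij_betw_inv_into_left[OF bij] by (simp add: h_def)
  have hadd: "h (u + v) = h u + h v" if "u \<in> carrier_vec n" "v \<in> carrier_vec n" for u v
    using that hg[of "h u + h v"] by (simp add: add gh hin)
  have hsmult: "h (rsmult u b) = rsmult (h u) b" if "u \<in> carrier_vec n" for u b
    using that hg[of "rsmult (h u) b"] by (simp add: smult gh hin)
  define M N where "M = Matrix.mat n n (\<lambda>(i, j). g (unit_vec n j) $ i)"
    and "N = Matrix.mat n n (\<lambda>(i, j). h (unit_vec n j) $ i)"
  have MN: "M \<in> carrier_mat n n" "N \<in> carrier_mat n n" by (simp_all add: M_def N_def)
  have M: "g x = M *\<^sub>v x" if "x \<in> carrier_vec n" for x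
    unfolding M_def by (rule right_linear_matrix[OF into add smult that])
  have N: "h x = N *\<^sub>v x" if "x \<in> carrier_vec n" for x
    unfolding N_def by (rule right_linear_matrix[OF hin hadd hsmult that])
  have colM: "col M j = g (unit_vec n j)" if "j < n" for j
    using that into[of "unit_vec n j"] by (intro eq_vecI) (auto simp: M_def)
  have colN: "col N j = h (unit_vec n j)" if "j < n" for j
    using that hin[of "unit_vec n j"] by (intro eq_vecI) (auto simp: N_def)
  have "M * N = 1\<^sub>m n"
  proof (rule mat_col_eqI)
    fix j assume "j < dim_col (1\<^sub>m n :: 'b mat)"
    then have j: "j < n" by simp
    have "col (M * N) j = M *\<^sub>v h (unit_vec n j)" using col_mult2[OF MN j] colN[OF j] by simp
    then show "col (M * N) j = col (1\<^sub>m n) j" using j M[symmetric, of "h (unit_vec n j)"] hin gh by simp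
  qed (use MN in auto)
  moreover have "N * M = 1\<^sub>m n"
  proof (rule mat_col_eqI)
    fix j assume "j < dim_col (1\<^sub>m n :: 'b mat)"
    then have j: "j < n" by simp
    have "col (N * M) j = N *\<^sub>v g (unit_vec n j)" using col_mult2[OF MN(2,1) j] colM[OF j] by simp
    then show "col (N * M) j = col (1\<^sub>m n) j" using j N[symmetric, of "g (unit_vec n j)"] into hg by simp
  qed (use MN in auto)
  ultimately have "M \<in> carrier (GL TYPE('b) n)" using MN by (auto simp: carrier_GL)
  then show ?thesis using colM by blast
qed

lemma right_module_iso_zero:
  "right_module_iso (carrier_vec m) C f \<Longrightarrow> C \<subseteq> carrier_vec n \<Longrightarrow> f (0\<^sub>v m) = 0\<^sub>v n"
proof -
  assume f: "right_module_iso (carrier_vec m) C f" and C: "C \<subseteq> carrier_vec n"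
  have "rsmult (0\<^sub>v m) 0 = (0\<^sub>v m :: 'a vec)" by (rule rsmult_zero) simp
  moreover have "f (rsmult (0\<^sub>v m) 0) = rsmult (f (0\<^sub>v m)) 0"
    using f unfolding right_module_iso_def by (metis zero_carrier_vec)
  moreover have "f (0\<^sub>v m) \<in> carrier_vec n"
    using f C bij_betw_apply[of f "carrier_vec m" C "0\<^sub>v m"] unfolding right_module_iso_def by auto
  ultimately show "f (0\<^sub>v m) = 0\<^sub>v n" using rsmult_zero by metis
qed

text \<open>Frame vectors are absorbed into the complement one after another, each at coordinate 0,
  which pushes the earlier ones up. They therefore end in reverse order, ahead of the basis of
  \<open>C\<close>.\<close>

lemma frame_iso:
  assumes "internal_direct_sum n (map (\<lambda>v. range (rsmult v)) vs @ [C])"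
    and "\<forall>v\<in>set vs. v \<in> carrier_vec n \<and> inj (rsmult v)"
    and "right_module_iso (carrier_vec m) C f"
  shows "\<exists>g. right_module_iso (carrier_vec (m + length vs)) (carrier_vec n) g \<and>
    (\<forall>j<m. g (unit_vec (m + length vs) (length vs + j)) = f (unit_vec m j)) \<and>
    (\<forall>i<length vs. g (unit_vec (m + length vs) (length vs - 1 - i)) = vs ! i)"
  using assms
proof (induction vs arbitrary: C m f)
  case Nil
  have "C \<subseteq> carrier_vec n" using Nil(1) by (auto simp: internal_direct_sum_def right_submodule_def)
  moreover have "carrier_vec n \<subseteq> C"
  proof
    fix w :: "'a vec" assume "w \<in> carrier_vec n"
    then obtain xs where xs: "list_all2 (\<in>) xs [C]" "w = vec_sum n xs"
      using Nil(1) unfolding internal_direct_sum_def by force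
    then obtain x where "xs = [x]" "x \<in> C" by (auto simp: list_all2_Cons2)
    then show "w \<in> C" using xs \<open>C \<subseteq> carrier_vec n\<close> by auto
  qed
  ultimately show ?case using Nil(3) by auto
next
  case (Cons v vs)
  let ?F = "\<lambda>u. rsmult v (u $ 0) + f (Matrix.vec m (\<lambda>j. u $ Suc j))"
  have v: "v \<in> carrier_vec n" "inj (rsmult v)" using Cons.prems by auto
  have ds: "internal_direct_sum n ([] @ [range (rsmult v)] @ map (\<lambda>v. range (rsmult v)) vs @ [C])"
    using Cons.prems(1) by simp
  have C: "C \<subseteq> carrier_vec n" using ds by (auto simp: internal_direct_sum_def right_submodule_def)
  have "right_module_iso (carrier_vec (Suc m)) (set_sum (range (rsmult v)) C) ?F"
    by (rule right_module_iso_merge[OF ds v Cons.prems(3)])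
  moreover have "internal_direct_sum n (map (\<lambda>v. range (rsmult v)) vs @ [set_sum (range (rsmult v)) C])"
    using internal_direct_sum_merge[OF ds] by simp
  ultimately obtain g where g: "right_module_iso (carrier_vec (Suc m + length vs)) (carrier_vec n) g"
    "\<And>j. j < Suc m \<Longrightarrow> g (unit_vec (Suc m + length vs) (length vs + j)) = ?F (unit_vec (Suc m) j)"
    "\<And>i. i < length vs \<Longrightarrow> g (unit_vec (Suc m + length vs) (length vs - 1 - i)) = vs ! i"
    using Cons.IH Cons.prems(2) by force
  have f_car: "f u \<in> carrier_vec n" if "u \<in> carrier_vec m" for u
    using Cons.prems(3) C that bij_betw_apply[of f "carrier_vec m" C u] unfolding right_module_iso_def by auto
  have "Matrix.vec m (\<lambda>j. unit_vec (Suc m) 0 $ Suc j) = (0\<^sub>v m :: 'a vec)" by (intro eq_vecI) auto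
  then have "?F (unit_vec (Suc m) 0) = rsmult v 1 + 0\<^sub>v n"
    using right_module_iso_zero[OF Cons.prems(3) C] by simp
  also have "\<dots> = v" using v(1) by (intro eq_vecI) (auto simp: rsmult_def)
  finally have F0: "?F (unit_vec (Suc m) 0) = v" .
  have FS: "?F (unit_vec (Suc m) (Suc j)) = f (unit_vec m j)" if "j < m" for j
  proof -
    have "Matrix.vec m (\<lambda>i. unit_vec (Suc m) (Suc j) $ Suc i) = (unit_vec m j :: 'a vec)"
      using that by (intro eq_vecI) auto
    then show ?thesis using rsmult_zero[OF v(1)] f_car[of "unit_vec m j"] that by simp
  qed
  have e: "Suc m + length vs = m + length (v # vs)" by simp
  show ?case
  proof (intro exI[of _ g] conjI allI impI)
    show "right_module_iso (carrier_vec (m + length (v # vs))) (carrier_vec n) g"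
      using g(1) unfolding e .
    show "g (unit_vec (m + length (v # vs)) (length (v # vs) + j)) = f (unit_vec m j)" if "j < m" for j
      using g(2)[of "Suc j"] FS[OF that] that by simp
    show "g (unit_vec (m + length (v # vs)) (length (v # vs) - 1 - i)) = (v # vs) ! i"
      if "i < length (v # vs)" for i
      using that g(2)[of 0] F0 g(3)[of "i - 1"] by (cases i) (auto)
  qed
qed

lemma partial_frame_GL:
  fixes vs :: "'b::ring_1 vec list"
  assumes "partial_frame n vs" "length vs \<le> n"
  shows "\<exists>M\<in>carrier (GL TYPE('b) n). \<forall>i<length vs. col M (length vs - 1 - i) = vs ! i"
proof -
  obtain C f where "internal_direct_sum n (map (\<lambda>v. range (rsmult v)) vs @ [C])"
    "right_module_iso (carrier_vec (n - length vs)) C f"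
    using assms(1) unfolding partial_frame_def by blast
  moreover have "\<forall>v\<in>set vs. v \<in> carrier_vec n \<and> inj (rsmult v)"
    using assms(1) by (auto simp: partial_frame_def bij_betw_def)
  ultimately obtain g where g: "right_module_iso (carrier_vec n) (carrier_vec n) g"
    "\<forall>i<length vs. g (unit_vec n (length vs - 1 - i)) = vs ! i"
    using frame_iso[of n vs C "n - length vs" f] assms(2) by auto
  obtain M where "M \<in> carrier (GL TYPE('b) n)" "\<forall>j<n. col M j = g (unit_vec n j)"
    using right_module_iso_GL[OF g(1)] by blast
  then show ?thesis using g(2) assms(2) by (intro bexI[of _ M]) auto
qed

section \<open>Prescribing the columns of an invertible matrix\<close>

lemma permute_cols:
  fixes M :: "'b::ring_1 mat"
  assumes M: "M \<in> carrier (GL TYPE('b) n)" and s: "bij_betw s {..<n} {..<n}"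
  shows "\<exists>M'\<in>carrier (GL TYPE('b) n). \<forall>c<n. col M' c = col M (s c)"
proof -
  obtain N where MN: "M \<in> carrier_mat n n" "N \<in> carrier_mat n n" "N * M = 1\<^sub>m n" "M * N = 1\<^sub>m n"
    using M by (auto simp: carrier_GL)
  have sn: "s i < n" if "i < n" for i using bij_betw_apply[OF s] that by blast
  define M' N' where "M' = Matrix.mat n n (\<lambda>(i, j). M $$ (i, s j))" and "N' = Matrix.mat n n (\<lambda>(i, j). N $$ (s i, j))"
  have "N' * M' = 1\<^sub>m n"
  proof (rule eq_matI)
    fix i j assume "i < dim_row (1\<^sub>m n :: 'b mat)" "j < dim_col (1\<^sub>m n :: 'b mat)"
    then have ij: "i < n" "j < n" by auto
    then have "(N' * M') $$ (i, j) = (N * M) $$ (s i, s j)"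
      using MN(1,2) sn by (simp add: M'_def N'_def scalar_prod_def)
    also have "\<dots> = (if i = j then 1 else 0)"
      unfolding MN(3) using sn ij bij_betw_imp_inj_on[OF s] by (auto dest: inj_onD)
    finally show "(N' * M') $$ (i, j) = 1\<^sub>m n $$ (i, j)" using ij by simp
  qed (auto simp: M'_def N'_def)
  moreover have "M' * N' = 1\<^sub>m n"
  proof (rule eq_matI)
    fix i j assume "i < dim_row (1\<^sub>m n :: 'b mat)" "j < dim_col (1\<^sub>m n :: 'b mat)"
    then have ij: "i < n" "j < n" by auto
    then have "(M' * N') $$ (i, j) = (\<Sum>k<n. M $$ (i, s k) * N $$ (s k, j))"
      using sn by (simp add: M'_def N'_def scalar_prod_def lessThan_atLeast0)
    also have "\<dots> = (\<Sum>k<n. M $$ (i, k) * N $$ (k, j))"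
      by (rule sum.reindex_bij_betw[OF s])
    also have "\<dots> = (M * N) $$ (i, j)"
      using MN(1,2) ij by (simp add: scalar_prod_def lessThan_atLeast0)
    finally show "(M' * N') $$ (i, j) = 1\<^sub>m n $$ (i, j)" using MN(4) by simp
  qed (auto simp: M'_def N'_def)
  moreover have "M' \<in> carrier_mat n n" "N' \<in> carrier_mat n n" by (auto simp: M'_def N'_def)
  ultimately have "M' \<in> carrier (GL TYPE('b) n)" by (auto simp: carrier_GL)
  moreover have "col M' c = col M (s c)" if "c < n" for c
    using that MN(1) sn by (intro eq_vecI) (auto simp: M'_def)
  ultimately show ?thesis by blast
qed

lemma extend_to_permutation:
  assumes "finite S" "A \<subseteq> S" "inj_on f A" "f ` A \<subseteq> S"
  shows "\<exists>s. bij_betw s S S \<and> (\<forall>a\<in>A. s a = f a)"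
proof -
  have "card (f ` A) = card A" using card_image[OF assms(3)] .
  then have "card (S - A) = card (S - f ` A)"
    using assms by (simp add: card_Diff_subset finite_subset)
  then obtain h where h: "bij_betw h (S - A) (S - f ` A)"
    using finite_same_card_bij[of "S - A" "S - f ` A"] assms(1) by auto
  define s where "s x = (if x \<in> A then f x else h x)" for x
  have "bij_betw s A (f ` A)"
    using bij_betw_cong[of A s f] inj_on_imp_bij_betw[OF assms(3)] by (simp add: s_def)
  moreover have "bij_betw s (S - A) (S - f ` A)"
    using bij_betw_cong[of "S - A" s h] h by (simp add: s_def)
  ultimately have "bij_betw s (A \<union> (S - A)) (f ` A \<union> (S - f ` A))"
    by (rule bij_betw_combine) auto
  moreover have "A \<union> (S - A) = S" "f ` A \<union> (S - f ` A) = S" using assms by auto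
  ultimately show ?thesis by (auto simp: s_def)
qed

text \<open>Chosen vertices of a simplex are made to occupy chosen columns. The matrix of the frame
  has vector number \<open>i\<close> in column \<open>p - i\<close>; a permutation extending the
  partial assignment moves it where it is wanted.\<close>

lemma frame_columns:
  fixes vs :: "'b::ring_1 vec list"
  assumes vs: "vs \<in> frame_simplices TYPE('b) n p" and A: "A \<subseteq> {..<n}" "inj_on f A" "\<And>a. a \<in> A \<Longrightarrow> f a \<le> p"
  shows "\<exists>M\<in>carrier (GL TYPE('b) n). \<forall>a\<in>A. col M a = vs ! f a"
proof -
  have l: "length vs = Suc p" "length vs \<le> n" "partial_frame n vs"
    using vs by (auto simp: frame_simplices_def)
  obtain M where M: "M \<in> carrier (GL TYPE('b) n)" "\<And>i. i \<le> p \<Longrightarrow> col M (p - i) = vs ! i"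
    using partial_frame_GL[OF l(3,2)] l(1) by auto
  have "inj_on (\<lambda>a. p - f a) A"
    using A(2,3) by (auto simp: inj_on_def) (metis diff_diff_cancel)
  moreover have "(\<lambda>a. p - f a) ` A \<subseteq> {..<n}" using l by auto
  ultimately obtain s where s: "bij_betw s {..<n} {..<n}" "\<And>a. a \<in> A \<Longrightarrow> s a = p - f a"
    using extend_to_permutation[of "{..<n}" A "\<lambda>a. p - f a"] A(1) by auto
  obtain M' where "M' \<in> carrier (GL TYPE('b) n)" "\<And>c. c < n \<Longrightarrow> col M' c = col M (s c)"
    using permute_cols[OF M(1) s(1)] by blast
  then show ?thesis using s(2) M(2) A by (intro bexI[of _ M']) auto
qed

section \<open>Columns of invertible matrices as simplices\<close>

lemma vec_sum_index:
  "set xs \<subseteq> carrier_vec n \<Longrightarrow> r < n \<Longrightarrow> vec_sum n xs $ r = (\<Sum>x\<leftarrow>xs. x $ r)"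
proof (induction xs)
  case (Cons x xs)
  then have "vec_sum n xs \<in> carrier_vec n" by (intro vec_sum_carrier) auto
  then show ?case using Cons by auto
qed simp

lemma vec_sum_columns:
  fixes M :: "'b::ring_1 mat"
  assumes "M \<in> carrier_mat n n"
  shows "vec_sum n (map (\<lambda>j. rsmult (col M j) (b j)) [0..<n] @ [0\<^sub>v n]) = M *\<^sub>v Matrix.vec n b"
proof (rule eq_vecI)
  have c: "set (map (\<lambda>j. rsmult (col M j) (b j)) [0..<n] @ [0\<^sub>v n]) \<subseteq> carrier_vec n"
    using assms by auto
  from vec_sum_carrier[OF c]
  show "dim_vec (vec_sum n (map (\<lambda>j. rsmult (col M j) (b j)) [0..<n] @ [0\<^sub>v n])) = dim_vec (M *\<^sub>v Matrix.vec n b)"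
    using assms by auto
  fix r assume "r < dim_vec (M *\<^sub>v Matrix.vec n b)"
  then have r: "r < n" using assms by simp
  have "vec_sum n (map (\<lambda>j. rsmult (col M j) (b j)) [0..<n] @ [0\<^sub>v n]) $ r =
      (\<Sum>j\<leftarrow>[0..<n]. rsmult (col M j) (b j) $ r)"
    unfolding vec_sum_index[OF c r] using r by (simp add: o_def)
  also have "\<dots> = (\<Sum>j\<in>set [0..<n]. rsmult (col M j) (b j) $ r)"
    by (rule interv_sum_list_conv_sum_set_nat)
  also have "\<dots> = (\<Sum>j = 0..<n. M $$ (r, j) * b j)"
    using assms r by (simp add: rsmult_def)
  also have "\<dots> = (M *\<^sub>v Matrix.vec n b) $ r" using assms r by (simp add: scalar_prod_def)
  finally show "vec_sum n (map (\<lambda>j. rsmult (col M j) (b j)) [0..<n] @ [0\<^sub>v n]) $ r = (M *\<^sub>v Matrix.vec n b) $ r" .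
qed

lemma right_submodule_range:
  assumes "v \<in> carrier_vec n"
  shows "right_submodule n (range (rsmult v))"
  unfolding right_submodule_def
proof (intro conjI ballI allI)
  show "0\<^sub>v n \<in> range (rsmult v)" using rangeI[of "rsmult v" 0] rsmult_zero[OF assms] by simp
  show "x + y \<in> range (rsmult v)" if "x \<in> range (rsmult v)" "y \<in> range (rsmult v)" for x y
    using that by (auto simp: rsmult_add[OF assms, symmetric])
  show "rsmult x b \<in> range (rsmult v)" if "x \<in> range (rsmult v)" for x b
    using that by (auto simp: rsmult_rsmult)
qed (use assms in auto)

text \<open>With all \<open>n\<close> columns listed the complement is the zero module, free of rank
  \<open>n - n\<close>. The coordinates of \<open>w\<close> are forced to be the entries of
  \<open>N *\<^sub>v w\<close>.\<close>

lemma GL_columns_frame: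
  fixes M :: "'b::ring_1 mat"
  assumes M: "M \<in> carrier (GL TYPE('b) n)"
  shows "partial_frame n (map (col M) [0..<n])"
proof -
  obtain N where MN: "M \<in> carrier_mat n n" "N \<in> carrier_mat n n" "N * M = 1\<^sub>m n" "M * N = 1\<^sub>m n"
    using M by (auto simp: carrier_GL)
  have NM: "N *\<^sub>v (M *\<^sub>v x) = x" if "x \<in> carrier_vec n" for x
    using that MN by (metis assoc_mult_mat_vec one_mult_mat_vec)
  have MN': "M *\<^sub>v (N *\<^sub>v x) = x" if "x \<in> carrier_vec n" for x
    using that MN by (metis assoc_mult_mat_vec one_mult_mat_vec)
  let ?Ms = "map (\<lambda>v. range (rsmult v)) (map (col M) [0..<n]) @ [{0\<^sub>v n}]"
  let ?xs = "\<lambda>b. map (\<lambda>j. rsmult (col M j) (b j)) [0..<n] @ [0\<^sub>v n]"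
  have "inj (rsmult (col M j))" if j: "j < n" for j
  proof (rule injI)
    fix a b assume "rsmult (col M j) a = rsmult (col M j) b"
    moreover have "rsmult (col M j) c = M *\<^sub>v Matrix.vec n (\<lambda>i. if i = j then c else 0)" for c
    proof (rule eq_vecI)
      fix r assume "r < dim_vec (M *\<^sub>v Matrix.vec n (\<lambda>i. if i = j then c else 0))"
      then have r: "r < n" using MN by simp
      have "(M *\<^sub>v Matrix.vec n (\<lambda>i. if i = j then c else 0)) $ r = (\<Sum>i = 0..<n. if i = j then M $$ (r, j) * c else 0)"
        using MN r by (simp add: scalar_prod_def if_distrib[of "\<lambda>x. _ * x"] cong: if_cong)
      then show "rsmult (col M j) c $ r = (M *\<^sub>v Matrix.vec n (\<lambda>i. if i = j then c else 0)) $ r"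
        using MN r j by (simp add: rsmult_def)
    qed (use MN in \<open>auto simp: rsmult_def\<close>)
    ultimately have "Matrix.vec n (\<lambda>i. if i = j then a else 0) = Matrix.vec n (\<lambda>i. if i = j then b else 0)"
      using NM by (metis vec_carrier)
    from arg_cong[OF this, of "\<lambda>v. v $ j"] show "a = b" using j by simp
  qed
  moreover have "internal_direct_sum n ?Ms"
    unfolding internal_direct_sum_def
  proof (intro conjI ballI)
    have "right_submodule n {0\<^sub>v n :: 'b vec}"
      by (auto simp: right_submodule_def rsmult_def intro!: eq_vecI)
    moreover have "right_submodule n (range (rsmult (col M j)))" for j
      by (rule right_submodule_range) (use MN(1) in auto)
    ultimately show "right_submodule n Q" if "Q \<in> set ?Ms" for Q
      using that by auto
    fix w :: "'b vec" assume w: "w \<in> carrier_vec n"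
    show "\<exists>!xs. list_all2 (\<in>) xs ?Ms \<and> w = vec_sum n xs"
    proof (rule ex1I[of _ "?xs (\<lambda>j. (N *\<^sub>v w) $ j)"])
      have "Matrix.vec n (\<lambda>j. (N *\<^sub>v w) $ j) = N *\<^sub>v w" using MN by (intro eq_vecI) auto
      then show "list_all2 (\<in>) (?xs (\<lambda>j. (N *\<^sub>v w) $ j)) ?Ms \<and> w = vec_sum n (?xs (\<lambda>j. (N *\<^sub>v w) $ j))"
        unfolding vec_sum_columns[OF MN(1)] using MN'[OF w]
        by (auto simp: list_all2_conv_all_nth nth_append)
    next
      fix xs assume xs: "list_all2 (\<in>) xs ?Ms \<and> w = vec_sum n xs"
      then have len: "length xs = Suc n" by (auto dest: list_all2_lengthD)
      have el: "xs ! j \<in> ?Ms ! j" if "j < Suc n" for j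
        using xs that len by (auto simp: list_all2_conv_all_nth)
      have "\<exists>b. xs ! j = rsmult (col M j) b" if "j < n" for j
        using el[of j] that by (auto simp: nth_append)
      then obtain b where b: "\<And>j. j < n \<Longrightarrow> xs ! j = rsmult (col M j) (b j)" by metis
      have "xs ! n = 0\<^sub>v n" using el[of n] by (simp add: nth_append)
      then have xs': "xs = ?xs b"
        using len b by (intro nth_equalityI) (auto simp: nth_append less_Suc_eq)
      then have "w = M *\<^sub>v Matrix.vec n b" using xs vec_sum_columns[OF MN(1)] by simp
      then have "N *\<^sub>v w = Matrix.vec n b" using NM by simp
      then show "xs = ?xs (\<lambda>j. (N *\<^sub>v w) $ j)" unfolding xs' by simp
    qed
  qed
  moreover have "right_module_iso (carrier_vec (n - n)) {0\<^sub>v n} (\<lambda>_. 0\<^sub>v n :: 'b vec)"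
    by (auto simp: right_module_iso_def bij_betw_def inj_on_def rsmult_def intro!: eq_vecI image_eqI[of _ _ "0\<^sub>v 0"])
  ultimately show ?thesis
    using MN(1) unfolding partial_frame_def by (auto simp: bij_betw_def)
qed

lemma partial_frame_prefix:
  "partial_frame n (xs @ ys) \<Longrightarrow> length (xs @ ys) \<le> n \<Longrightarrow> partial_frame n xs"
proof (induction ys rule: rev_induct)
  case (snoc y ys)
  then have "partial_frame n ((xs @ ys) @ [])" using partial_frame_remove[of n "xs @ ys" y "[]"] by simp
  then show ?case using snoc by simp
qed simp

text \<open>The chosen columns are permuted to the front of a full frame. Deleting the remaining
  vectors supplies the free complement.\<close>

lemma columns_frame_simplices:
  fixes M :: "'b::ring_1 mat"
  assumes M: "M \<in> carrier (GL TYPE('b) n)" and cs: "distinct cs" "set cs \<subseteq> {..<n}" "length cs = Suc p"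
  shows "map (col M) cs \<in> frame_simplices TYPE('b) n p"
proof -
  have len: "Suc p \<le> n"
    using card_mono[OF _ cs(2)] distinct_card[OF cs(1)] cs(3) by simp
  have "inj_on ((!) cs) {..<Suc p}" using cs by (simp add: inj_on_nth)
  moreover have "(!) cs ` {..<Suc p} \<subseteq> {..<n}" using cs(2,3) nth_mem[of _ cs] by (auto simp del: nth_mem)
  ultimately obtain s where s: "bij_betw s {..<n} {..<n}" "\<And>a. a < Suc p \<Longrightarrow> s a = cs ! a"
    using extend_to_permutation[of "{..<n}" "{..<Suc p}" "(!) cs"] len by auto
  obtain M' where M': "M' \<in> carrier (GL TYPE('b) n)" "\<And>c. c < n \<Longrightarrow> col M' c = col M (s c)"
    using permute_cols[OF M s(1)] by blast
  have "[0..<n] = [0..<Suc p] @ [Suc p..<n]" using len upt_add_eq_append[of 0 "Suc p" "n - Suc p"] by (simp del: upt_Suc)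
  then have "partial_frame n (map (col M') [0..<Suc p])"
    using GL_columns_frame[OF M'(1)] partial_frame_prefix[of n "map (col M') [0..<Suc p]" "map (col M') [Suc p..<n]"] len
    by simp
  moreover have "map (col M') [0..<Suc p] = map (col M) cs"
    using len cs(3) M'(2) s(2) by (intro nth_equalityI) (auto simp del: upt_Suc)
  ultimately show ?thesis using len cs(3) by (simp add: frame_simplices_def)
qed

section \<open>The lift of the frame complex to the Steinberg group\<close>

lemma x_gen_in_St: "i < n \<Longrightarrow> j < n \<Longrightarrow> i \<noteq> j \<Longrightarrow> x_gen n i j (a::'b::ring_1) \<in> carrier (St TYPE('b) n)"
  unfolding St_def x_gen_def x_word_def by (intro pres_class_in_carrier) (simp add: st_gens_def)

lemma word_eval_St:
  "w \<in> words (st_gens TYPE('b::ring_1) n) \<Longrightarrow>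
    word_eval (St TYPE('b) n) (\<lambda>(i, j, a). x_gen n i j a) w = pres_class (st_gens TYPE('b) n) (st_rels TYPE('b) n) w"
proof -
  assume w: "w \<in> words (st_gens TYPE('b) n)"
  have f: "(\<lambda>(i, j, a). x_gen n i j a) =
      (\<lambda>g. pres_class (st_gens TYPE('b) n) (st_rels TYPE('b) n) [(g, True)])"
    by (auto simp: x_gen_def x_word_def)
  show ?thesis unfolding f St_def by (rule word_eval_presented[OF w])
qed

lemma St_relation:
  assumes "(u, v) \<in> st_rels TYPE('b::ring_1) n" "u \<in> words (st_gens TYPE('b) n)" "v \<in> words (st_gens TYPE('b) n)"
  shows "word_eval (St TYPE('b) n) (\<lambda>(i, j, a). x_gen n i j a) u =
    word_eval (St TYPE('b) n) (\<lambda>(i, j, a). x_gen n i j a) v"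
  unfolding word_eval_St[OF assms(2)] word_eval_St[OF assms(3)] pres_class_eq_iff[OF assms(2,3)]
  using assms by (rule pres_rel.rel)

lemma word_eval_generate:
  assumes "group H" "f \<in> S \<rightarrow> carrier H" "w \<in> words S"
  shows "word_eval H f w \<in> generate H (f ` S)"
  using assms(3)
proof (induction w)
  case Nil
  then show ?case by (simp add: generate.one)
next
  case (Cons x w)
  obtain g e where x: "x = (g, e)" by (cases x)
  then have g: "g \<in> S" using Cons.prems by simp
  have "(if e then f g else inv\<^bsub>H\<^esub> f g) \<in> generate H (f ` S)"
    using g by (simp add: generate.incl generate.inv)
  then show ?case using Cons x by (simp add: generate.eng)
qed

lemma GL_cancel:
  fixes A :: "'b::ring_1 mat"
  assumes "A \<in> carrier (GL TYPE('b) n)" "B \<in> carrier_mat n n" "C \<in> carrier_mat n n" "A * B = A * C"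
  shows "B = C"
proof -
  obtain N where N: "N \<in> carrier_mat n n" "N * A = 1\<^sub>m n" "A \<in> carrier_mat n n"
    using assms(1) by (auto simp: carrier_GL)
  have "B = N * A * B" using N assms(2) by simp
  also have "\<dots> = N * (A * C)" using assoc_mult_mat[OF N(1,3) assms(2)] assms(4) by simp
  also have "\<dots> = C" using assoc_mult_mat[OF N(1,3) assms(3)] N assms(3) by simp
  finally show ?thesis .
qed

lemma steinberg_St:
  assumes "\<And>a :: 'b::ring_1. a + a = 0"
  shows "steinberg (St TYPE('b) n) n (x_gen n :: nat \<Rightarrow> nat \<Rightarrow> 'b \<Rightarrow> _)"
proof -
  interpret group "St TYPE('b) n" by (rule group_St)
  let ?G = "St TYPE('b) n" and ?X = "x_gen n :: nat \<Rightarrow> nat \<Rightarrow> 'b \<Rightarrow> _"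
  show ?thesis
  proof
    show "?X i j a \<in> carrier ?G" if "i < n" "j < n" "i \<noteq> j" for i j a
      using x_gen_in_St that .
    show "?X i j a \<otimes>\<^bsub>?G\<^esub> ?X i j b = ?X i j (a + b)" if ij: "i < n" "j < n" "i \<noteq> j" for i j a b
    proof -
      have "(x_word i j a @ x_word i j b, x_word i j (a + b)) \<in> st_rels TYPE('b) n"
        unfolding st_rels_def using ij by blast
      from St_relation[OF this] show ?thesis
        using ij by (simp add: x_word_def st_gens_def x_gen_in_St)
    qed
    show "?X i j a \<otimes>\<^bsub>?G\<^esub> ?X k l b = ?X k l b \<otimes>\<^bsub>?G\<^esub> ?X i j a"
      if ij: "i < n" "j < n" "k < n" "l < n" "i \<noteq> j" "k \<noteq> l" "i \<noteq> l" "j \<noteq> k" for i j k l a b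
    proof -
      have "(word_comm (x_word i j a) (x_word k l b), []) \<in> st_rels TYPE('b) n"
        unfolding st_rels_def using ij by blast
      from St_relation[OF this]
      have "?X i j a \<otimes>\<^bsub>?G\<^esub> (?X k l b \<otimes>\<^bsub>?G\<^esub> (inv\<^bsub>?G\<^esub> ?X i j a \<otimes>\<^bsub>?G\<^esub> inv\<^bsub>?G\<^esub> ?X k l b)) = \<one>\<^bsub>?G\<^esub>"
        using ij by (simp add: x_word_def word_comm_def word_inv_def st_gens_def x_gen_in_St)
      then show ?thesis
        using ij commutator_eq_iff[of "?X i j a" "?X k l b" "\<one>\<^bsub>?G\<^esub>"] by (simp add: x_gen_in_St)
    qed
    show "?X i j a \<otimes>\<^bsub>?G\<^esub> ?X j k b = ?X i k (a * b) \<otimes>\<^bsub>?G\<^esub> (?X j k b \<otimes>\<^bsub>?G\<^esub> ?X i j a)"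
      if ij: "i < n" "j < n" "k < n" "i \<noteq> j" "j \<noteq> k" "i \<noteq> k" for i j k a b
    proof -
      have "(word_comm (x_word i j a) (x_word j k b), x_word i k (a * b)) \<in> st_rels TYPE('b) n"
        unfolding st_rels_def using ij by blast
      from St_relation[OF this]
      have "?X i j a \<otimes>\<^bsub>?G\<^esub> (?X j k b \<otimes>\<^bsub>?G\<^esub> (inv\<^bsub>?G\<^esub> ?X i j a \<otimes>\<^bsub>?G\<^esub> inv\<^bsub>?G\<^esub> ?X j k b)) = ?X i k (a * b)"
        using ij by (simp add: x_word_def word_comm_def word_inv_def st_gens_def x_gen_in_St)
      then show ?thesis
        using ij commutator_eq_iff[of "?X i j a" "?X j k b" "?X i k (a * b)"] by (simp add: x_gen_in_St)
    qed
    show "carrier ?G = generate ?G {?X i j a | i j a. i < n \<and> j < n \<and> i \<noteq> j}"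
    proof
      show "generate ?G {?X i j a | i j a. i < n \<and> j < n \<and> i \<noteq> j} \<subseteq> carrier ?G"
        by (rule generate_incl) (auto intro: x_gen_in_St)
      have eq: "(\<lambda>(i, j, a). ?X i j a) ` st_gens TYPE('b) n = {?X i j a | i j a. i < n \<and> j < n \<and> i \<noteq> j}"
        by (force simp: st_gens_def)
      show "carrier ?G \<subseteq> generate ?G {?X i j a | i j a. i < n \<and> j < n \<and> i \<noteq> j}"
      proof
        fix x assume "x \<in> carrier ?G"
        then obtain w where w: "w \<in> words (st_gens TYPE('b) n)"
          "x = pres_class (st_gens TYPE('b) n) (st_rels TYPE('b) n) w"
          unfolding St_def by (elim presented_group_cases)
        have "word_eval ?G (\<lambda>(i, j, a). ?X i j a) w \<in> generate ?G ((\<lambda>(i, j, a). ?X i j a) ` st_gens TYPE('b) n)"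
          by (rule word_eval_generate[OF group_St _ w(1)]) (auto simp: st_gens_def intro: x_gen_in_St)
        then show "x \<in> generate ?G {?X i j a | i j a. i < n \<and> j < n \<and> i \<noteq> j}"
          unfolding word_eval_St[OF w(1)] eq w(2) .
      qed
    qed
    show "a + a = 0" for a :: 'b by (rule assms)
  qed
qed

section \<open>Steinberg elements acting on the columns of their matrices\<close>

locale steinberg_frames =
  fixes TB :: "'b::ring_1 itself" and n :: nat
  assumes char: "\<And>a :: 'b. a + a = 0" and nontrivial: "(0 :: 'b) \<noteq> 1"
    and n: "n \<ge> 3"
    and GE: "m = n - 1 \<or> m = n - 2 \<Longrightarrow> carrier (GL TYPE('b) m) = elem_group TYPE('b) m"
    and stab_ker: "y \<in> st_ker TYPE('b) (n - 1) \<Longrightarrow> stab TYPE('b) (n - 1) y = \<one>\<^bsub>St TYPE('b) n\<^esub>"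
begin

abbreviation "\<phi> \<equiv> phi TYPE('b) n"
abbreviation "XX \<equiv> x_gen n :: nat \<Rightarrow> nat \<Rightarrow> 'b \<Rightarrow> 'b st_gen word set"

sublocale steinberg "St TYPE('b) n" n XX
  by (rule steinberg_St[OF char])

abbreviation mul (infixl "\<cdot>" 70) where "g \<cdot> h \<equiv> g \<otimes>\<^bsub>St TYPE('b) n\<^esub> h"

lemma phi_GL: "g \<in> carrier (St TYPE('b) n) \<Longrightarrow> \<phi> g \<in> carrier (GL TYPE('b) n)"
  using phi_hom by (rule hom_in_carrier)

lemma phi_carrier: "g \<in> carrier (St TYPE('b) n) \<Longrightarrow> \<phi> g \<in> carrier_mat n n"
  using phi_GL GL_carrier_mat by blast

lemma phi_mult: "g \<in> carrier (St TYPE('b) n) \<Longrightarrow> h \<in> carrier (St TYPE('b) n) \<Longrightarrow> \<phi> (g \<cdot> h) = \<phi> g * \<phi> h"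
  using hom_mult[OF phi_hom] by (simp add: mult_GL)

lemma phi_X: "i < n \<Longrightarrow> j < n \<Longrightarrow> i \<noteq> j \<Longrightarrow> \<phi> (XX i j a) = transv n i j a"
  by (rule phi_x_gen)

lemma phi_one: "\<phi> \<one>\<^bsub>St TYPE('b) n\<^esub> = 1\<^sub>m n"
  using hom_one[OF phi_hom group_St group_GL] by (simp add: one_GL)

text \<open>Each generator on the right alters only a column below \<open>m\<close>. For
  \<open>m = n - 1\<close> this makes the last column constant on cosets of \<open>P\<close>, so a
  coset lies over a vertex.\<close>

lemma col_phi_cols:
  assumes "p \<in> cols m" "m \<le> n" "g \<in> carrier (St TYPE('b) n)" "m \<le> c" "c < n"
  shows "col (\<phi> (g \<cdot> p)) c = col (\<phi> g) c"
  using assms(1,2,3)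
proof (induction arbitrary: g rule: cols_induct)
  case (mult k l a y)
  have c: "XX k l a \<in> carrier (St TYPE('b) n)" "y \<in> carrier (St TYPE('b) n)" "l < n" "c \<noteq> l"
    using mult.hyps assms cols_carrier[of m] by auto
  have "col (\<phi> (g \<cdot> (XX k l a \<cdot> y))) c = col (\<phi> (g \<cdot> XX k l a)) c"
    using mult c by (simp add: m_assoc[symmetric])
  also have "\<dots> = col (\<phi> g * transv n k l a) c"
    using mult.hyps c mult.prems by (simp add: phi_mult phi_X)
  also have "\<dots> = col (\<phi> g) c"
    by (rule col_mult_transv) (use mult.hyps mult.prems c assms(5) phi_carrier in auto)
  finally show ?case .
qed simp

lemma col_transv:
  assumes "M \<in> carrier_mat n n" "i < n" "j < n"
  shows "col (M * transv n i j (1::'b)) j = col M j + col M i"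
proof (rule eq_vecI)
  fix r assume "r < dim_vec (col M j + col M i)"
  then show "col (M * transv n i j 1) j $ r = (col M j + col M i) $ r"
    using mult_transv_index[OF assms(1,2) _ assms(3), of r j 1] assms
    by (simp add: transv_def mat_unit_def del: index_mult_mat(1))
qed (use assms in simp)

text \<open>Three column additions perform the exchange: the pair \<open>(u, v)\<close> of columns
  \<open>i\<close> and \<open>j\<close> becomes \<open>(u, v + u)\<close>, then
  \<open>(v, v + u)\<close>, then \<open>(v, u)\<close>, with cancellations from characteristic
  two.\<close>

lemma col_phi_weyl:
  assumes g: "g \<in> carrier (St TYPE('b) n)" and ij: "i < n" "j < n" "i \<noteq> j"
  shows "col (\<phi> (g \<cdot> weyl i j)) i = col (\<phi> g) j" "col (\<phi> (g \<cdot> weyl i j)) j = col (\<phi> g) i"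
    "c < n \<Longrightarrow> c \<noteq> i \<Longrightarrow> c \<noteq> j \<Longrightarrow> col (\<phi> (g \<cdot> weyl i j)) c = col (\<phi> g) c"
proof -
  let ?M = "\<phi> g" and ?x = "transv n i j (1::'b)" and ?y = "transv n j i (1::'b)"
  have M: "?M \<in> carrier_mat n n" "?M * ?x \<in> carrier_mat n n" "?M * ?x * ?y \<in> carrier_mat n n"
    using phi_carrier[OF g] by (auto intro!: mult_carrier_mat[of _ n n])
  have eq: "\<phi> (g \<cdot> weyl i j) = ?M * ?x * ?y * ?x"
    using g ij M(1) by (simp add: weyl_def phi_mult phi_X assoc_mult_mat[of _ n n _ n _ n] mult_carrier_mat[of _ n n])
  have c: "col ?M i \<in> carrier_vec n" "col ?M j \<in> carrier_vec n" using M(1) by (auto intro!: carrier_vecI)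
  have cancel: "u + (v + u) = v" "v + u + u = v" if "u \<in> carrier_vec n" "v \<in> carrier_vec n" for u v :: "'b vec"
    using that char by (auto intro!: eq_vecI simp: add.left_commute add.assoc)
  have xi: "col (?M * ?x) i = col ?M i" using col_mult_transv[OF M(1), of i i j 1] ij by simp
  have xj: "col (?M * ?x) j = col ?M j + col ?M i" using col_transv[OF M(1) ij(1,2)] .
  have yi: "col (?M * ?x * ?y) i = col ?M j"
    using col_transv[OF M(2) ij(2,1)] xi xj cancel[OF c] by simp
  have yj: "col (?M * ?x * ?y) j = col ?M j + col ?M i"
    using col_mult_transv[OF M(2), of j j i 1] ij xj by simp
  show "col (\<phi> (g \<cdot> weyl i j)) i = col ?M j"
    unfolding eq using col_mult_transv[OF M(3), of i i j 1] ij yi by simp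
  show "col (\<phi> (g \<cdot> weyl i j)) j = col ?M i"
    unfolding eq using col_transv[OF M(3) ij(1,2)] yi yj c cancel[OF c(2,1)] comm_add_vec[OF c] by simp
  show "col (\<phi> (g \<cdot> weyl i j)) c = col ?M c" if "c < n" "c \<noteq> i" "c \<noteq> j"
    unfolding eq using that ij M by (simp add: col_mult_transv)
qed

lemma lift_transv_group:
  assumes "M \<in> transv_group TYPE('b) n m" "m \<le> n"
  shows "\<exists>p\<in>cols m. \<phi> p = M"
  using assms
proof (induction rule: transv_group_induct)
  case one
  then show ?case using cols_one phi_one by blast
next
  case (mult k l a B)
  then obtain p where p: "p \<in> cols m" "\<phi> p = B" by blast
  then have "\<phi> (XX k l a \<cdot> p) = transv n k l a * B"
    using mult.hyps assms(2) cols_carrier by (simp add: phi_mult phi_X)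
  then show ?case using cols_mult[OF cols_X p(1)] mult.hyps by blast
qed

text \<open>The quotient of \<open>M\<close> by \<phi> \<open>g\<close> on the left fixes the basis
  vectors from index \<open>m\<close> on, hence is a product of transvections with column index
  below \<open>m\<close>, and these lift to \<open>cols m\<close>.\<close>

lemma lift_columns:
  assumes g: "g \<in> carrier (St TYPE('b) n)" and M: "M \<in> carrier (GL TYPE('b) n)"
    and m: "m = n - 1 \<or> m = n - 2" and eq: "\<And>c. m \<le> c \<Longrightarrow> c < n \<Longrightarrow> col M c = col (\<phi> g) c"
  shows "\<exists>p\<in>cols m. \<phi> (g \<cdot> p) = M"
proof -
  interpret GL: group "GL TYPE('b) n" by (rule group_GL)
  have mn: "m \<le> n" using m by auto
  let ?N = "inv\<^bsub>GL TYPE('b) n\<^esub> \<phi> g"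
  have N: "?N \<in> carrier (GL TYPE('b) n)" using phi_GL[OF g] by simp
  have car: "?N \<in> carrier_mat n n" "\<phi> g \<in> carrier_mat n n" "M \<in> carrier_mat n n"
    using N M phi_carrier[OF g] GL_carrier_mat by auto
  have NM: "?N * M \<in> carrier (GL TYPE('b) n)" using GL.m_closed[OF N M] by (simp add: mult_GL)
  have "col (?N * M) c = col (1\<^sub>m n) c" if c: "m \<le> c" "c < n" for c
  proof -
    have "col (?N * M) c = ?N *\<^sub>v col M c" by (rule col_mult2[OF car(1,3) c(2)])
    also have "\<dots> = col (?N * \<phi> g) c" using col_mult2[OF car(1,2) c(2)] eq[OF c] by simp
    finally show ?thesis using inv_GL(1)[OF phi_GL[OF g]] by simp
  qed
  then have "?N * M \<in> transv_group TYPE('b) n m"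
    by (rule fixed_cols_transv_group[OF NM mn _ GE[OF m]])
  then obtain p where p: "p \<in> cols m" "\<phi> p = ?N * M" using lift_transv_group mn by blast
  have "\<phi> (g \<cdot> p) = \<phi> g * (?N * M)" using phi_mult[OF g] cols_carrier[OF mn p(1)] p(2) by simp
  also have "\<dots> = (\<phi> g * ?N) * M" by (rule assoc_mult_mat[symmetric, OF car(2,1,3)])
  also have "\<dots> = M" using inv_GL(2)[OF phi_GL[OF g]] car(3) by simp
  finally show ?thesis using p(1) by blast
qed

lemma phi_row_elem: "m \<le> n - 1 \<Longrightarrow> \<phi> (row_elem m r) = lower n (n - 1) (\<lambda>i k. if k < m then r k else 0)"
proof (induction m)
  case 0
  then show ?case using n by (simp add: phi_one) (auto intro!: eq_matI simp: lower_def)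
next
  case (Suc m)
  have "\<phi> (row_elem (Suc m) r) = transv n (n - 1) m (r m) * \<phi> (row_elem m r)"
    using Suc.prems row_elem_closed[of m r] n by (simp add: phi_mult phi_X)
  also have "\<dots> = lower n (n - 1) (\<lambda>i k. (if i = n - 1 \<and> k = m then r m else 0) + (if k < m then r k else 0))"
    using Suc n by (subst transv_lower[symmetric]) auto
  also have "\<dots> = lower n (n - 1) (\<lambda>i k. if k < Suc m then r k else 0)"
    by (intro eq_matI) (use n in \<open>auto simp: lower_index lower_def less_Suc_eq\<close>)
  finally show ?case .
qed

lemma phi_stab:
  assumes "y \<in> carrier (St TYPE('b) (n - 1))"
  shows "\<phi> (stab TYPE('b) (n - 1) y) = extend_mat n (n - 1) (phi TYPE('b) (n - 1) y)"
proof -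
  interpret S: steinberg "St TYPE('b) (n - 1)" "n - 1" "x_gen (n - 1) :: nat \<Rightarrow> nat \<Rightarrow> 'b \<Rightarrow> _"
    by (rule steinberg_St[OF char])
  have Suc: "Suc (n - 1) = n" using n by simp
  have hom: "stab TYPE('b) (n - 1) \<in> hom (St TYPE('b) (n - 1)) (St TYPE('b) n)"
    using stab_hom[where 'b='b and m="n - 1"] unfolding Suc .
  have stab_X: "stab TYPE('b) (n - 1) (x_gen (n - 1) k l a) = XX k l a" if "k < n - 1" "l < n - 1" "k \<noteq> l" for k l a
    using stab_x_gen[OF that] unfolding Suc .
  have "y \<in> S.cols (n - 1)" using assms S.cols_n by simp
  then show ?thesis
    using order.refl
  proof (induction rule: S.cols_induct)
    case one
    show ?case
      using hom_one[OF hom group_St group_St] hom_one[OF phi_hom[where 'b='b and m="n - 1"] group_St group_GL]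
      by (simp add: phi_one one_GL extend_one)
  next
    case (mult k l a y)
    have y: "y \<in> carrier (St TYPE('b) (n - 1))" using S.cols_carrier mult.hyps by blast
    have X: "x_gen (n - 1) k l a \<in> carrier (St TYPE('b) (n - 1))"
      by (rule x_gen_in_St) (use mult.hyps in auto)
    have 1: "stab TYPE('b) (n - 1) (x_gen (n - 1) k l a \<otimes>\<^bsub>St TYPE('b) (n - 1)\<^esub> y) =
        XX k l a \<cdot> stab TYPE('b) (n - 1) y"
      using hom_mult[OF hom X y] stab_X mult.hyps by simp
    have 2: "phi TYPE('b) (n - 1) (x_gen (n - 1) k l a \<otimes>\<^bsub>St TYPE('b) (n - 1)\<^esub> y) =
        transv (n - 1) k l a * phi TYPE('b) (n - 1) y"
      using hom_mult[OF phi_hom X y] phi_x_gen[of k "n - 1" l a] mult.hyps by (simp add: mult_GL)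
    have "phi TYPE('b) (n - 1) y \<in> carrier_mat (n - 1) (n - 1)"
      using hom_in_carrier[OF phi_hom y] GL_carrier_mat by blast
    then have "extend_mat n (n - 1) (transv (n - 1) k l a * phi TYPE('b) (n - 1) y) =
        transv n k l a * extend_mat n (n - 1) (phi TYPE('b) (n - 1) y)"
      using extend_mult[of "transv (n - 1) k l a" "n - 1" _ n] extend_transv[of k "n - 1" l n a] mult.hyps by simp
    then show ?case
      unfolding 1 2 using mult hom_in_carrier[OF hom y] by (simp add: phi_mult phi_X)
  qed
qed

text \<open>Write \<open>p\<close> as a row element times \<open>stab y\<close>. Comparing blocks
  with the identity makes the matrix of \<open>y\<close> trivial and then the row zero; so
  \<open>y\<close> lies in the smaller kernel, which stabilization kills.\<close>

lemma phi_inj_cols: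
  assumes "p \<in> cols (n - 1)" "\<phi> p = 1\<^sub>m n"
  shows "p = \<one>\<^bsub>St TYPE('b) n\<^esub>"
proof -
  interpret S: group "St TYPE('b) (n - 1)" by (rule group_St)
  have Suc: "Suc (n - 1) = n" using n by simp
  have hom: "stab TYPE('b) (n - 1) \<in> hom (St TYPE('b) (n - 1)) (St TYPE('b) n)"
    using stab_hom[where 'b='b and m="n - 1"] unfolding Suc .
  have stab_X: "stab TYPE('b) (n - 1) (x_gen (n - 1) k l a) = XX k l a" if "k < n - 1" "l < n - 1" "k \<noteq> l" for k l a
    using stab_x_gen[OF that] unfolding Suc .
  let ?J = "{XX k l a | k l a. k < n - 1 \<and> l < n - 1 \<and> k \<noteq> l}"
  obtain r h where h: "h \<in> generate (St TYPE('b) n) ?J" and p: "p = row_elem (n - 1) r \<cdot> h"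
    using cols_decompose[OF assms(1)] n by auto
  have J: "?J \<subseteq> carrier (St TYPE('b) n)" by auto
  have "\<exists>y\<in>carrier (St TYPE('b) (n - 1)). stab TYPE('b) (n - 1) y = h"
  proof (rule generate_induct_left[OF J _ h])
    show "inv\<^bsub>St TYPE('b) n\<^esub> s \<in> ?J" if "s \<in> ?J" for s using that by (auto simp: X_inv) blast
    show "\<exists>y\<in>carrier (St TYPE('b) (n - 1)). stab TYPE('b) (n - 1) y = \<one>\<^bsub>St TYPE('b) n\<^esub>"
      using hom_one[OF hom group_St group_St] S.one_closed by blast
    fix s y assume s: "s \<in> ?J" and "\<exists>y'\<in>carrier (St TYPE('b) (n - 1)). stab TYPE('b) (n - 1) y' = y"
    then obtain y' k l a where y': "y' \<in> carrier (St TYPE('b) (n - 1))" "stab TYPE('b) (n - 1) y' = y"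
      "s = XX k l a" "k < n - 1" "l < n - 1" "k \<noteq> l" by blast
    have X: "x_gen (n - 1) k l a \<in> carrier (St TYPE('b) (n - 1))" using y' x_gen_in_St by blast
    have "stab TYPE('b) (n - 1) (x_gen (n - 1) k l a \<otimes>\<^bsub>St TYPE('b) (n - 1)\<^esub> y') = s \<cdot> y"
      using hom_mult[OF hom X y'(1)] y' stab_X by simp
    then show "\<exists>z\<in>carrier (St TYPE('b) (n - 1)). stab TYPE('b) (n - 1) z = s \<cdot> y"
      using S.m_closed[OF X y'(1)] by blast
  qed
  then obtain y where y: "y \<in> carrier (St TYPE('b) (n - 1))" "stab TYPE('b) (n - 1) y = h" by blast
  define A where "A = phi TYPE('b) (n - 1) y"
  have A: "A \<in> carrier_mat (n - 1) (n - 1)"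
    using hom_in_carrier[OF phi_hom y(1)] GL_carrier_mat A_def by blast
  let ?D = "Matrix.mat (n - (n - 1)) (n - 1) (\<lambda>(i, k). if k < n - 1 then r k else 0)"
  have hc: "h \<in> carrier (St TYPE('b) n)" using generate_in_carrier[OF J h] .
  have rc: "row_elem (n - 1) r \<in> carrier (St TYPE('b) n)" by (rule row_elem_closed) (use n in simp)
  have block_p: "\<phi> p = four_block_mat A (0\<^sub>m (n - 1) (n - (n - 1))) (?D * A) (1\<^sub>m (n - (n - 1)))"
    using lower_extend[OF A, of n "\<lambda>i k. if k < n - 1 then r k else 0"] phi_stab[OF y(1)]
    unfolding p phi_mult[OF rc hc] phi_row_elem[OF order.refl] y(2) A_def[symmetric] by simp
  have block_one: "1\<^sub>m n = four_block_mat (1\<^sub>m (n - 1)) (0\<^sub>m (n - 1) (n - (n - 1))) (0\<^sub>m (n - (n - 1)) (n - 1))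
      (1\<^sub>m (n - (n - 1)) :: 'b mat)"
    using n by (intro eq_matI) auto
  have eq: "four_block_mat A (0\<^sub>m (n - 1) (n - (n - 1))) (?D * A) (1\<^sub>m (n - (n - 1))) =
      four_block_mat (1\<^sub>m (n - 1)) (0\<^sub>m (n - 1) (n - (n - 1))) (0\<^sub>m (n - (n - 1)) (n - 1)) (1\<^sub>m (n - (n - 1)))"
    by (rule HOL.trans[OF HOL.trans[OF block_p[symmetric] assms(2)] block_one])
  have DA_carrier: "?D * A \<in> carrier_mat (n - (n - 1)) (n - 1)"
    by (rule mult_carrier_mat[OF mat_carrier A])
  note blocks = four_block_eqD[OF eq A one_carrier_mat DA_carrier zero_carrier_mat one_carrier_mat one_carrier_mat]
  have A1: "A = 1\<^sub>m (n - 1)" and DA: "?D * A = 0\<^sub>m (n - (n - 1)) (n - 1)"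
    using blocks .
  have D0: "?D = 0\<^sub>m (n - (n - 1)) (n - 1)" using DA unfolding A1 by simp
  have "r k = 0" if "k < n - 1" for k
    using arg_cong[OF D0, of "\<lambda>M. M $$ (0, k)"] that n by simp
  then have "row_elem (n - 1) r = row_elem (n - 1) (\<lambda>_. 0)" by (intro row_elem_cong) simp
  then have "row_elem (n - 1) r = \<one>\<^bsub>St TYPE('b) n\<^esub>" using row_elem_zero[of "n - 1"] n by simp
  moreover have "y \<in> st_ker TYPE('b) (n - 1)"
    using y(1) A1 by (simp add: st_ker_def kernel_def A_def one_GL)
  then have "h = \<one>\<^bsub>St TYPE('b) n\<^esub>" using stab_ker y(2) by simp
  ultimately show ?thesis using p by simp
qed

lemma phi_eq_cols:
  assumes "p \<in> cols (n - 1)" "q \<in> cols (n - 1)" "\<phi> p = \<phi> q"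
  shows "p = q"
proof -
  have P: "subgroup (cols (n - 1)) (St TYPE('b) n)" by (rule cols_subgroup) simp
  have c: "p \<in> carrier (St TYPE('b) n)" "q \<in> carrier (St TYPE('b) n)"
    using assms cols_carrier[of "n - 1"] by auto
  have "inv\<^bsub>St TYPE('b) n\<^esub> q \<cdot> p \<in> cols (n - 1)"
    using assms subgroup.m_inv_closed[OF P] cols_mult by blast
  moreover have "\<phi> (inv\<^bsub>St TYPE('b) n\<^esub> q \<cdot> p) = \<phi> (inv\<^bsub>St TYPE('b) n\<^esub> q) * \<phi> q"
    using c assms(3) by (simp add: phi_mult)
  then have "\<phi> (inv\<^bsub>St TYPE('b) n\<^esub> q \<cdot> p) = 1\<^sub>m n"
    using phi_mult[OF inv_closed[OF c(2)] c(2)] c(2) by (simp add: phi_one)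
  ultimately have "inv\<^bsub>St TYPE('b) n\<^esub> q \<cdot> p = \<one>\<^bsub>St TYPE('b) n\<^esub>" by (rule phi_inj_cols)
  then show ?thesis using c by (metis inv_closed inv_equality inv_inv)
qed

section \<open>Cosets, fibres and transport\<close>

abbreviation "P \<equiv> cols (n - 1)"
abbreviation "w1 \<equiv> weyl (n - 2) (n - 1)"
abbreviation "w2 \<equiv> weyl (n - 3) (n - 2)"

lemma P_carrier: "p \<in> P \<Longrightarrow> p \<in> carrier (St TYPE('b) n)"
  using cols_carrier[of "n - 1"] by simp

lemma idx: "n - 3 < n" "n - 2 < n" "n - 1 < n" "n - 3 \<noteq> n - 2" "n - 2 \<noteq> n - 1" "n - 3 \<noteq> n - 1"
  using n by auto

lemma w1_carrier: "w1 \<in> carrier (St TYPE('b) n)"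
  using idx by (intro weyl_closed) auto

text \<open>Both indices are below \<open>n - 1\<close>. Thus right multiplication by
  \<open>w2\<close> exchanges columns \<open>n - 3\<close> and \<open>n - 2\<close> of a
  representative without leaving its coset.\<close>

lemma w2_P: "w2 \<in> P"
  unfolding weyl_def using n by (intro cols_mult cols_X) auto

definition coset :: "'b st_gen word set \<Rightarrow> 'b st_gen word set set" where
  "coset g = {g \<cdot> p | p. p \<in> P}"

lemma coset_self: "g \<in> carrier (St TYPE('b) n) \<Longrightarrow> g \<in> coset g"
  unfolding coset_def using cols_one[of "n - 1"] by force

lemma coset_carrier: "g \<in> carrier (St TYPE('b) n) \<Longrightarrow> h \<in> coset g \<Longrightarrow> h \<in> carrier (St TYPE('b) n)"
  unfolding coset_def using P_carrier by auto

lemma coset_mult: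
  assumes "g \<in> carrier (St TYPE('b) n)" "p \<in> P"
  shows "coset (g \<cdot> p) = coset g"
proof -
  have inv: "inv\<^bsub>St TYPE('b) n\<^esub> p \<in> P"
    using subgroup.m_inv_closed[OF cols_subgroup assms(2)] by simp
  have "\<exists>q'\<in>P. g \<cdot> q = g \<cdot> p \<cdot> q'" if "q \<in> P" for q
  proof
    show "inv\<^bsub>St TYPE('b) n\<^esub> p \<cdot> q \<in> P" using cols_mult[OF inv that] .
    have "p \<cdot> (inv\<^bsub>St TYPE('b) n\<^esub> p \<cdot> q) = q"
      using assms that P_carrier by (simp add: m_assoc[symmetric])
    then show "g \<cdot> q = g \<cdot> p \<cdot> (inv\<^bsub>St TYPE('b) n\<^esub> p \<cdot> q)"
      using assms that P_carrier by (simp add: m_assoc)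
  qed
  moreover have "g \<cdot> p \<cdot> q = g \<cdot> (p \<cdot> q)" "p \<cdot> q \<in> P" if "q \<in> P" for q
    using assms that P_carrier cols_mult by (simp_all add: m_assoc)
  ultimately show ?thesis unfolding coset_def by blast
qed

definition Fib :: "'b vec \<Rightarrow> 'b st_gen word set set set" where
  "Fib v = {coset g | g. g \<in> carrier (St TYPE('b) n) \<and> col (\<phi> g) (n - 1) = v}"

text \<open>The union avoids choosing a representative whose column \<open>n - 2\<close> is
  \<open>w\<close>: all of them give the same coset. Equal vertices need their own case, since no
  invertible matrix over a nonzero ring has two equal columns and the union over a fibre element
  would be empty.\<close>

definition tr :: "'b vec \<Rightarrow> 'b vec \<Rightarrow> 'b st_gen word set set \<Rightarrow> 'b st_gen word set set" where
  "tr v w a = (if v = w then a else (\<Union>h\<in>{h \<in> a. col (\<phi> h) (n - 2) = w}. coset (h \<cdot> w1)))"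

text \<open>Well defined because the Weyl element normalises the lift of the stabiliser of an edge.\<close>

lemma tr_coset:
  assumes h: "h \<in> carrier (St TYPE('b) n)" and v: "col (\<phi> h) (n - 1) = v"
    and w: "col (\<phi> h) (n - 2) = w" and "v \<noteq> w"
  shows "tr v w (coset h) = coset (h \<cdot> w1)"
proof -
  have "coset (h' \<cdot> w1) = coset (h \<cdot> w1)" if h': "h' \<in> coset h" "col (\<phi> h') (n - 2) = w" for h'
  proof -
    obtain p where p: "p \<in> P" "h' = h \<cdot> p" using h'(1) by (auto simp: coset_def)
    have h'c: "h' \<in> carrier (St TYPE('b) n)" using coset_carrier[OF h h'(1)] .
    have "col (\<phi> h') (n - 1) = col (\<phi> h) (n - 1)"
      unfolding p(2) using idx by (intro col_phi_cols[OF p(1)] h) auto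
    then have "col (\<phi> h') c = col (\<phi> h) c" if "n - 2 \<le> c" "c < n" for c
      using that h'(2) w n by (cases "c = n - 2"; cases "c = n - 1") auto
    \<comment> \<open>Agreement in the last two columns yields some \<open>q\<close> in the smaller
      group \<open>cols (n - 2)\<close> with the same matrix as \<open>p\<close>; injectivity on
      \<open>P\<close> will identify the two.\<close>
    then obtain q where q: "q \<in> cols (n - 2)" "\<phi> (h \<cdot> q) = \<phi> h'"
      using lift_columns[OF h phi_GL[OF h'c], of "n - 2"] by blast
    have qP: "q \<in> P" by (rule subsetD[OF cols_mono q(1)]) arith
    have "\<phi> h * \<phi> q = \<phi> h * \<phi> p" using q(2) p h qP P_carrier by (simp add: phi_mult)
    then have "\<phi> q = \<phi> p"
      using GL_cancel[of "\<phi> h" n "\<phi> q" "\<phi> p"] phi_GL phi_carrier h qP p(1) P_carrier by simp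
    then have "p = q" using phi_eq_cols[OF qP p(1)] by simp
    obtain q' where q': "q' \<in> cols (n - 2)" "w1 \<cdot> q = q' \<cdot> w1"
      using weyl_cols[OF q(1) order.refl diff_le_mono2 idx(2,3,5)] by auto
    have q'P: "q' \<in> P" by (rule subsetD[OF cols_mono q'(1)]) arith
    note c = w1_carrier P_carrier[OF qP] P_carrier[OF q'P]
    \<comment> \<open>Since \<open>w1\<close> is an involution, its relation with \<open>q\<close>
      and \<open>q'\<close> may be reversed. The two transported representatives then differ on the
      right by \<open>q'\<close>, an element of \<open>P\<close>.\<close>
    have "w1 \<cdot> q' = w1 \<cdot> (q' \<cdot> (w1 \<cdot> w1))" using c weyl_self[of "n - 2" "n - 1"] idx by simp
    also have "\<dots> = w1 \<cdot> (q' \<cdot> w1 \<cdot> w1)" using c by (simp add: m_assoc)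
    also have "\<dots> = w1 \<cdot> (w1 \<cdot> q \<cdot> w1)" by (simp only: q'(2))
    also have "\<dots> = q \<cdot> w1" using c weyl_self_left[of "n - 2" "n - 1"] idx by (simp add: m_assoc)
    finally have "h' \<cdot> w1 = h \<cdot> w1 \<cdot> q'" unfolding p(2) \<open>p = q\<close> using h c by (simp add: m_assoc)
    then show ?thesis using coset_mult[OF _ q'P, of "h \<cdot> w1"] h c by simp
  qed
  moreover have "h \<in> {h' \<in> coset h. col (\<phi> h') (n - 2) = w}" using coset_self[OF h] w by simp
  ultimately have "(\<Union>h'\<in>{h' \<in> coset h. col (\<phi> h') (n - 2) = w}. coset (h' \<cdot> w1)) = coset (h \<cdot> w1)"
    by blast
  then show ?thesis using assms(4) by (simp add: tr_def)
qed

text \<open>An element of a fibre can be represented by a Steinberg element with any prescribed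
  matrix having the right last column. The other vertices of a simplex may thus be placed in columns
  \<open>n - 2\<close> and \<open>n - 3\<close>.\<close>

lemma Fib_rep:
  assumes a: "a \<in> Fib (col M (n - 1))" and M: "M \<in> carrier (GL TYPE('b) n)"
  shows "\<exists>h\<in>carrier (St TYPE('b) n). a = coset h \<and> \<phi> h = M"
proof -
  obtain g where g: "g \<in> carrier (St TYPE('b) n)" "a = coset g" "col (\<phi> g) (n - 1) = col M (n - 1)"
    using a by (auto simp: Fib_def)
  have "col M c = col (\<phi> g) c" if "n - 1 \<le> c" "c < n" for c
    using that g(3) by (cases "c = n - 1") auto
  then obtain p where "p \<in> P" "\<phi> (g \<cdot> p) = M" using lift_columns[OF g(1) M, of "n - 1"] by blast
  then show ?thesis using g coset_mult[OF g(1)] P_carrier by (intro bexI[of _ "g \<cdot> p"]) auto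
qed

lemma frame_pair:
  assumes x: "x \<in> frame_simplices TYPE('b) n p" "i \<le> p" "j \<le> p" "x ! i \<noteq> x ! j"
  shows "\<exists>M\<in>carrier (GL TYPE('b) n). col M (n - 1) = x ! i \<and> col M (n - 2) = x ! j"
proof -
  have "i \<noteq> j" using x by auto
  have "\<exists>M\<in>carrier (GL TYPE('b) n). \<forall>a\<in>{n - 1, n - 2}. col M a = x ! (if a = n - 1 then i else j)"
  proof (rule frame_columns[OF x(1)])
    show "inj_on (\<lambda>a. if a = n - 1 then i else j) {n - 1, n - 2}"
      using \<open>i \<noteq> j\<close> by (auto simp: inj_on_def)
  qed (use x idx in auto)
  then show ?thesis using idx(5) by auto
qed

lemma frame_triple:
  assumes x: "x \<in> frame_simplices TYPE('b) n p" "i \<le> p" "j \<le> p" "k \<le> p"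
    and "x ! i \<noteq> x ! j" "x ! j \<noteq> x ! k" "x ! i \<noteq> x ! k"
  shows "\<exists>M\<in>carrier (GL TYPE('b) n). col M (n - 1) = x ! i \<and> col M (n - 2) = x ! j \<and> col M (n - 3) = x ! k"
proof -
  let ?f = "\<lambda>a. if a = n - 1 then i else if a = n - 2 then j else k"
  have ne: "i \<noteq> j" "j \<noteq> k" "i \<noteq> k" using assms by auto
  have "\<exists>M\<in>carrier (GL TYPE('b) n). \<forall>a\<in>{n - 1, n - 2, n - 3}. col M a = x ! ?f a"
  proof (rule frame_columns[OF x(1)])
    show "inj_on ?f {n - 1, n - 2, n - 3}"
      using ne by (auto simp: inj_on_def)
  qed (use x idx in auto)
  then show ?thesis using idx(4-6) by auto
qed

lemma tr_closed:
  assumes x: "x \<in> frame_simplices TYPE('b) n p" "i \<le> p" "j \<le> p" and a: "a \<in> Fib (x ! i)"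
  shows "tr (x ! i) (x ! j) a \<in> Fib (x ! j)"
proof (cases "x ! i = x ! j")
  case True
  then show ?thesis using a by (simp add: tr_def)
next
  case False
  obtain M where M: "M \<in> carrier (GL TYPE('b) n)" "col M (n - 1) = x ! i" "col M (n - 2) = x ! j"
    using frame_pair[OF x] False by blast
  obtain h where h: "h \<in> carrier (St TYPE('b) n)" "a = coset h" "\<phi> h = M"
    using Fib_rep[of a M] a M by auto
  have "tr (x ! i) (x ! j) a = coset (h \<cdot> w1)"
    unfolding h(2) using M h False by (intro tr_coset) auto
  moreover have "col (\<phi> (h \<cdot> w1)) (n - 1) = x ! j" using col_phi_weyl(2)[OF h(1) idx(2,3,5)] h M by simp
  ultimately show ?thesis using h(1) w1_carrier by (auto simp: Fib_def)
qed

text \<open>For three distinct vertices let \<open>h\<close> carry them in columns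
  \<open>n - 1\<close>, \<open>n - 2\<close>, \<open>n - 3\<close>. After the first transport,
  \<open>w2\<close> brings the third vertex into column \<open>n - 2\<close>, so the route through
  the second vertex ends at the coset of \<open>h w1 w2 w1\<close>, and the direct one at that of
  \<open>h w2 w1\<close>. The braid relation makes these differ by \<open>w2\<close>, which lies in
  \<open>P\<close>. If the first and third vertices coincide, \<open>w1\<close> squares to
  one.\<close>

lemma tr_trans:
  assumes x: "x \<in> frame_simplices TYPE('b) n p" "i \<le> p" "j \<le> p" "k \<le> p" and a: "a \<in> Fib (x ! i)"
  shows "tr (x ! j) (x ! k) (tr (x ! i) (x ! j) a) = tr (x ! i) (x ! k) a"
proof (cases "x ! i = x ! j \<or> x ! j = x ! k")
  case True
  then show ?thesis by (auto simp: tr_def)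
next
  case False
  show ?thesis
  proof (cases "x ! i = x ! k")
    case True
    obtain M where M: "M \<in> carrier (GL TYPE('b) n)" "col M (n - 1) = x ! i" "col M (n - 2) = x ! j"
      using frame_pair[OF x(1-3)] False by blast
    obtain h where h: "h \<in> carrier (St TYPE('b) n)" "a = coset h" "\<phi> h = M"
      using Fib_rep[of a M] a M by auto
    have hw: "h \<cdot> w1 \<in> carrier (St TYPE('b) n)" using h w1_carrier by simp
    have "tr (x ! i) (x ! j) a = coset (h \<cdot> w1)"
      unfolding h(2) using M h False by (intro tr_coset) auto
    moreover have "tr (x ! j) (x ! k) (coset (h \<cdot> w1)) = coset (h \<cdot> w1 \<cdot> w1)"
      using col_phi_weyl[OF h(1) idx(2,3,5)] h M False True by (intro tr_coset[OF hw]) auto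
    moreover have "h \<cdot> w1 \<cdot> w1 = h"
      using h(1) w1_carrier weyl_self[of "n - 2" "n - 1"] idx by (simp add: m_assoc)
    ultimately show ?thesis using True h(2) by (simp add: tr_def)
  next
    case ik: False
    obtain M where M: "M \<in> carrier (GL TYPE('b) n)" "col M (n - 1) = x ! i" "col M (n - 2) = x ! j"
        "col M (n - 3) = x ! k"
      using frame_triple[OF x] False ik by blast
    obtain h where h: "h \<in> carrier (St TYPE('b) n)" "a = coset h" "\<phi> h = M"
      using Fib_rep[of a M] a M by auto
    have w2: "w2 \<in> carrier (St TYPE('b) n)" using w2_P P_carrier by simp
    note c = h(1) w1_carrier w2
    have hw: "h \<cdot> w1 \<in> carrier (St TYPE('b) n)" "h \<cdot> w2 \<in> carrier (St TYPE('b) n)"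
      "h \<cdot> w1 \<cdot> w2 \<in> carrier (St TYPE('b) n)" using c by auto
    have 1: "tr (x ! i) (x ! j) a = coset (h \<cdot> w1)"
      unfolding h(2) using M h False by (intro tr_coset) auto
    note c1 = col_phi_weyl[OF h(1) idx(2,3,5)]
    note c12 = col_phi_weyl[OF hw(1) idx(1,2,4)]
    note c2 = col_phi_weyl[OF h(1) idx(1,2,4)]
    have "tr (x ! j) (x ! k) (coset (h \<cdot> w1 \<cdot> w2)) = coset (h \<cdot> w1 \<cdot> w2 \<cdot> w1)"
      using c1(2) c1(3)[of "n - 3"] c12(2) c12(3)[of "n - 1"] h M False idx
      by (intro tr_coset[OF hw(3)]) auto
    then have 2: "tr (x ! j) (x ! k) (coset (h \<cdot> w1)) = coset (h \<cdot> w1 \<cdot> w2 \<cdot> w1)"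
      using coset_mult[OF hw(1) w2_P] by simp
    have "tr (x ! i) (x ! k) (coset (h \<cdot> w2)) = coset (h \<cdot> w2 \<cdot> w1)"
      using c2(2) c2(3)[of "n - 1"] h M ik idx by (intro tr_coset[OF hw(2)]) auto
    then have 3: "tr (x ! i) (x ! k) a = coset (h \<cdot> w2 \<cdot> w1)"
      using coset_mult[OF h(1) w2_P] h(2) by simp
    have "w1 \<cdot> (w2 \<cdot> w1) = w2 \<cdot> (w1 \<cdot> w2)" using idx by (intro weyl_braid) auto
    then have "h \<cdot> w1 \<cdot> w2 \<cdot> w1 = h \<cdot> w2 \<cdot> w1 \<cdot> w2" using c by (simp add: m_assoc)
    then show ?thesis unfolding 1 2 3 using coset_mult[of "h \<cdot> w2 \<cdot> w1", OF _ w2_P] c by simp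
  qed
qed

text \<open>A repeated column of \<open>M\<close> would repeat a column of the identity matrix. The
  lemma keeps the edges used below out of the case \<open>v = w\<close> of
  \<open>tr\<close>.\<close>

lemma GL_cols_distinct:
  assumes M: "M \<in> carrier (GL TYPE('b) n)" and ij: "i < n" "j < n" "i \<noteq> j"
  shows "col M i \<noteq> col M j"
proof
  assume eq: "col M i = col M j"
  obtain N where N: "N \<in> carrier_mat n n" "N * M = 1\<^sub>m n" using M by (auto simp: carrier_GL)
  have "col (1\<^sub>m n) i = (col (1\<^sub>m n) j :: 'b vec)"
    using col_mult2[OF N(1) GL_carrier_mat[OF M]] ij eq N(2) by metis
  from arg_cong[OF this, of "\<lambda>v. v $ i"] show False using ij nontrivial by simp
qed

section \<open>The global section and the isomorphism\<close>

theorem phi_iso: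
  assumes sc: "simply_connected_space (geometric_realization (frame_simplices TYPE('b) n) frame_face)"
  shows "\<phi> \<in> iso (St TYPE('b) n) (GL TYPE('b) n)"
proof -
  interpret V: vector_simplices "frame_simplices TYPE('b) n"
    using semisimplicial_set_frames[of "TYPE('b)" n]
    by unfold_locales (auto simp: frame_simplices_def semisimplicial_set_def)
  let ?e = "col (\<phi> \<one>\<^bsub>St TYPE('b) n\<^esub>) (n - 1)"
  have vertex: "[col M (n - 1)] \<in> frame_simplices TYPE('b) n 0" if "M \<in> carrier (GL TYPE('b) n)" for M
    using columns_frame_simplices[OF that, of "[n - 1]" 0] idx by simp
  have edge: "[col M (n - 1), col M (n - 2)] \<in> frame_simplices TYPE('b) n 1" if "M \<in> carrier (GL TYPE('b) n)" for M
    using columns_frame_simplices[OF that, of "[n - 1, n - 2]" 1] idx by simp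
  have "\<exists>\<sigma>. \<sigma> ?e = coset \<one>\<^bsub>St TYPE('b) n\<^esub> \<and> (\<forall>v. [v] \<in> frame_simplices TYPE('b) n 0 \<longrightarrow> \<sigma> v \<in> Fib v) \<and>
      (\<forall>v w. [v, w] \<in> frame_simplices TYPE('b) n 1 \<longrightarrow> \<sigma> w = tr v w (\<sigma> v))"
  proof (rule V.simply_connected_section[OF sc, where Fib = Fib and tr = tr])
    show "tr (x ! i) (x ! j) a \<in> Fib (x ! j)"
      if "x \<in> frame_simplices TYPE('b) n p" "i \<le> p" "j \<le> p" "a \<in> Fib (x ! i)" for p x i j a
      using that by (rule tr_closed)
    show "tr (x ! j) (x ! k) (tr (x ! i) (x ! j) a) = tr (x ! i) (x ! k) a"
      if "x \<in> frame_simplices TYPE('b) n p" "i \<le> p" "j \<le> p" "k \<le> p" "a \<in> Fib (x ! i)" for p x i j k a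
      using that by (rule tr_trans)
    show "tr v v a = a" for v a by (simp add: tr_def)
    show "[?e] \<in> frame_simplices TYPE('b) n 0" by (rule vertex[OF phi_GL]) simp
    show "coset \<one>\<^bsub>St TYPE('b) n\<^esub> \<in> Fib ?e" unfolding Fib_def by blast
  qed
  then obtain \<sigma> where \<sigma>: "\<sigma> ?e = coset \<one>\<^bsub>St TYPE('b) n\<^esub>"
    "\<And>v. [v] \<in> frame_simplices TYPE('b) n 0 \<Longrightarrow> \<sigma> v \<in> Fib v"
    "\<And>v w. [v, w] \<in> frame_simplices TYPE('b) n 1 \<Longrightarrow> \<sigma> w = tr v w (\<sigma> v)" by blast
  \<comment> \<open>\<open>D\<close> collects the elements at whose vertex the section takes the
    expected value, and \<open>M\<close> consists of the elements whose right multiplication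
    preserves \<open>D\<close>. Closure of \<open>M\<close> under products is immediate, and
    \<open>cols_weyl_generate\<close> asks for no inverses.\<close>
  define D where "D = {g \<in> carrier (St TYPE('b) n). \<sigma> (col (\<phi> g) (n - 1)) = coset g}"
  define M where "M = {x \<in> carrier (St TYPE('b) n). \<forall>g\<in>D. g \<cdot> x \<in> D}"
  have M_all: "M = carrier (St TYPE('b) n)"
  proof (rule cols_weyl_generate[OF n])
    show "M \<subseteq> carrier (St TYPE('b) n)" by (auto simp: M_def)
    show "x \<cdot> y \<in> M" if "x \<in> M" "y \<in> M" for x y
      using that by (auto simp: M_def D_def m_assoc[symmetric])
    show "P \<subseteq> M"
    proof
      fix p assume p: "p \<in> P"
      have "g \<cdot> p \<in> D" if g: "g \<in> D" for g
        using g col_phi_cols[OF p, of g "n - 1"] coset_mult[of g p] p P_carrier idx by (auto simp: D_def)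
      then show "p \<in> M" using p P_carrier by (simp add: M_def)
    qed
    have "g \<cdot> w1 \<in> D" if g: "g \<in> D" for g
    proof -
      have gc: "g \<in> carrier (St TYPE('b) n)" "\<sigma> (col (\<phi> g) (n - 1)) = coset g" using g by (auto simp: D_def)
      \<comment> \<open>The edge from the last column to the one before it: flatness of the section
        along it is exactly the step from \<open>g\<close> to \<open>g w1\<close>.\<close>
      have "\<sigma> (col (\<phi> g) (n - 2)) = tr (col (\<phi> g) (n - 1)) (col (\<phi> g) (n - 2)) (coset g)"
        using \<sigma>(3)[OF edge[OF phi_GL[OF gc(1)]]] gc(2) by simp
      also have "\<dots> = coset (g \<cdot> w1)"
        using GL_cols_distinct[OF phi_GL[OF gc(1)]] idx by (intro tr_coset gc) auto
      finally show ?thesis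
        using col_phi_weyl(2)[OF gc(1) idx(2,3,5)] gc(1) w1_carrier by (simp add: D_def)
    qed
    then show "w1 \<in> M" using w1_carrier by (simp add: M_def)
  qed
  have one: "\<one>\<^bsub>St TYPE('b) n\<^esub> \<in> D" using \<sigma>(1) by (simp add: D_def)
  have D: "\<sigma> (col (\<phi> g) (n - 1)) = coset g" if g: "g \<in> carrier (St TYPE('b) n)" for g
  proof -
    have "g \<in> M" using M_all g by blast
    then have "\<one>\<^bsub>St TYPE('b) n\<^esub> \<cdot> g \<in> D" using one unfolding M_def by blast
    then show ?thesis using g by (simp add: D_def)
  qed
  have "inj_on \<phi> (carrier (St TYPE('b) n))"
  proof (rule inj_onI)
    fix g h assume g: "g \<in> carrier (St TYPE('b) n)" and h: "h \<in> carrier (St TYPE('b) n)" and eq: "\<phi> g = \<phi> h"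
    \<comment> \<open>Equal matrices have the same last column, and the section has a single value
      there.\<close>
    have "h \<in> coset g" using D[OF g] D[OF h] eq coset_self[OF h] by simp
    then obtain p where p: "p \<in> P" "h = g \<cdot> p" by (auto simp: coset_def)
    have "\<phi> g * \<phi> p = \<phi> h" unfolding p(2) by (rule phi_mult[OF g P_carrier[OF p(1)], symmetric])
    also have "\<dots> = \<phi> g * \<phi> \<one>\<^bsub>St TYPE('b) n\<^esub>"
      unfolding phi_one right_mult_one_mat[OF phi_carrier[OF g]] by (rule eq[symmetric])
    finally have "\<phi> p = \<phi> \<one>\<^bsub>St TYPE('b) n\<^esub>"
      using GL_cancel[of "\<phi> g" n "\<phi> p" "\<phi> \<one>\<^bsub>St TYPE('b) n\<^esub>"] phi_GL phi_carrier g p(1) P_carrier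
      by simp
    then have "p = \<one>\<^bsub>St TYPE('b) n\<^esub>" using phi_inj_cols[OF p(1)] phi_one by simp
    then show "g = h" using p(2) g by simp
  qed
  moreover have "\<phi> ` carrier (St TYPE('b) n) = carrier (GL TYPE('b) n)"
  proof
    show "carrier (GL TYPE('b) n) \<subseteq> \<phi> ` carrier (St TYPE('b) n)"
    proof
      \<comment> \<open>The section provides an element of the fibre over the last column of
        \<open>A\<close>; a representative of it can be adjusted to have matrix
        \<open>A\<close>.\<close>
      fix A assume A: "A \<in> carrier (GL TYPE('b) n)"
      then show "A \<in> \<phi> ` carrier (St TYPE('b) n)"
        using Fib_rep[OF \<sigma>(2)[OF vertex[OF A]] A] by blast
    qed
  qed (use phi_GL in blast)
  ultimately show ?thesis using phi_hom by (simp add: iso_def bij_betw_def)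
qed

end

theorem theorem5p1:
  fixes n :: nat
  assumes "CHAR('b::ring_1) = 2"
    and "n \<ge> 4"
    and "carrier (GL TYPE('b) (n - 1)) = elem_group TYPE('b) (n - 1)"
    and "carrier (GL TYPE('b) (n - 2)) = elem_group TYPE('b) (n - 2)"
    and "stab TYPE('b) (n - 1) ` st_ker TYPE('b) (n - 1) = {\<one>\<^bsub>St TYPE('b) n\<^esub>}"
    and "simply_connected_space (geometric_realization (frame_simplices TYPE('b) n) frame_face)"
  shows "phi TYPE('b) n \<in> iso (St TYPE('b) n) (GL TYPE('b) n)"
proof -
  have two: "(2 :: 'b) = 0" using of_nat_CHAR[where 'a='b] assms(1) by simp
  \<comment> \<open>In the zero ring \<open>CHAR\<close> divides 1.\<close>
  have "(0 :: 'b) \<noteq> 1"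
  proof
    assume "(0 :: 'b) = 1"
    then have "CHAR('b) dvd 1" using of_nat_eq_0_iff_char_dvd[where 'a='b, of 1] by simp
    then show False using assms(1) by simp
  qed
  moreover have "a + a = 0" for a :: 'b using two mult_2[of a] by simp
  moreover have "stab TYPE('b) (n - 1) y = \<one>\<^bsub>St TYPE('b) n\<^esub>" if "y \<in> st_ker TYPE('b) (n - 1)" for y
    using that assms(5) by blast
  ultimately interpret steinberg_frames "TYPE('b)" n
    using assms(2-4) by unfold_locales auto
  show ?thesis by (rule phi_iso[OF assms(6)])
qed

end
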